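(* Let $\Omega=B_1\subset\mathbb{R}^n$, with $n\ge 2$. Let $\Gamma\subset B_1$ be any closed $C^1$ hypersurface satisfying $$\Gamma\cap B_{1/4}=\left\{x=(x',x_n)\in B_{1/4}: x_n=\frac{|x'|}{|\log|x'||}\right\}$$ (where the right-hand side of the equation is understood as $0$ for $x'=0$), and let $g\equiv1$. Then the unique weak solution $u$ to $$\Delta u=g\,dH^{n-1}|_\Gamma\ \text{ in }\Omega,\qquad u=0\ \text{ on }\partial\Omega,$$ is not locally Lipschitz in $B_1$.
   Context: $B_r\subset\mathbb{R}^n$ is the open ball of radius $r$ centered at $0$, and $x=(x',x_n)$ with $x'\in\mathbb{R}^{n-1}$. A closed hypersurface is a compact hypersurface without boundary. $dH^{n-1}|_\Gamma$ is the Hausdorff measure restricted to $\Gamma$. Weak solution: $u\in C(\overline\Omega)$ with $u=0$ on $\partial\Omega$ and $\int_\Omega u\Delta\varphi\,dx=\int_\Gamma g\varphi\,dH^{n-1}$ for all $\varphi\in C_c^\infty(\Omega)$. *)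

theory Defs
  imports "HOL-Analysis.Analysis"
begin

definition partial :: "'n::finite \<Rightarrow> (real^'n \<Rightarrow> real) \<Rightarrow> real^'n \<Rightarrow> real" where
  "partial i f x = frechet_derivative f (at x) (axis i 1)"

text \<open>\<open>Ck_on k S f\<close> is meant for open \<open>S\<close>, since derivatives are taken in the whole space.\<close>

fun Ck_on :: "nat \<Rightarrow> (real^'n::finite) set \<Rightarrow> (real^'n \<Rightarrow> real) \<Rightarrow> bool" where
  "Ck_on 0 S f \<longleftrightarrow> continuous_on S f"
| "Ck_on (Suc k) S f \<longleftrightarrow> (\<forall>x\<in>S. f differentiable (at x)) \<and> (\<forall>i. Ck_on k S (partial i f))"

definition laplacian :: "(real^'n::finite \<Rightarrow> real) \<Rightarrow> real^'n \<Rightarrow> real" where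
  "laplacian f x = (\<Sum>i\<in>UNIV. partial i (partial i f) x)"

text \<open>The elements of \<open>C\<^sub>c\<^sup>\<infinity>(\<Omega>)\<close>, extended by zero to the whole space.\<close>

definition test_functions :: "(real^'n::finite) set \<Rightarrow> (real^'n \<Rightarrow> real) set" where
  "test_functions \<Omega> = {\<phi>. (\<forall>k. Ck_on k UNIV \<phi>) \<and>
     compact (closure {x. \<phi> x \<noteq> 0}) \<and> closure {x. \<phi> x \<noteq> 0} \<subseteq> \<Omega>}"

definition locally_lipschitz_on :: "'a::metric_space set \<Rightarrow> ('a \<Rightarrow> 'b::metric_space) \<Rightarrow> bool" where
  "locally_lipschitz_on S f \<longleftrightarrow> (\<forall>x\<in>S. \<exists>r>0. \<exists>L. L-lipschitz_on (ball x r \<inter> S) f)"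

text \<open>
  The normalisation is the usual one, under which the \<open>n\<close>-dimensional Hausdorff measure
  on Euclidean \<open>n\<close>-space is Lebesgue measure.  The empty set is treated separately because
  \<open>0 ^ 0 = 1\<close>, which is the right weight for a singleton in dimension 0 only.
\<close>

definition hausdorff_weight :: "nat \<Rightarrow> 'a::metric_space set \<Rightarrow> real" where
  "hausdorff_weight m C = (if C = {} then 0 else unit_ball_vol (real m) * (diameter C / 2) ^ m)"

text \<open>Boundedness is required explicitly: \<^const>\<open>diameter\<close> is unspecified on unbounded sets.\<close>

definition hausdorff_covers :: "real \<Rightarrow> 'a::metric_space set \<Rightarrow> (nat \<Rightarrow> 'a set) set" where
  "hausdorff_covers \<delta> A =
     {C. A \<subseteq> (\<Union>j. C j) \<and> (\<forall>j. bounded (C j) \<and> diameter (C j) \<le> \<delta>)}"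

definition hausdorff_outer :: "nat \<Rightarrow> 'a::metric_space set \<Rightarrow> ennreal" where
  "hausdorff_outer m A =
     (SUP \<delta>\<in>{0<..}. INF C\<in>hausdorff_covers \<delta> A. \<Sum>j. ennreal (hausdorff_weight m (C j)))"

definition hausdorff_measure :: "nat \<Rightarrow> 'a::metric_space measure" where
  "hausdorff_measure m = measure_of UNIV (sets borel) (hausdorff_outer m)"

text \<open>
  The point \<open>x'\<close> of the decomposition \<open>x = (x', x\<^sub>k)\<close>, viewed inside the coordinate hyperplane
  \<open>x\<^sub>k = 0\<close>.
\<close>

definition horizontal :: "'n::finite \<Rightarrow> real^'n \<Rightarrow> real^'n" where
  "horizontal k x = (\<chi> i. if i = k then 0 else x $ i)"

text \<open>
  A \<open>C\<^sup>1\<close> hypersurface without boundary is locally, up to a choice of the coordinate axis \<open>k\<close>,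
  the graph of a \<open>C\<^sup>1\<close> function of the remaining coordinates.  Only the values of \<open>f\<close> on the
  hyperplane \<open>x\<^sub>k = 0\<close> matter; a \<open>C\<^sup>1\<close> function on that hyperplane is the restriction of one
  on the whole space that does not depend on \<open>x\<^sub>k\<close>.
\<close>

definition C1_hypersurface :: "(real^'n::finite) set \<Rightarrow> bool" where
  "C1_hypersurface \<Gamma> \<longleftrightarrow>
     (\<forall>p\<in>\<Gamma>. \<exists>U k f. open U \<and> p \<in> U \<and> Ck_on 1 UNIV f \<and>
        \<Gamma> \<inter> U = {x \<in> U. x $ k = f (horizontal k x)})"

definition closed_C1_hypersurface :: "(real^'n::finite) set \<Rightarrow> bool" where
  "closed_C1_hypersurface \<Gamma> \<longleftrightarrow> compact \<Gamma> \<and> C1_hypersurface \<Gamma>"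

text \<open>
  Weak solutions of \<open>\<Delta>u = g dH\<^sup>n\<^sup>-\<^sup>1|\<^sub>\<Gamma>\<close> in \<open>\<Omega>\<close>, \<open>u = 0\<close> on the boundary.  Functions in
  \<open>C(closure \<Omega>)\<close> are represented by total functions; the values of \<open>u\<close> outside
  \<open>closure \<Omega>\<close> are irrelevant.
\<close>

definition weak_solution ::
  "(real^'n::finite) set \<Rightarrow> (real^'n) set \<Rightarrow> (real^'n \<Rightarrow> real) \<Rightarrow> (real^'n \<Rightarrow> real) \<Rightarrow> bool" where
  "weak_solution \<Omega> \<Gamma> g u \<longleftrightarrow>
     continuous_on (closure \<Omega>) u \<and> (\<forall>x\<in>frontier \<Omega>. u x = 0) \<and>
     (\<forall>\<phi>\<in>test_functions \<Omega>.
        (LINT x:\<Omega>|lborel. u x * laplacian \<phi> x) =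
        (LINT x:\<Gamma>|hausdorff_measure (CARD('n) - 1). g x * \<phi> x))"

end

theory Submission
  imports Defs
begin

text \<open>
  The solution is the Green potential of the surface measure. The profile of the fundamental solution
  is regularised to a smooth \<open>P\<^sub>e\<close> with \<open>P\<^sub>e' (t) = t powr (- n/2) * Q (t / e\<^sup>2)\<close> for a smooth step \<open>Q\<close>.
  Then \<open>P\<^sub>e (|x|\<^sup>2)\<close> agrees with the fundamental solution for \<open>|x| \<ge> e\<close>, its Laplacian is a nonnegative
  kernel supported in the ball of radius \<open>e\<close>, and differences \<open>P\<^sub>e - P\<^sub>r\<close> give compactly supported test
  functions. These yield Weyl's lemma in the form of a maximum principle, hence uniqueness; and the
  potentials of \<open>P\<^sub>e\<close> converge uniformly, since the area of \<open>\<Gamma>\<close> in a ball of radius \<open>r\<close> is \<open>O(r\<^sup>n\<^sup>-\<^sup>1)\<close>,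
  hence existence.

  For the failure of the Lipschitz bound the equation is tested with the truncated dipole
  \<open>\<phi>\<^sub>e = x\<^sub>k (P\<^sub>e' - P\<^sub>R') (|x|\<^sup>2)\<close>. Its Laplacian is odd, of size \<open>e\<^sup>-\<^sup>n\<^sup>-\<^sup>1\<close> on the ball of radius \<open>e\<close>, plus a fixed
  term, so a function that is Lipschitz at the origin gives bounded left-hand sides. On the cusp,
  however, \<open>\<phi>\<^sub>e\<close> is nonnegative and comparable to \<open>|x|\<^sup>1\<^sup>-\<^sup>n / |log |x||\<close>, so the dyadic shell of radius
  \<open>2\<^sup>-\<^sup>j\<close> contributes about \<open>1/j\<close>, and the harmonic series diverges.
\<close>

section \<open>Smooth functions of one variable\<close>

text \<open>The dipole is half of the \<open>k\<close>-th derivative of the fundamental solution, so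
  testing with it reads off that derivative of \<open>u\<close> at the origin as an integral of
  \<open>x_k / |x|^n\<close> over the surface. For a graph of height \<open>h(s)\<close> at distance
  \<open>s\<close> this is comparable to the integral of \<open>h(s) / s^2 ds\<close>. With
  \<open>h(s) = s / |log s|\<close> it becomes \<open>ds / (s |log s|)\<close>, the borderline
  failure of the Dini condition: a surface can be C^1 and still force an unbounded gradient.

  Radial functions are written in \<open>t = |x|^2\<close>, a polynomial in the coordinates.
  Smoothness thus reduces to one real variable, also at the origin, and the Laplacian becomes
  \<open>4 t P'' + 2 n P'\<close>. Polar coordinates never occur: that Laplacians of test functions
  integrate to zero already shows that all kernels have the same mass, which is divided out without
  being computed. The Hausdorff measure is only given through coverings, so its additivity on Borel
  sets and both comparisons with powers of the radius are derived from coverings as well.\<close>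

lemma ex_abs_bound_on_compact:
  fixes f :: "'a::topological_space \<Rightarrow> real"
  assumes "compact S" "continuous_on S f"
  shows "\<exists>B\<ge>0. \<forall>x\<in>S. \<bar>f x\<bar> \<le> B"
proof -
  have "bounded (f ` S)" using assms by (intro compact_imp_bounded compact_continuous_image)
  then obtain B where "\<forall>y\<in>f ` S. \<bar>y\<bar> \<le> B" by (auto simp: bounded_real)
  then show ?thesis by (intro exI[of _ "max B 0"]) auto
qed

text \<open>Derivatives are carried as existential witnesses, so closure properties are proved by
  exhibiting the derivative and never need differentiability side conditions.\<close>

fun Ck_real :: "nat \<Rightarrow> real set \<Rightarrow> (real \<Rightarrow> real) \<Rightarrow> bool" where
  "Ck_real 0 S f \<longleftrightarrow> continuous_on S f"
| "Ck_real (Suc k) S f \<longleftrightarrow>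
     (\<exists>f'. (\<forall>t\<in>S. (f has_real_derivative f' t) (at t)) \<and> Ck_real k S f')"

lemma Ck_real_Suc_imp: "Ck_real (Suc k) S f \<Longrightarrow> Ck_real k S f"
proof (induction k arbitrary: f)
  case 0
  then show ?case
    using DERIV_isCont by (fastforce intro!: continuous_at_imp_continuous_on)
next
  case (Suc k)
  then obtain f' where "\<forall>t\<in>S. (f has_real_derivative f' t) (at t)" "Ck_real (Suc k) S f'"
    by auto
  with Suc.IH[of f'] show ?case by auto
qed

lemma Ck_real_const: "Ck_real k S (\<lambda>_. c)"
proof (induction k arbitrary: c)
  case (Suc k)
  show ?case using Suc[of 0] by (auto intro!: exI[of _ "\<lambda>_. 0"])
qed auto

lemma Ck_real_add:
  "Ck_real k S f \<Longrightarrow> Ck_real k S g \<Longrightarrow> Ck_real k S (\<lambda>t. f t + g t)"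
proof (induction k arbitrary: f g)
  case (Suc k)
  from Suc.prems obtain f' g' where
    "\<forall>t\<in>S. (f has_real_derivative f' t) (at t)" "Ck_real k S f'"
    "\<forall>t\<in>S. (g has_real_derivative g' t) (at t)" "Ck_real k S g'" by auto
  then show ?case using Suc.IH[of f' g']
    by (auto intro!: exI[of _ "\<lambda>t. f' t + g' t"] derivative_intros)
qed (auto intro: continuous_on_add continuous_on_mult)

lemma Ck_real_mult:
  "Ck_real k S f \<Longrightarrow> Ck_real k S g \<Longrightarrow> Ck_real k S (\<lambda>t. f t * g t)"
proof (induction k arbitrary: f g)
  case (Suc k)
  from Suc.prems obtain f' g' where *:
    "\<forall>t\<in>S. (f has_real_derivative f' t) (at t)" "Ck_real k S f'"
    "\<forall>t\<in>S. (g has_real_derivative g' t) (at t)" "Ck_real k S g'" by auto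
  have "Ck_real k S f" "Ck_real k S g" using Suc.prems Ck_real_Suc_imp by blast+
  then have "Ck_real k S (\<lambda>t. f' t * g t + g' t * f t)"
    using Suc.IH * by (intro Ck_real_add) auto
  then show ?case using *
    by (auto intro!: exI[of _ "\<lambda>t. f' t * g t + g' t * f t"] DERIV_mult)
qed (auto intro: continuous_on_add continuous_on_mult)

lemma Ck_real_cong:
  assumes "open S" "\<And>t. t \<in> S \<Longrightarrow> f t = g t" "Ck_real k S f"
  shows "Ck_real k S g"
proof (cases k)
  case 0
  then show ?thesis using assms continuous_on_cong by (metis Ck_real.simps(1))
next
  case (Suc k')
  then obtain f' where f': "\<forall>t\<in>S. (f has_real_derivative f' t) (at t)" "Ck_real k' S f'"
    using assms(3) by auto
  have "(g has_real_derivative f' t) (at t)" if "t \<in> S" for t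
    using has_field_derivative_transform_within_open[OF _ assms(1) that, of f "f' t" g]
      f' that assms(2) by auto
  with f' Suc show ?thesis by auto
qed

text \<open>On the overlap the two witnesses agree by uniqueness of derivatives, so they glue to a
  single one.\<close>

lemma Ck_real_Un:
  assumes "open S" "open T"
  shows "Ck_real k S f \<Longrightarrow> Ck_real k T f \<Longrightarrow> Ck_real k (S \<union> T) f"
proof (induction k arbitrary: f)
  case 0
  then show ?case using assms by (auto intro: continuous_on_open_Un)
next
  case (Suc k)
  from Suc.prems obtain f' g' where *:
    "\<forall>t\<in>S. (f has_real_derivative f' t) (at t)" "Ck_real k S f'"
    "\<forall>t\<in>T. (f has_real_derivative g' t) (at t)" "Ck_real k T g'" by auto
  define h where "h t = (if t \<in> S then f' t else g' t)" for t
  have hT: "h t = g' t" if "t \<in> T" for t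
    using * that DERIV_unique by (fastforce simp: h_def)
  have "Ck_real k S h" "Ck_real k T h"
    using Ck_real_cong[OF assms(1) _ *(2), of h] Ck_real_cong[OF assms(2) _ *(4), of h] hT
    by (auto simp: h_def)
  moreover have "\<forall>t\<in>S\<union>T. (f has_real_derivative h t) (at t)"
    using *(1,3) hT by (auto simp: h_def)
  ultimately show ?case using Suc.IH by auto
qed

lemma Ck_real_subset: "Ck_real k S f \<Longrightarrow> T \<subseteq> S \<Longrightarrow> Ck_real k T f"
proof (induction k arbitrary: f)
  case 0 then show ?case using continuous_on_subset by auto
next
  case (Suc k)
  then obtain f' where "\<forall>t\<in>S. (f has_real_derivative f' t) (at t)" "Ck_real k S f'" by auto
  with Suc.IH[of f'] Suc.prems(2) show ?case by auto
qed

lemma Ck_real_affine: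
  assumes "Ck_real k UNIV f" shows "Ck_real k UNIV (\<lambda>t. f (c * t + d))"
  using assms
proof (induction k arbitrary: f)
  case 0
  then show ?case by (auto intro!: continuous_intros continuous_on_compose2[of UNIV f])
next
  case (Suc k)
  from Suc.prems obtain f' where f': "\<forall>t. (f has_real_derivative f' t) (at t)" "Ck_real k UNIV f'"
    by auto
  have "((\<lambda>t. f (c * t + d)) has_real_derivative f' (c * t + d) * c) (at t)" for t
    by (rule DERIV_chain2[of f]) (use f' in \<open>auto intro!: derivative_eq_intros\<close>)
  moreover have "Ck_real k UNIV (\<lambda>t. f' (c * t + d) * c)"
    using Suc.IH[OF f'(2)] by (intro Ck_real_mult Ck_real_const)
  ultimately show ?case by (auto intro!: exI[of _ "\<lambda>t. f' (c * t + d) * c"])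
qed

lemma Ck_real_powr: "Ck_real k {0<..} (\<lambda>t. t powr a)"
proof (induction k arbitrary: a)
  case 0
  then show ?case by (auto intro!: continuous_intros)
next
  case (Suc k)
  have "Ck_real k {0<..} (\<lambda>t. a * t powr (a - 1))"
    by (intro Ck_real_mult Ck_real_const Suc.IH)
  then show ?case by (auto intro!: exI[of _ "\<lambda>t. a * t powr (a - 1)"] has_real_derivative_powr)
qed

text \<open>The factor \<open>1 / t ^ m\<close> makes the family closed under differentiation up to
  linear combinations, so smoothness of all members follows by one induction.\<close>

definition flat_exp :: "nat \<Rightarrow> real \<Rightarrow> real" where
  "flat_exp m t = (if t \<le> 0 then 0 else exp (- (1/t)) / t ^ m)"

lemma flat_exp_tendsto: "(flat_exp m \<longlongrightarrow> 0) (at 0)"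
proof -
  \<comment> \<open>Substituting \<open>x = 1/t\<close> turns the right-hand limit at 0 into the
    decay of \<open>x ^ m / exp x\<close> at infinity.\<close>
  have "((\<lambda>x::real. x ^ m / exp x) \<longlongrightarrow> 0) at_top" by (rule tendsto_power_div_exp_0)
  then have "((\<lambda>t. inverse t ^ m / exp (inverse t)) \<longlongrightarrow> 0) (at_right (0::real))"
    by (rule filterlim_compose[OF _ filterlim_inverse_at_top_right])
  then have "(flat_exp m \<longlongrightarrow> 0) (at_right 0)"
    by (rule Lim_transform_eventually)
      (auto simp: flat_exp_def eventually_at_right_field exp_minus field_simps intro!: exI[of _ 1])
  moreover have "(flat_exp m \<longlongrightarrow> 0) (at_left 0)"
    by (rule Lim_transform_eventually[OF tendsto_const])
      (auto simp: flat_exp_def eventually_at_left_field intro!: exI[of _ "-1"])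
  ultimately show ?thesis by (simp add: filterlim_at_split)
qed

lemma flat_exp_deriv:
  "(flat_exp m has_real_derivative flat_exp (m + 2) t - m * flat_exp (m + 1) t) (at t)"
proof -
  consider "t < 0" | "t = 0" | "t > 0" by linarith
  then show ?thesis
  proof cases
    case 1
    have "((\<lambda>_. 0) has_real_derivative 0) (at t)" by simp
    then have "(flat_exp m has_real_derivative 0) (at t)"
      by (rule has_field_derivative_transform_within_open[where S="{..<0}"])
        (use 1 in \<open>auto simp: flat_exp_def\<close>)
    then show ?thesis using 1 by (simp add: flat_exp_def)
  next
    case 2
    \<comment> \<open>At the origin the difference quotient is itself a member of the family, also
      for \<open>h <= 0\<close>, where both sides are 0.\<close>
    have "(\<lambda>h. (flat_exp m (0 + h) - flat_exp m 0) / h) = flat_exp (m + 1)"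
      by (auto simp: flat_exp_def fun_eq_iff)
    then show ?thesis using flat_exp_tendsto[of "m + 1"] 2
      by (simp add: DERIV_def) (simp add: flat_exp_def)
  next
    case 3
    have e: "((\<lambda>t. exp (- (1/t))) has_real_derivative exp (- (1/t)) * t powr (- 2)) (at t)"
      using 3 by (auto intro!: derivative_eq_intros simp: powr_minus_divide power2_eq_square)
    have p: "((\<lambda>t. t powr (- real m)) has_real_derivative (- real m) * t powr (- real m - 1)) (at t)"
      using 3 by (rule has_real_derivative_powr)
    have pw: "t powr (- real j) = 1 / t ^ j" if "t > 0" for t j
      using that by (simp add: powr_minus_divide powr_realpow)
    have p2: "t powr (-2) * t powr (- real m) = 1 / t ^ (m + 2)"
      using 3 pw[of t "m + 2"] by (simp add: powr_add[symmetric])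
    have p1: "t powr (- real m - 1) = 1 / t ^ (m + 1)"
    proof -
      have "- real m - 1 = - real (m + 1)" by simp
      then show ?thesis using pw[OF 3, of "m + 1"] by (simp only: power_add power_one_right)
    qed
    have "((\<lambda>t. exp (- (1/t)) * t powr (- real m)) has_real_derivative
        exp (- (1/t)) / t ^ (m + 2) - m * (exp (- (1/t)) / t ^ (m + 1))) (at t)"
    proof (rule DERIV_cong[OF DERIV_mult[OF e p]])
      show "exp (- (1 / t)) * t powr - 2 * t powr - real m +
          - real m * t powr (- real m - 1) * exp (- (1 / t)) =
        exp (- (1 / t)) / t ^ (m + 2) - real m * (exp (- (1 / t)) / t ^ (m + 1))"
        unfolding mult.assoc p1 p2 by simp
    qed
    then have "(flat_exp m has_real_derivative
        exp (- (1/t)) / t ^ (m + 2) - m * (exp (- (1/t)) / t ^ (m + 1))) (at t)"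
      by (rule has_field_derivative_transform_within_open[where S="{0<..}"])
        (use 3 pw in \<open>auto simp: flat_exp_def\<close>)
    then show ?thesis using 3 by (simp add: flat_exp_def)
  qed
qed

lemma Ck_real_flat_exp: "Ck_real k UNIV (flat_exp m)"
proof (induction k arbitrary: m)
  case 0
  have "isCont (flat_exp m) t" for t
    using flat_exp_deriv DERIV_isCont by blast
  then show ?case by (simp add: continuous_at_imp_continuous_on)
next
  case (Suc k)
  have "Ck_real k UNIV (\<lambda>t. flat_exp (m + 2) t + (- real m) * flat_exp (m + 1) t)"
    by (intro Ck_real_add Ck_real_mult Ck_real_const Suc.IH)
  then show ?case using flat_exp_deriv[of m]
    by (auto intro!: exI[of _ "\<lambda>t. flat_exp (m + 2) t + (- real m) * flat_exp (m + 1) t"])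
qed

lemma continuous_imp_antiderivative:
  fixes f :: "real \<Rightarrow> real"
  assumes "continuous_on UNIV f"
  shows "\<exists>F. \<forall>t. (F has_real_derivative f t) (at t)"
proof -
  have "\<exists>F. \<forall>x. -\<infinity> < ereal x \<longrightarrow> ereal x < \<infinity> \<longrightarrow> (F has_vector_derivative f x) (at x)"
    using assms by (intro einterval_antiderivative) (auto simp: continuous_on_eq_continuous_at)
  then show ?thesis by (simp add: has_real_derivative_iff_has_vector_derivative)
qed

lemma constant_on_Icc_if_DERIV_zero:
  fixes f :: "real \<Rightarrow> real"
  assumes "a \<le> b" "\<And>t. a \<le> t \<Longrightarrow> t \<le> b \<Longrightarrow> (f has_real_derivative 0) (at t)"
  shows "f a = f b"
proof (rule antisym)
  show "f a \<le> f b" by (rule DERIV_nonneg_imp_nondecreasing) (use assms in force)+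
  show "f b \<le> f a" by (rule DERIV_nonpos_imp_nonincreasing) (use assms in force)+
qed

text \<open>The thresholds 1/4 and 1 are the squares of 1/2 and 1, because the argument will be
  \<open>|x|^2 / e^2\<close>. Strict positivity in between is what later lets a vanishing mean force
  a function to vanish on an annulus.\<close>

definition is_smooth_step :: "(real \<Rightarrow> real) \<Rightarrow> (real \<Rightarrow> real) \<Rightarrow> bool" where
  "is_smooth_step q b \<longleftrightarrow>
     (\<forall>k. Ck_real k UNIV b) \<and> (\<forall>t. (q has_real_derivative b t) (at t)) \<and>
     (\<forall>t. b t \<ge> 0) \<and> (\<forall>t. t \<le> 1/4 \<or> 1 \<le> t \<longrightarrow> b t = 0) \<and>
     (\<forall>t. 1/4 < t \<and> t < 1 \<longrightarrow> b t > 0) \<and>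
     (\<forall>t\<le>1/4. q t = 0) \<and> (\<forall>t\<ge>1. q t = 1)"

lemma ex_smooth_step: "\<exists>q b. is_smooth_step q b"
proof -
  \<comment> \<open>The product \<open>exp (-1/(t - 1/4)) * exp (-1/(1 - t))\<close> on the open
    interval from 1/4 to 1, and zero elsewhere.\<close>
  define b0 where "b0 t = flat_exp 0 (1 * t + (-1/4)) * flat_exp 0 ((-1) * t + 1)" for t
  have Cb0: "Ck_real k UNIV b0" for k
    unfolding b0_def by (intro Ck_real_mult Ck_real_affine Ck_real_flat_exp)
  have nn: "b0 t \<ge> 0" for t by (auto simp: b0_def flat_exp_def)
  have zero: "b0 t = 0" if "t \<le> 1/4 \<or> 1 \<le> t" for t using that by (auto simp: b0_def flat_exp_def)
  have pos: "b0 t > 0" if "1/4 < t \<and> t < 1" for t using that by (auto simp: b0_def flat_exp_def)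
  obtain F where F: "(F has_real_derivative b0 t) (at t)" for t
    using continuous_imp_antiderivative[of b0] Cb0[of 0] by auto
  define c where "c = F 1 - F (1/4)"
  have mono: "F s \<le> F t" if "s \<le> t" for s t
    by (rule DERIV_nonneg_imp_nondecreasing[OF that]) (meson F nn)
  \<comment> \<open>The points 1/3 and 1/2 keep a closed interval inside the region where the bump
    is positive; monotonicity extends the strict growth to all of [1/4, 1].\<close>
  have "F (1/3) < F (1/2)"
    by (rule DERIV_pos_imp_increasing) (use F pos in force)+
  then have c: "c > 0" using mono[of "1/4" "1/3"] mono[of "1/2" 1] by (simp add: c_def)
  have F1: "F t = F (1/4)" if "t \<le> 1/4" for t
  proof (rule constant_on_Icc_if_DERIV_zero[OF that])
    show "(F has_real_derivative 0) (at s)" if "s \<le> 1/4" for s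
      using F[of s] zero[of s] that by simp
  qed
  have F2: "F t = F 1" if "t \<ge> 1" for t
  proof (rule constant_on_Icc_if_DERIV_zero[OF that, symmetric])
    show "(F has_real_derivative 0) (at s)" if "1 \<le> s" for s
      using F[of s] zero[of s] that by simp
  qed
  have "is_smooth_step (\<lambda>t. (F t - F (1/4)) / c) (\<lambda>t. b0 t * (1 / c))"
    unfolding is_smooth_step_def
  proof (intro conjI allI impI)
    show "Ck_real k UNIV (\<lambda>t. b0 t * (1 / c))" for k by (intro Ck_real_mult Ck_real_const Cb0)
    show "((\<lambda>t. (F t - F (1/4)) / c) has_real_derivative b0 t * (1 / c)) (at t)" for t
      using DERIV_cdivide[OF DERIV_diff[OF F DERIV_const]] by simp
    show "b0 t * (1 / c) \<ge> 0" for t using c nn by simp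
    show "b0 t * (1 / c) = 0" if "t \<le> 1/4 \<or> 1 \<le> t" for t using zero[OF that] by simp
    show "b0 t * (1 / c) > 0" if "1/4 < t \<and> t < 1" for t using pos[OF that] c by simp
    show "(F t - F (1/4)) / c = 0" if "t \<le> 1/4" for t using F1[OF that] by simp
    show "(F t - F (1/4)) / c = 1" if "1 \<le> t" for t using F2[OF that] c by (simp add: c_def)
  qed
  then show ?thesis by blast
qed

definition smooth_step :: "real \<Rightarrow> real" where
  "smooth_step = (SOME q. \<exists>b. is_smooth_step q b)"

definition smooth_bump :: "real \<Rightarrow> real" where
  "smooth_bump = (SOME b. is_smooth_step smooth_step b)"

lemma is_smooth_step: "is_smooth_step smooth_step smooth_bump"
proof -
  have "\<exists>b. is_smooth_step smooth_step b"
    unfolding smooth_step_def by (rule someI_ex[OF ex_smooth_step])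
  then show ?thesis unfolding smooth_bump_def by (rule someI_ex)
qed

lemma Ck_real_smooth_bump: "Ck_real k UNIV smooth_bump"
  and DERIV_smooth_step: "(smooth_step has_real_derivative smooth_bump t) (at t)"
  and smooth_bump_nonneg: "smooth_bump t \<ge> 0"
  and smooth_bump_zero: "t \<le> 1/4 \<or> 1 \<le> t \<Longrightarrow> smooth_bump t = 0"
  and smooth_bump_pos: "1/4 < t \<Longrightarrow> t < 1 \<Longrightarrow> smooth_bump t > 0"
  and smooth_step_0: "t \<le> 1/4 \<Longrightarrow> smooth_step t = 0"
  and smooth_step_1: "t \<ge> 1 \<Longrightarrow> smooth_step t = 1"
proof -
  note * = is_smooth_step[unfolded is_smooth_step_def]
  show "Ck_real k UNIV smooth_bump" by (rule *[THEN conjunct1, THEN spec])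
  note * = *[THEN conjunct2]
  show "(smooth_step has_real_derivative smooth_bump t) (at t)"
    by (rule *[THEN conjunct1, THEN spec])
  note * = *[THEN conjunct2]
  show "smooth_bump t \<ge> 0" by (rule *[THEN conjunct1, THEN spec])
  note * = *[THEN conjunct2]
  show "t \<le> 1/4 \<or> 1 \<le> t \<Longrightarrow> smooth_bump t = 0" by (rule *[THEN conjunct1, THEN spec, THEN mp])
  note * = *[THEN conjunct2]
  show "1/4 < t \<Longrightarrow> t < 1 \<Longrightarrow> smooth_bump t > 0"
    by (rule *[THEN conjunct1, THEN spec, THEN mp, OF conjI])
  note * = *[THEN conjunct2]
  show "t \<le> 1/4 \<Longrightarrow> smooth_step t = 0" by (rule *[THEN conjunct1, THEN spec, THEN mp])
  show "t \<ge> 1 \<Longrightarrow> smooth_step t = 1" by (rule *[THEN conjunct2, THEN spec, THEN mp])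
qed

lemma Ck_real_smooth_step: "Ck_real k UNIV smooth_step"
proof (rule Ck_real_Suc_imp)
  show "Ck_real (Suc k) UNIV smooth_step"
    using Ck_real_smooth_bump DERIV_smooth_step by auto
qed

lemma smooth_step_mono: "s \<le> t \<Longrightarrow> smooth_step s \<le> smooth_step t"
  by (rule DERIV_nonneg_imp_nondecreasing) (meson DERIV_smooth_step smooth_bump_nonneg)+

lemma smooth_step_bounds: "0 \<le> smooth_step t" "smooth_step t \<le> 1"
proof -
  show "0 \<le> smooth_step t"
    using smooth_step_mono[of "min t 0" t] smooth_step_0[of "min t 0"] by simp
  show "smooth_step t \<le> 1"
    using smooth_step_mono[of t "max t 1"] smooth_step_1[of "max t 1"] by simp
qed

section \<open>Regularised radial profiles of the fundamental solution\<close>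

text \<open>Up to a constant factor, \<open>t powr (- n / 2)\<close> is the derivative in
  \<open>t = |x|^2\<close> of the fundamental solution in every dimension, the logarithmic one
  included. The dimension is a real number because it only occurs in exponents and
  coefficients.\<close>

definition radial_deriv :: "real \<Rightarrow> real \<Rightarrow> real \<Rightarrow> real" where
  "radial_deriv n e t = t powr (- n / 2) * smooth_step (t / e\<^sup>2)"

text \<open>What is left of \<open>4 t P'' + 2 n P'\<close> for
  \<open>P' = radial_deriv n e\<close>: the terms without a derivative of the step cancel.\<close>

definition radial_mollifier :: "real \<Rightarrow> real \<Rightarrow> real \<Rightarrow> real" where
  "radial_mollifier n e t = 4 * t powr (1 - n / 2) * smooth_bump (t / e\<^sup>2) / e\<^sup>2"

text \<open>The second derivative, solved from that equation. Division by zero gives the correct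
  value 0 at \<open>t = 0\<close>.\<close>

definition radial_deriv2 :: "real \<Rightarrow> real \<Rightarrow> real \<Rightarrow> real" where
  "radial_deriv2 n e t = (radial_mollifier n e t - 2 * n * radial_deriv n e t) / (4 * t)"

text \<open>Choosing any antiderivative covers both the logarithm (\<open>n = 2\<close>) and the
  power \<open>t powr (1 - n / 2)\<close>, without a case distinction.\<close>

definition newton_profile :: "real \<Rightarrow> real \<Rightarrow> real" where
  "newton_profile n = (SOME p. \<forall>t>0. (p has_real_derivative t powr (- n / 2)) (at t))"

text \<open>The common value at \<open>t = 1\<close> fixes the additive constant, so that profiles
  of all scales up to 1 coincide far from the origin.\<close>

definition smoothed_profile :: "real \<Rightarrow> real \<Rightarrow> real \<Rightarrow> real" where
  "smoothed_profile n e = (SOME p. (\<forall>t. (p has_real_derivative radial_deriv n e t) (at t)) \<and>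
     p 1 = newton_profile n 1)"

text \<open>The power is singular at 0, but the product vanishes on a neighbourhood of the
  nonpositive half-line; smoothness is glued from the two overlapping open sets.\<close>

lemma Ck_real_powr_mult_flat:
  assumes "Ck_real k UNIV q" "0 < c" "\<And>t. t < c \<Longrightarrow> q t = 0"
  shows "Ck_real k UNIV (\<lambda>t. t powr a * q t)"
proof -
  have "Ck_real k {0<..} (\<lambda>t. t powr a * q t)"
    using assms(1) by (intro Ck_real_mult Ck_real_powr) (auto elim: Ck_real_subset)
  moreover have "Ck_real k {..<c} (\<lambda>t. t powr a * q t)"
    by (rule Ck_real_cong[OF _ _ Ck_real_const[of _ _ 0]]) (auto simp: assms(3))
  ultimately have "Ck_real k ({0<..} \<union> {..<c}) (\<lambda>t. t powr a * q t)"
    by (intro Ck_real_Un) auto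
  moreover have "{0<..} \<union> {..<c} = UNIV" using assms(2) by auto
  ultimately show ?thesis by simp
qed

lemma Ck_real_scale: "Ck_real k UNIV f \<Longrightarrow> Ck_real k UNIV (\<lambda>t. f (t / c))"
  using Ck_real_affine[of k f "1 / c" 0] by simp

lemma radial_quarter: "0 < e \<Longrightarrow> t < e\<^sup>2 / 4 \<Longrightarrow> t / e\<^sup>2 \<le> 1/4"
  for e :: real by (simp add: field_simps)

lemma Ck_real_radial_deriv:
  assumes "0 < e" shows "Ck_real k UNIV (radial_deriv n e)"
  unfolding radial_deriv_def
  by (rule Ck_real_powr_mult_flat[where c="e\<^sup>2 / 4"])
    (use assms in \<open>auto intro!: Ck_real_scale Ck_real_smooth_step smooth_step_0 radial_quarter\<close>)

lemma Ck_real_radial_mollifier: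
  assumes "0 < e" shows "Ck_real k UNIV (radial_mollifier n e)"
proof -
  have "Ck_real k UNIV (\<lambda>t. 4 / e\<^sup>2 * (t powr (1 - n / 2) * smooth_bump (t / e\<^sup>2)))"
    by (intro Ck_real_mult[of _ _ "\<lambda>_. 4 / e\<^sup>2"] Ck_real_const Ck_real_powr_mult_flat[where c="e\<^sup>2 / 4"])
      (use assms in \<open>auto intro!: Ck_real_scale Ck_real_smooth_bump smooth_bump_zero radial_quarter\<close>)
  then show ?thesis unfolding radial_mollifier_def by (simp add: mult_ac)
qed

lemma radial_mollifier_nonneg: "0 \<le> radial_mollifier n e t"
  unfolding radial_mollifier_def by (simp add: smooth_bump_nonneg)

lemma radial_mollifier_eq_0:
  assumes "0 < e" "t \<le> e\<^sup>2 / 4 \<or> e\<^sup>2 \<le> t" shows "radial_mollifier n e t = 0"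
proof -
  have "smooth_bump (t / e\<^sup>2) = 0"
    using assms by (intro smooth_bump_zero) (auto simp: field_simps)
  then show ?thesis by (simp add: radial_mollifier_def)
qed

lemma radial_mollifier_pos:
  assumes "0 < e" "e\<^sup>2 / 4 < t" "t < e\<^sup>2" shows "0 < radial_mollifier n e t"
proof -
  have "0 < smooth_bump (t / e\<^sup>2)"
    using assms by (intro smooth_bump_pos) (auto simp: field_simps)
  moreover have "t > 0" using assms by (smt (verit) zero_less_power divide_pos_pos)
  ultimately show ?thesis using assms by (simp add: radial_mollifier_def)
qed

text \<open>With \<open>t = |x|^2\<close> this is the usual scaling of an approximate identity in
  dimension \<open>n\<close>; it reduces derivative bounds at all scales to scale 1.\<close>

lemma radial_mollifier_scale:
  assumes "0 < e"
  shows "radial_mollifier n e t = e powr (- n) * radial_mollifier n 1 (t / e\<^sup>2)"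
proof (cases "t \<le> 0")
  case True
  then have "t \<le> e\<^sup>2 / 4" "t / e\<^sup>2 \<le> 1\<^sup>2 / 4"
    by (smt (verit) zero_le_power2 divide_nonneg_nonneg, smt (verit) True zero_le_power2 divide_nonpos_nonneg power_one zero_less_divide_iff)
  then show ?thesis using radial_mollifier_eq_0[of e t n] radial_mollifier_eq_0[of 1 "t / e\<^sup>2" n] assms
    by simp
next
  case False
  have "(t / e\<^sup>2) powr (1 - n / 2) = t powr (1 - n / 2) / (e powr 2) powr (1 - n / 2)"
    using False assms by (simp add: powr_divide)
  also have "(e powr 2) powr (1 - n / 2) = e powr (2 + (- n))"
    by (simp add: powr_powr algebra_simps)
  also have "\<dots> = e\<^sup>2 * e powr (- n)"
    using assms by (simp only: powr_add) (simp add: powr_numeral)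
  finally show ?thesis using assms by (simp add: radial_mollifier_def field_simps)
qed

lemma radial_deriv_nonneg: "0 \<le> radial_deriv n e t"
  unfolding radial_deriv_def by (simp add: smooth_step_bounds)

lemma radial_deriv_le: "radial_deriv n e t \<le> t powr (- n / 2)"
  unfolding radial_deriv_def using mult_left_mono[OF smooth_step_bounds(2), of "t powr (- n / 2)"] by simp

lemma radial_deriv_antimono:
  assumes "0 < e" "e \<le> r" "0 \<le> t"
  shows "radial_deriv n r t \<le> radial_deriv n e t"
proof -
  have "t / r\<^sup>2 \<le> t / e\<^sup>2" using assms by (intro divide_left_mono) (auto simp: power_mono)
  then show ?thesis unfolding radial_deriv_def by (intro mult_left_mono smooth_step_mono) auto
qed

lemma radial_deriv_eq: "0 < e \<Longrightarrow> e\<^sup>2 \<le> t \<Longrightarrow> radial_deriv n e t = t powr (- n / 2)"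
  unfolding radial_deriv_def by (subst smooth_step_1) auto

lemma radial_deriv_eq_0: "0 < e \<Longrightarrow> t \<le> e\<^sup>2 / 4 \<Longrightarrow> radial_deriv n e t = 0"
  unfolding radial_deriv_def by (subst smooth_step_0) (auto simp: field_simps)

lemma DERIV_radial_deriv:
  assumes e: "0 < e"
  shows "(radial_deriv n e has_real_derivative radial_deriv2 n e t) (at t)"
proof (cases "t > 0")
  case True
  have "((\<lambda>t. smooth_step (t / e\<^sup>2)) has_real_derivative smooth_bump (t / e\<^sup>2) * (1 / e\<^sup>2)) (at t)"
    by (rule DERIV_chain2[of smooth_step, OF DERIV_smooth_step]) (rule DERIV_cdivide[OF DERIV_ident])
  note * = DERIV_mult[OF has_real_derivative_powr[OF True, of "- n / 2"] this]
  have p: "t powr (- n / 2 - 1) = t powr (- n / 2) / t" "t powr (1 - n / 2) = t * t powr (- n / 2)"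
    using True powr_add[of t "- n / 2" 1] by (auto simp: powr_diff)
  have "- n / 2 * t powr (- n / 2 - 1) * smooth_step (t / e\<^sup>2) +
      smooth_bump (t / e\<^sup>2) * (1 / e\<^sup>2) * t powr (- n / 2) = radial_deriv2 n e t"
    unfolding radial_deriv2_def radial_mollifier_def radial_deriv_def p
    using True e by (simp add: field_simps)
  with * show ?thesis unfolding radial_deriv_def by simp
next
  case False
  then have t: "t < e\<^sup>2 / 4" using e by (smt (verit) zero_less_power divide_pos_pos)
  have "((\<lambda>_. 0) has_real_derivative 0) (at t)" by simp
  then have "(radial_deriv n e has_real_derivative 0) (at t)"
    by (rule has_field_derivative_transform_within_open[where S="{..<e\<^sup>2 / 4}"])
      (use t radial_deriv_eq_0[OF e] in auto)
  moreover have "radial_deriv2 n e t = 0"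
    using t radial_deriv_eq_0[OF e] radial_mollifier_eq_0[OF e] by (auto simp: radial_deriv2_def)
  ultimately show ?thesis by simp
qed

text \<open>The left-hand side is the Laplacian of \<open>P (|x|^2)\<close> with
  \<open>P' = radial_deriv n e\<close>.\<close>

lemma radial_deriv_ode:
  assumes "0 < e"
  shows "4 * t * radial_deriv2 n e t + 2 * n * radial_deriv n e t = radial_mollifier n e t"
proof (cases "t = 0")
  case True
  then show ?thesis using assms by (simp add: radial_deriv_eq_0 radial_mollifier_eq_0)
qed (simp add: radial_deriv2_def)

text \<open>The quotient by \<open>t\<close> is smooth because it is the unique derivative of a
  smooth function.\<close>

lemma Ck_real_radial_deriv2:
  assumes "0 < e" shows "Ck_real k UNIV (radial_deriv2 n e)"
proof -
  obtain f' where f': "\<forall>t. (radial_deriv n e has_real_derivative f' t) (at t)" "Ck_real k UNIV f'"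
    using Ck_real_radial_deriv[OF assms, of "Suc k" n] by auto
  have "f' = radial_deriv2 n e"
    using f'(1) DERIV_radial_deriv[OF assms] DERIV_unique by blast
  with f' show ?thesis by simp
qed

lemma DERIV_newton_profile:
  assumes "0 < t" shows "(newton_profile n has_real_derivative t powr (- n / 2)) (at t)"
proof -
  have "\<exists>F. \<forall>x. ereal 0 < ereal x \<longrightarrow> ereal x < \<infinity> \<longrightarrow> (F has_vector_derivative x powr (- n / 2)) (at x)"
    by (intro einterval_antiderivative) (auto intro!: continuous_intros)
  then have "\<exists>F. \<forall>x>0. (F has_real_derivative x powr (- n / 2)) (at x)"
    by (simp add: has_real_derivative_iff_has_vector_derivative)
  from someI_ex[OF this] show ?thesis using assms unfolding newton_profile_def by blast
qed

lemma
  assumes "0 < e"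
  shows DERIV_smoothed_profile:
      "(smoothed_profile n e has_real_derivative radial_deriv n e t) (at t)"
    and smoothed_profile_1: "smoothed_profile n e 1 = newton_profile n 1"
proof -
  obtain F where F: "\<forall>t. (F has_real_derivative radial_deriv n e t) (at t)"
    using continuous_imp_antiderivative Ck_real_radial_deriv[OF assms, of 0] by fastforce
  have "\<forall>t. ((\<lambda>t. F t - F 1 + newton_profile n 1) has_real_derivative radial_deriv n e t) (at t)"
    using DERIV_add[OF DERIV_diff[OF F[rule_format] DERIV_const[of "F 1"]] DERIV_const[of "newton_profile n 1"]]
    by simp
  then have "\<exists>p. (\<forall>t. (p has_real_derivative radial_deriv n e t) (at t)) \<and> p 1 = newton_profile n 1"
    by (intro exI[of _ "\<lambda>t. F t - F 1 + newton_profile n 1"]) simp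
  from someI_ex[OF this] show "(smoothed_profile n e has_real_derivative radial_deriv n e t) (at t)"
    "smoothed_profile n e 1 = newton_profile n 1"
    unfolding smoothed_profile_def by blast+
qed

lemma Ck_real_smoothed_profile:
  assumes "0 < e" shows "Ck_real k UNIV (smoothed_profile n e)"
proof (rule Ck_real_Suc_imp)
  show "Ck_real (Suc k) UNIV (smoothed_profile n e)"
    using Ck_real_radial_deriv[OF assms, of k n] DERIV_smoothed_profile[OF assms, of n]
    by (auto intro!: exI[of _ "radial_deriv n e"])
qed

text \<open>Both sides have the same derivative on \<open>t >= e^2\<close>, a range that contains
  the normalisation point 1 because \<open>e <= 1\<close>.\<close>

lemma smoothed_profile_eq:
  assumes e: "0 < e" "e \<le> 1" and t: "e\<^sup>2 \<le> t"
  shows "smoothed_profile n e t = newton_profile n t"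
proof -
  let ?h = "\<lambda>t. smoothed_profile n e t - newton_profile n t"
  have e2: "0 < e\<^sup>2" "e\<^sup>2 \<le> 1" using e by (auto simp: power_le_one)
  have h: "(?h has_real_derivative 0) (at s)" if "e\<^sup>2 \<le> s" for s
    using DERIV_diff[OF DERIV_smoothed_profile[OF e(1)] DERIV_newton_profile[of s n], of n]
      radial_deriv_eq[OF e(1) that, of n] that e2 by simp
  have "?h t = ?h 1"
  proof (cases "t \<le> 1")
    case True
    then show ?thesis using h t by (intro constant_on_Icc_if_DERIV_zero) auto
  next
    case False
    then show ?thesis using h e2 by (intro constant_on_Icc_if_DERIV_zero[symmetric]) auto
  qed
  then show ?thesis using smoothed_profile_1[OF e(1)] by simp
qed

text \<open>The profiles meet at 1, and the one of smaller scale has the larger derivative, hence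
  lies below to the left of 1.\<close>

lemma smoothed_profile_mono:
  assumes e: "0 < e'" "e' \<le> e" and t: "0 \<le> t" "t \<le> 1"
  shows "smoothed_profile n e' t \<le> smoothed_profile n e t"
proof -
  let ?h = "\<lambda>t. smoothed_profile n e' t - smoothed_profile n e t"
  have e0: "0 < e" using e by simp
  have "?h t \<le> ?h 1"
  proof (rule DERIV_nonneg_imp_nondecreasing[where f="?h", OF t(2)])
    fix s assume "t \<le> s" "s \<le> 1"
    then show "\<exists>y. (?h has_real_derivative y) (at s) \<and> 0 \<le> y"
      using DERIV_diff[OF DERIV_smoothed_profile[OF e(1), where n=n and t=s] DERIV_smoothed_profile[OF e0, where n=n and t=s]]
        radial_deriv_antimono[OF e, of s n] t
      by (intro exI[of _ "radial_deriv n e' s - radial_deriv n e s"] conjI) auto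
  qed
  then show ?thesis using smoothed_profile_1[OF e(1)] smoothed_profile_1[OF e0] by simp
qed

text \<open>The exponent \<open>n/2 - 3/4\<close> leaves room for the logarithm in dimension two, so that no case
  distinction on the dimension is needed.\<close>

lemma smoothed_profile_bounds:
  assumes e: "0 < e" "e \<le> 1" and t: "0 < t" "t < e\<^sup>2" and n: "2 \<le> n"
  shows "newton_profile n t \<le> smoothed_profile n e t"
    and "smoothed_profile n e t - newton_profile n t \<le> 4 * t powr (- (n / 2 - 3 / 4))"
proof -
  define a where "a = n / 2 - 3 / 4"
  have a: "a \<ge> 1/4" using n by (simp add: a_def)
  have e2: "0 < e\<^sup>2" "e\<^sup>2 \<le> 1" using e by (auto simp: power_le_one)
  have eq: "smoothed_profile n e (e\<^sup>2) = newton_profile n (e\<^sup>2)" using smoothed_profile_eq e by simp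
  let ?h = "\<lambda>t. smoothed_profile n e t - newton_profile n t"
  have "?h (e\<^sup>2) \<le> ?h t"
  proof (rule DERIV_nonpos_imp_nonincreasing[where f="?h"])
    show "t \<le> e\<^sup>2" using t by simp
    fix s assume s: "t \<le> s" "s \<le> e\<^sup>2"
    show "\<exists>y. (?h has_real_derivative y) (at s) \<and> y \<le> 0"
      using DERIV_diff[OF DERIV_smoothed_profile[OF e(1)] DERIV_newton_profile[of s n], of n]
        radial_deriv_le[of n e s] s t
      by (intro exI[of _ "radial_deriv n e s - s powr (- n / 2)"]) simp
  qed
  with eq show "newton_profile n t \<le> smoothed_profile n e t" by simp
  have mono: "smoothed_profile n e t \<le> smoothed_profile n e (e\<^sup>2)"
    by (rule DERIV_nonneg_imp_nondecreasing[where f="smoothed_profile n e"])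
      (use t in simp, meson DERIV_smoothed_profile[OF e(1)] radial_deriv_nonneg)
  \<comment> \<open>The second term has derivative \<open>- t powr (- a - 1)\<close>, which
    dominates \<open>t powr (- n / 2)\<close> for \<open>t <= 1\<close> since
    \<open>a + 1 = n / 2 + 1 / 4\<close>. The constant 4 comes from \<open>a >= 1/4\<close>.\<close>
  let ?g = "\<lambda>t. newton_profile n t + (1 / a) * t powr (- a)"
  have "?g (e\<^sup>2) \<le> ?g t"
  proof (rule DERIV_nonpos_imp_nonincreasing[where f="?g"])
    show "t \<le> e\<^sup>2" using t by simp
    fix s assume s: "t \<le> s" "s \<le> e\<^sup>2"
    have s0: "0 < s" "s \<le> 1" using s t e2 by auto
    have "(?g has_real_derivative s powr (- n / 2) + (1 / a) * (- a * s powr (- a - 1))) (at s)"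
      using DERIV_add[OF DERIV_newton_profile[OF s0(1)] DERIV_cmult[OF has_real_derivative_powr[OF s0(1), of "- a"], of "1 / a"]]
      by simp
    moreover have "s powr (- n / 2) \<le> s powr (- a - 1)"
      using s0 by (intro powr_mono') (auto simp: a_def)
    ultimately show "\<exists>y. (?g has_real_derivative y) (at s) \<and> y \<le> 0" using a
      by (intro exI conjI) auto
  qed
  then have "newton_profile n (e\<^sup>2) - newton_profile n t \<le> (1 / a) * t powr (- a)"
    using a by (smt (verit) powr_ge_zero divide_nonneg_nonneg mult_nonneg_nonneg)
  also have "\<dots> \<le> 4 * t powr (- a)"
    using a by (intro mult_right_mono) (auto simp: field_simps)
  finally show "smoothed_profile n e t - newton_profile n t \<le> 4 * t powr (- (n / 2 - 3 / 4))"
    using mono eq unfolding a_def by simp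
qed

text \<open>The mollifier of scale 1 is constant outside [1/4, 1], so its continuous derivative is
  bounded by compactness. This controls the Laplacian of the dipole.\<close>

lemma ex_DERIV_radial_mollifier:
  "\<exists>C d. (\<forall>t. (radial_mollifier n 1 has_real_derivative d t) (at t)) \<and>
    (\<forall>t. \<bar>d t\<bar> \<le> C) \<and> (\<forall>t>1. d t = 0)"
proof -
  obtain d where d: "\<And>t. (radial_mollifier n 1 has_real_derivative d t) (at t)" "continuous_on UNIV d"
    using Ck_real_radial_mollifier[of 1 "Suc 0" n] by auto
  have 0: "d t = 0" if t: "t < 1/4 \<or> 1 < t" for t
  proof -
    have "((\<lambda>_. 0) has_real_derivative 0) (at t)" by simp
    then have "(radial_mollifier n 1 has_real_derivative 0) (at t)"
      by (rule has_field_derivative_transform_within_open[where S="{..<1/4} \<union> {1<..}"])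
        (use t radial_mollifier_eq_0[of 1] in auto)
    then show ?thesis using d(1) DERIV_unique by blast
  qed
  obtain C where C: "0 \<le> C" "\<forall>t\<in>{1/4..1}. \<bar>d t\<bar> \<le> C"
    using ex_abs_bound_on_compact[of "{1/4..1}" d] continuous_on_subset[OF d(2), of "{1/4..1}"] by auto
  have "\<bar>d t\<bar> \<le> C" for t
    using C 0[of t] by (cases "t \<in> {1/4..1}") auto
  then show ?thesis using d(1) 0 by (intro exI[of _ C] exI[of _ d]) auto
qed

lemma DERIV_radial_mollifier_scale:
  assumes "\<And>t. (radial_mollifier n 1 has_real_derivative d t) (at t)" "0 < e"
  shows "(radial_mollifier n e has_real_derivative e powr (- n - 2) * d (t / e\<^sup>2)) (at t)"
proof -
  have "((\<lambda>t. radial_mollifier n 1 (t / e\<^sup>2)) has_real_derivative d (t / e\<^sup>2) * (1 / e\<^sup>2)) (at t)"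
    by (rule DERIV_chain2[of "radial_mollifier n 1", OF assms(1)]) (rule DERIV_cdivide[OF DERIV_ident])
  from DERIV_cmult[OF this, of "e powr (- n)"]
  have "(radial_mollifier n e has_real_derivative e powr (- n) * (d (t / e\<^sup>2) * (1 / e\<^sup>2))) (at t)"
    unfolding radial_mollifier_scale[OF assms(2), symmetric] .
  moreover have "e powr (- n - 2) = e powr (- n) / e\<^sup>2"
    using assms(2) by (simp add: powr_diff powr_numeral)
  ultimately show ?thesis by simp
qed

section \<open>Calculus of partial derivatives and Laplacians\<close>

lemma partial_eqI: "(f has_derivative f') (at x) \<Longrightarrow> partial i f x = f' (axis i 1)"
  unfolding partial_def using frechet_derivative_at by metis

lemma Ck_on_Suc_imp: "Ck_on (Suc k) S f \<Longrightarrow> Ck_on k S f"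
proof (induction k arbitrary: f)
  case 0
  then show ?case
    by (simp add: continuous_at_imp_continuous_on differentiable_imp_continuous_within)
qed auto

lemma Ck_on_le: "Ck_on k S f \<Longrightarrow> j \<le> k \<Longrightarrow> Ck_on j S f"
  by (induction k) (auto simp: le_Suc_eq dest: Ck_on_Suc_imp simp del: Ck_on.simps(2))

lemma partial_const: "partial i (\<lambda>_. c) = (\<lambda>_. 0)"
  by (rule ext) (subst partial_eqI[OF has_derivative_const], simp)

lemma Ck_on_const: "Ck_on k S (\<lambda>_. c)"
  by (induction k arbitrary: c) (auto simp: partial_const)

lemma has_derivative_coord: "((\<lambda>x::real^'n. x $ j) has_derivative (\<lambda>h. h $ j)) (at x)"
  by (rule bounded_linear.has_derivative[OF bounded_linear_vec_nth has_derivative_ident])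

lemma partial_coord: "partial i (\<lambda>x::real^'n. x $ j) = (\<lambda>_. if i = j then 1 else 0)"
  by (rule ext) (subst partial_eqI[OF has_derivative_coord], simp add: axis_def)

lemma Ck_on_coord: "Ck_on k S (\<lambda>x::real^'n. x $ j)"
proof (cases k)
  case 0 then show ?thesis by (auto intro: continuous_intros)
next
  case (Suc k')
  then show ?thesis
    by (auto simp: partial_coord intro!: Ck_on_const)
      (metis has_derivative_coord differentiable_def)
qed

lemma partial_add:
  assumes "f differentiable at x" "g differentiable at x"
  shows "partial i (\<lambda>x. f x + g x) x = partial i f x + partial i g x"
proof -
  obtain f' g' where *: "(f has_derivative f') (at x)" "(g has_derivative g') (at x)"
    using assms differentiable_def by blast
  show ?thesis
    by (simp add: partial_eqI[OF *(1)] partial_eqI[OF *(2)] partial_eqI[OF has_derivative_add[OF *]])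
qed

lemma partial_mult:
  assumes "f differentiable at x" "g differentiable at x"
  shows "partial i (\<lambda>x. f x * g x) x = f x * partial i g x + partial i f x * g x"
proof -
  obtain f' g' where *: "(f has_derivative f') (at x)" "(g has_derivative g') (at x)"
    using assms differentiable_def by blast
  show ?thesis
    by (simp add: partial_eqI[OF *(1)] partial_eqI[OF *(2)] partial_eqI[OF has_derivative_mult[OF *]])
qed

lemma has_derivative_real_comp:
  fixes F :: "real \<Rightarrow> real"
  assumes "(F has_real_derivative d) (at (g x))" "(g has_derivative g') (at x)"
  shows "((\<lambda>x. F (g x)) has_derivative (\<lambda>h. d * g' h)) (at x)"
  using has_derivative_compose[OF assms(2), of F "\<lambda>h. d * h"] assms(1)
  by (simp add: has_field_derivative_def)

lemma partial_comp:
  fixes F :: "real \<Rightarrow> real"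
  assumes "(F has_real_derivative d) (at (g x))" "g differentiable at x"
  shows "partial i (\<lambda>x. F (g x)) x = d * partial i g x"
proof -
  obtain g' where *: "(g has_derivative g') (at x)"
    using assms differentiable_def by blast
  show ?thesis
    by (simp add: partial_eqI[OF *(1)] partial_eqI[OF has_derivative_real_comp[OF assms(1) *]])
qed

lemma Ck_on_add: "Ck_on k UNIV f \<Longrightarrow> Ck_on k UNIV g \<Longrightarrow> Ck_on k UNIV (\<lambda>x. f x + g x)"
proof (induction k arbitrary: f g)
  case (Suc k)
  have "partial i (\<lambda>x. f x + g x) = (\<lambda>x. partial i f x + partial i g x)" for i
    using Suc.prems by (auto intro!: ext partial_add)
  then show ?case using Suc by auto
qed (auto intro: continuous_on_add)

lemma Ck_on_mult: "Ck_on k UNIV f \<Longrightarrow> Ck_on k UNIV g \<Longrightarrow> Ck_on k UNIV (\<lambda>x. f x * g x)"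
proof (induction k arbitrary: f g)
  case (Suc k)
  have "partial i (\<lambda>x. f x * g x) = (\<lambda>x. f x * partial i g x + partial i f x * g x)" for i
    using Suc.prems by (auto intro!: ext partial_mult)
  moreover have "Ck_on k UNIV f" "Ck_on k UNIV g" using Suc.prems Ck_on_Suc_imp by blast+
  ultimately show ?case using Suc by (auto intro!: Ck_on_add)
qed (auto intro: continuous_on_mult)

lemma Ck_on_diff:
  assumes "Ck_on k UNIV f" "Ck_on k UNIV g" shows "Ck_on k UNIV (\<lambda>x. f x - g x)"
  using Ck_on_add[OF assms(1) Ck_on_mult[OF Ck_on_const[of k UNIV "-1"] assms(2)]] by simp

lemma Ck_on_sum:
  "(\<And>i. i \<in> I \<Longrightarrow> Ck_on k UNIV (f i)) \<Longrightarrow> Ck_on k UNIV (\<lambda>x. \<Sum>i\<in>I. f i x)"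
  by (induction I rule: infinite_finite_induct) (auto intro: Ck_on_const Ck_on_add)

lemma Ck_on_comp: "Ck_real k UNIV F \<Longrightarrow> Ck_on k UNIV g \<Longrightarrow> Ck_on k UNIV (\<lambda>x. F (g x))"
proof (induction k arbitrary: F)
  case 0
  then show ?case by (auto intro: continuous_on_compose2)
next
  case (Suc k)
  then obtain F' where F': "\<And>t. (F has_real_derivative F' t) (at t)" "Ck_real k UNIV F'" by auto
  have g: "g differentiable at x" for x using Suc.prems by auto
  have "partial i (\<lambda>x. F (g x)) = (\<lambda>x. F' (g x) * partial i g x)" for i
    using F' g by (auto intro!: ext partial_comp)
  moreover have "(\<lambda>x. F (g x)) differentiable at x" for x
    using g[of x] has_derivative_real_comp[OF F'(1)] unfolding differentiable_def by blast
  moreover have "Ck_on k UNIV g" using Suc.prems(2) by (rule Ck_on_Suc_imp)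
  ultimately show ?case using Suc F' by (auto intro!: Ck_on_mult)
qed

lemma Ck_on_2D:
  assumes "Ck_on (Suc (Suc 0)) UNIV f"
  shows "f differentiable at x" "partial i f differentiable at x"
    "continuous_on UNIV f" "continuous_on UNIV (partial i f)" "continuous_on UNIV (partial j (partial i f))"
proof -
  have 1: "Ck_on (Suc 0) UNIV (partial i f)" using assms by simp
  show "f differentiable at x" "partial i f differentiable at x"
    "continuous_on UNIV (partial j (partial i f))" using assms 1 by auto
  show "continuous_on UNIV f" "continuous_on UNIV (partial i f)"
    using Ck_on_le[OF assms, of 0] Ck_on_le[OF 1, of 0] by auto
qed

lemma continuous_on_laplacian:
  "Ck_on (Suc (Suc 0)) UNIV f \<Longrightarrow> continuous_on UNIV (laplacian f)"
  unfolding laplacian_def by (intro continuous_on_sum Ck_on_2D(5))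

lemma laplacian_add:
  assumes "Ck_on (Suc (Suc 0)) UNIV f" "Ck_on (Suc (Suc 0)) UNIV g"
  shows "laplacian (\<lambda>x. f x + g x) x = laplacian f x + laplacian g x"
proof -
  note f = Ck_on_2D[OF assms(1)] and g = Ck_on_2D[OF assms(2)]
  have "partial i (\<lambda>x. f x + g x) = (\<lambda>x. partial i f x + partial i g x)" for i
    using f g by (auto intro!: ext partial_add)
  then show ?thesis using f g by (simp add: laplacian_def partial_add sum.distrib)
qed

lemma laplacian_mult:
  assumes "Ck_on (Suc (Suc 0)) UNIV f" "Ck_on (Suc (Suc 0)) UNIV g"
  shows "laplacian (\<lambda>x. f x * g x) x =
    f x * laplacian g x + 2 * (\<Sum>i\<in>UNIV. partial i f x * partial i g x) + laplacian f x * g x"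
proof -
  note f = Ck_on_2D[OF assms(1)] and g = Ck_on_2D[OF assms(2)]
  have 1: "partial i (\<lambda>x. f x * g x) = (\<lambda>x. f x * partial i g x + partial i f x * g x)" for i
    using f g by (auto intro!: ext partial_mult)
  have "partial i (partial i (\<lambda>x. f x * g x)) x =
      f x * partial i (partial i g) x + 2 * (partial i f x * partial i g x) + partial i (partial i f) x * g x" for i
    unfolding 1 using f g by (subst partial_add) (auto simp: partial_mult algebra_simps intro!: differentiable_mult)
  then show ?thesis
    by (simp add: laplacian_def sum.distrib sum_distrib_left sum_distrib_right)
qed

lemma laplacian_const: "laplacian (\<lambda>_. c) x = 0"
  by (simp add: laplacian_def partial_const)

lemma laplacian_coord: "laplacian (\<lambda>x::real^'n. x $ j) x = 0"
  by (simp add: laplacian_def partial_coord partial_const)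

lemma laplacian_diff:
  assumes "Ck_on (Suc (Suc 0)) UNIV f" "Ck_on (Suc (Suc 0)) UNIV g"
  shows "laplacian (\<lambda>x. f x - g x) x = laplacian f x - laplacian g x"
  using laplacian_add[OF Ck_on_diff[OF assms] assms(2), of x] by simp

lemma laplacian_comp:
  assumes F: "\<And>t. (F has_real_derivative F' t) (at t)" "\<And>t. (F' has_real_derivative F'' t) (at t)"
    and g: "Ck_on (Suc (Suc 0)) UNIV g"
  shows "laplacian (\<lambda>x. F (g x)) x =
    F'' (g x) * (\<Sum>i\<in>UNIV. (partial i g x)\<^sup>2) + F' (g x) * laplacian g x"
proof -
  note gd = Ck_on_2D[OF g]
  have 1: "partial i (\<lambda>x. F (g x)) = (\<lambda>x. F' (g x) * partial i g x)" for i
    using F gd by (auto intro!: ext partial_comp)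
  have d: "(\<lambda>x. F' (g x)) differentiable at x"
    using gd(1)[of x] has_derivative_real_comp[OF F(2)] unfolding differentiable_def by blast
  have "partial i (partial i (\<lambda>x. F (g x))) x = F'' (g x) * (partial i g x)\<^sup>2 + F' (g x) * partial i (partial i g) x" for i
    unfolding 1 partial_mult[OF d gd(2)] partial_comp[OF F(2) gd(1)] by (simp add: power2_eq_square)
  then show ?thesis by (simp add: laplacian_def sum.distrib sum_distrib_left)
qed

lemma norm2_diff_vec: "(norm (x - p))\<^sup>2 = (\<Sum>i\<in>UNIV. (x $ i - p $ i) * (x $ i - p $ i))"
  for x p :: "real^'n"
  by (simp add: power2_norm_eq_inner inner_vec_def)

lemma Ck_on_norm2: "Ck_on k UNIV (\<lambda>x::real^'n. (norm (x - p))\<^sup>2)"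
  unfolding norm2_diff_vec by (intro Ck_on_sum Ck_on_mult Ck_on_diff Ck_on_coord Ck_on_const)

lemma partial_norm2: "partial i (\<lambda>x::real^'n. (norm (x - p))\<^sup>2) = (\<lambda>x. 2 * (x $ i - p $ i))"
proof
  fix x
  have "((\<lambda>x::real^'n. (x - p) \<bullet> (x - p)) has_derivative (\<lambda>h. 2 * ((x - p) \<bullet> h))) (at x)"
    by (auto intro!: derivative_eq_intros simp: inner_commute)
  from partial_eqI[OF this, of i]
  show "partial i (\<lambda>x::real^'n. (norm (x - p))\<^sup>2) x = 2 * (x $ i - p $ i)"
    by (simp add: power2_norm_eq_inner inner_axis)
qed

lemma partial_affine_coord: "partial i (\<lambda>x::real^'n. c * (x $ i - b)) = (\<lambda>_. c)"
proof
  fix x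
  have "((\<lambda>x::real^'n. c * (x $ i - b)) has_derivative (\<lambda>h. c * h $ i)) (at x)"
    by (auto intro!: derivative_eq_intros has_derivative_coord)
  from partial_eqI[OF this, of i] show "partial i (\<lambda>x::real^'n. c * (x $ i - b)) x = c" by simp
qed

lemma laplacian_norm2: "laplacian (\<lambda>x::real^'n. (norm (x - p))\<^sup>2) x = 2 * real CARD('n)"
  unfolding laplacian_def partial_norm2 partial_affine_coord by simp

lemma sum_partial_norm2:
  "(\<Sum>i\<in>UNIV. (partial i (\<lambda>x::real^'n. (norm (x - p))\<^sup>2) x)\<^sup>2) = 4 * (norm (x - p))\<^sup>2"
  unfolding partial_norm2 unfolding norm2_diff_vec sum_distrib_left
  by (rule sum.cong) (auto simp: power2_eq_square algebra_simps)

lemma laplacian_radial: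
  assumes "\<And>t. (F has_real_derivative F' t) (at t)" "\<And>t. (F' has_real_derivative F'' t) (at t)"
  shows "laplacian (\<lambda>x::real^'n. F ((norm (x - p))\<^sup>2)) x =
    4 * (norm (x - p))\<^sup>2 * F'' ((norm (x - p))\<^sup>2) + 2 * real CARD('n) * F' ((norm (x - p))\<^sup>2)"
  using laplacian_comp[of F F' F'' "\<lambda>x::real^'n. (norm (x - p))\<^sup>2" x, OF assms Ck_on_norm2]
  by (simp add: sum_partial_norm2 laplacian_norm2)

text \<open>The quantity \<open>|x|\<^sup>2 |y|\<^sup>2 - 2 x\<bullet>y + 1 = |y|\<^sup>2 |x - y/|y|\<^sup>2|\<^sup>2\<close> of the reflected pole in Green's
  function of the unit ball, written without dividing by \<open>|y|\<close>.\<close>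

definition reflected_sq :: "real^'n \<Rightarrow> real^'n \<Rightarrow> real" where
  "reflected_sq y x = (norm x)\<^sup>2 * (norm y)\<^sup>2 - 2 * (x \<bullet> y) + 1"

lemma reflected_sq_alt:
  "reflected_sq y x = (norm y)\<^sup>2 * (norm (x - 0))\<^sup>2 + (\<Sum>i\<in>UNIV. (- 2 * y $ i) * x $ i) + 1"
  by (simp add: reflected_sq_def inner_vec_def sum_distrib_left sum_negf mult_ac)

lemma Ck_on_reflected_sq: "Ck_on k UNIV (reflected_sq y)"
  unfolding reflected_sq_alt
  by (intro Ck_on_add Ck_on_mult Ck_on_norm2 Ck_on_const Ck_on_sum Ck_on_coord)

lemma partial_reflected_sq:
  "partial i (reflected_sq y) = (\<lambda>x. 2 * (norm y)\<^sup>2 * x $ i - 2 * y $ i)"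
proof
  fix x
  have "((\<lambda>x. (x \<bullet> x) * (norm y)\<^sup>2 - 2 * (x \<bullet> y) + 1) has_derivative
      (\<lambda>h. 2 * (x \<bullet> h) * (norm y)\<^sup>2 - 2 * (h \<bullet> y))) (at x)"
    by (auto intro!: derivative_eq_intros simp: inner_commute)
  from partial_eqI[OF this, of i]
  show "partial i (reflected_sq y) x = 2 * (norm y)\<^sup>2 * x $ i - 2 * y $ i"
    by (simp add: reflected_sq_def[abs_def] power2_norm_eq_inner inner_axis inner_commute[of "axis i 1"])
qed

lemma laplacian_reflected_sq:
  "laplacian (reflected_sq y) (x::real^'n) = 2 * real CARD('n) * (norm y)\<^sup>2"
proof -
  have "partial i (partial i (reflected_sq y)) x = 2 * (norm y)\<^sup>2" for i
  proof -
    have "((\<lambda>x. 2 * (norm y)\<^sup>2 * x $ i - 2 * y $ i) has_derivative (\<lambda>h. 2 * (norm y)\<^sup>2 * h $ i)) (at x)"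
      by (auto intro!: derivative_eq_intros has_derivative_coord)
    from partial_eqI[OF this, of i] show ?thesis by (simp add: partial_reflected_sq)
  qed
  then show ?thesis by (simp add: laplacian_def)
qed

lemma sum_partial_reflected_sq:
  "(\<Sum>i\<in>UNIV. (partial i (reflected_sq y) x)\<^sup>2) = 4 * (norm y)\<^sup>2 * reflected_sq y x"
proof -
  have *: "(a *\<^sub>R x - b *\<^sub>R y) \<bullet> (a *\<^sub>R x - b *\<^sub>R y) =
      a * a * (x \<bullet> x) - 2 * a * b * (x \<bullet> y) + b * b * (y \<bullet> y)" for a b
    by (simp add: inner_diff_left inner_diff_right inner_commute[of y x]) (simp add: algebra_simps)
  have "(\<Sum>i\<in>UNIV. (partial i (reflected_sq y) x)\<^sup>2) =
      ((2 * (norm y)\<^sup>2) *\<^sub>R x - 2 *\<^sub>R y) \<bullet> ((2 * (norm y)\<^sup>2) *\<^sub>R x - 2 *\<^sub>R y)"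
    unfolding partial_reflected_sq by (simp add: inner_vec_def power2_eq_square mult_ac)
  also have "\<dots> = 4 * (norm y)\<^sup>2 * reflected_sq y x"
    unfolding * reflected_sq_def power2_norm_eq_inner by (simp add: algebra_simps)
  finally show ?thesis .
qed

text \<open>\<open>reflected_sq y\<close> satisfies the same gradient and Laplacian identities as a
  squared distance, with an extra factor \<open>|y|^2\<close>. Composition therefore leads to the
  same radial equation, also for \<open>y = 0\<close>.\<close>

lemma laplacian_comp_reflected_sq:
  assumes "\<And>t. (F has_real_derivative F' t) (at t)" "\<And>t. (F' has_real_derivative F'' t) (at t)"
  shows "laplacian (\<lambda>x. F (reflected_sq y x)) (x::real^'n) = (norm y)\<^sup>2 *
    (4 * reflected_sq y x * F'' (reflected_sq y x) + 2 * real CARD('n) * F' (reflected_sq y x))"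
  using laplacian_comp[of F F' F'' "reflected_sq y" x, OF assms Ck_on_reflected_sq]
  by (simp add: sum_partial_reflected_sq laplacian_reflected_sq algebra_simps)

section \<open>Green's identity\<close>

lemma DERIV_along_axis:
  assumes "\<And>x. f differentiable at x"
  shows "((\<lambda>t. f (x + t *\<^sub>R axis i 1)) has_real_derivative partial i f (x + t *\<^sub>R axis i 1)) (at t)"
proof -
  obtain f' where f': "(f has_derivative f') (at (x + t *\<^sub>R axis i 1))"
    using assms differentiable_def by blast
  have "((\<lambda>t. x + t *\<^sub>R axis i 1) has_derivative (\<lambda>h. h *\<^sub>R axis i (1::real))) (at t)"
    by (auto intro!: derivative_eq_intros)
  from has_derivative_compose[OF this f']
  have "((\<lambda>t. f (x + t *\<^sub>R axis i 1)) has_derivative (\<lambda>h. f' (h *\<^sub>R axis i 1))) (at t)" .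
  moreover have "(\<lambda>h. f' (h *\<^sub>R axis i 1)) = (*) (partial i f (x + t *\<^sub>R axis i 1))"
    using linear_scale[OF has_derivative_linear[OF f']] by (auto simp: partial_eqI[OF f'] fun_eq_iff)
  ultimately show ?thesis by (simp add: has_field_derivative_def)
qed

lemma integrable_continuous_bounded_support:
  fixes f :: "'a::euclidean_space \<Rightarrow> real"
  assumes "continuous_on UNIV f" "bounded {x. f x \<noteq> 0}"
  shows "integrable lborel f"
proof -
  let ?K = "closure {x. f x \<noteq> 0}"
  have "integrable lborel (\<lambda>x. indicator ?K x *\<^sub>R f x)"
    using assms by (intro borel_integrable_compact) (auto elim: continuous_on_subset)
  moreover have "(\<lambda>x. indicator ?K x *\<^sub>R f x) = f"
    using closure_subset[of "{x. f x \<noteq> 0}"] by (auto simp: indicator_def fun_eq_iff)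
  ultimately show ?thesis by (simp only:)
qed

lemma lborel_integral_translate:
  fixes f :: "'a::euclidean_space \<Rightarrow> real"
  assumes "f \<in> borel_measurable borel"
  shows "(LINT x|lborel. f (x + c)) = (LINT x|lborel. f x)"
proof -
  have "(LINT x|lborel. f x) = (LINT x|distr lborel borel ((+) c). f x)"
    by (simp add: lborel_distr_plus)
  also have "\<dots> = (LINT x|lborel. f (c + x))"
    using assms by (intro integral_distr) auto
  finally show ?thesis by (simp add: add.commute)
qed

lemma partial_eq_0_off_support:
  assumes "x \<notin> closure {x. f x \<noteq> 0}" shows "partial i f x = 0"
proof -
  let ?U = "- closure {x. f x \<noteq> 0}"
  have "((\<lambda>_. 0) has_derivative (\<lambda>_. 0)) (at x)" by simp
  then have "(f has_derivative (\<lambda>_. 0)) (at x)"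
    by (rule has_derivative_transform_within_open[where s="?U"])
      (use assms closure_subset[of "{x. f x \<noteq> 0}"] in auto)
  from partial_eqI[OF this] show ?thesis by simp
qed

text \<open>By translation invariance every difference quotient integrates to zero; dominated
  convergence passes this on to the derivative.\<close>

lemma integral_partial_eq_0:
  fixes W :: "real^'n::finite \<Rightarrow> real"
  assumes W: "Ck_on (Suc 0) UNIV W" and bd: "bounded {x. W x \<noteq> 0}"
  shows "(LINT x|lborel. partial i W x) = 0"
proof -
  let ?e = "axis i 1 :: real^'n"
  have diff: "W differentiable at x" for x using W by auto
  have cont: "continuous_on UNIV W" using Ck_on_le[OF W, of 0] by auto
  have contp: "continuous_on UNIV (partial i W)" using W by auto
  obtain R where R: "R > 0" "\<And>x. W x \<noteq> 0 \<Longrightarrow> norm x \<le> R"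
    using bd unfolding bounded_pos by blast
  have off: "partial i W x = 0" if "norm x > R" for x
  proof (rule partial_eq_0_off_support)
    have "closure {x. W x \<noteq> 0} \<subseteq> cball 0 R"
      by (rule closure_minimal) (use R in auto)
    then show "x \<notin> closure {x. W x \<noteq> 0}" using that by auto
  qed
  obtain B where "0 \<le> B" "\<forall>x\<in>cball 0 R. \<bar>partial i W x\<bar> \<le> B"
    using ex_abs_bound_on_compact[of "cball 0 R" "partial i W"] continuous_on_subset[OF contp] by auto
  then have B: "\<bar>partial i W x\<bar> \<le> B" for x
    using off[of x] by (cases "norm x \<le> R") auto
  define s where "s m x = (W (x + inverse (real (Suc m)) *\<^sub>R ?e) - W x) / inverse (real (Suc m))"
    for m x
  have Wint: "integrable lborel W" by (intro integrable_continuous_bounded_support cont bd)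
  have Wmeas: "W \<in> borel_measurable borel" using cont by (rule borel_measurable_continuous_onI)
  have Wtint: "integrable lborel (\<lambda>x. W (x + c))" for c
  proof (rule integrable_continuous_bounded_support)
    show "continuous_on UNIV (\<lambda>x. W (x + c))"
      by (intro continuous_on_compose2[OF cont] continuous_intros) auto
    have "{x. W (x + c) \<noteq> 0} \<subseteq> cball (- c) R" using R(2) by (auto simp: dist_norm norm_minus_commute)
    then show "bounded {x. W (x + c) \<noteq> 0}" using bounded_subset bounded_cball by blast
  qed
  have s0: "(LINT x|lborel. s m x) = 0" for m
    unfolding s_def using Wint Wtint lborel_integral_translate[OF Wmeas] by simp
  have "(\<lambda>m. LINT x|lborel. s m x) \<longlonglongrightarrow> (LINT x|lborel. partial i W x)"
  \<comment> \<open>The mean value theorem bounds the quotients by \<open>B\<close>; as the steps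
    are at most 1, the quotients vanish outside the ball of radius \<open>R + 1\<close>.\<close>
  proof (rule integral_dominated_convergence[where w="\<lambda>x. B * indicator (cball 0 (R + 1)) x"])
    show "partial i W \<in> borel_measurable lborel" using contp by (simp add: borel_measurable_continuous_onI)
    show "s m \<in> borel_measurable lborel" for m
      unfolding s_def using Wint Wtint by (intro borel_measurable_integrable) auto
    show "integrable lborel (\<lambda>x. B * indicator (cball 0 (R + 1)) x)"
      using emeasure_lborel_cball_finite by (intro integrable_mult_right integrable_real_indicator) auto
    show "AE x in lborel. (\<lambda>m. s m x) \<longlonglongrightarrow> partial i W x"
    proof (rule AE_I2)
      fix x
      have "((\<lambda>t. W (x + t *\<^sub>R ?e)) has_real_derivative partial i W (x + 0 *\<^sub>R ?e)) (at 0)"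
        by (rule DERIV_along_axis[OF diff])
      then have "((\<lambda>h. (W (x + h *\<^sub>R ?e) - W x) / h) \<longlongrightarrow> partial i W x) (at 0)"
        by (simp add: DERIV_def)
      moreover have "filterlim (\<lambda>m. inverse (real (Suc m))) (at 0) sequentially"
        using LIMSEQ_inverse_real_of_nat by (simp add: filterlim_at)
      ultimately show "(\<lambda>m. s m x) \<longlonglongrightarrow> partial i W x"
        unfolding s_def by (rule filterlim_compose)
    qed
    show "AE x in lborel. norm (s m x) \<le> B * indicator (cball 0 (R + 1)) x" for m
    proof (rule AE_I2)
      fix x
      define h where "h = inverse (real (Suc m))"
      have sh: "s m x = (W (x + h *\<^sub>R ?e) - W x) / h" unfolding s_def h_def ..
      have h: "0 < h" "h \<le> 1" by (auto simp: h_def field_simps)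
      obtain z where "W (x + h *\<^sub>R ?e) - W (x + 0 *\<^sub>R ?e) = (h - 0) * partial i W (x + z *\<^sub>R ?e)"
        using MVT2[OF h(1), of "\<lambda>t. W (x + t *\<^sub>R ?e)" "\<lambda>t. partial i W (x + t *\<^sub>R ?e)"]
          DERIV_along_axis[OF diff] by blast
      then have sz: "s m x = partial i W (x + z *\<^sub>R ?e)" using h by (simp add: sh)
      show "norm (s m x) \<le> B * indicator (cball 0 (R + 1)) x"
      proof (cases "norm x \<le> R + 1")
        case True
        then show ?thesis using sz B by simp
      next
        case False
        have "norm x \<le> norm (x + h *\<^sub>R ?e) + norm (h *\<^sub>R ?e)" by (metis norm_triangle_sub add_diff_cancel_left' add.commute norm_minus_commute)
        then have "norm (x + h *\<^sub>R ?e) > R" using False h by simp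
        then have "W (x + h *\<^sub>R ?e) = 0" "W x = 0" using R(2) False by force+
        then show ?thesis using False by (simp add: sh)
      qed
    qed
  qed
  then show ?thesis using s0 by (simp add: LIMSEQ_const_iff)
qed

lemma test_functionsI:
  fixes \<phi> :: "real^'n::finite \<Rightarrow> real"
  assumes "\<And>k. Ck_on k UNIV \<phi>" "\<And>x. \<phi> x \<noteq> 0 \<Longrightarrow> norm (x - p) \<le> r" "cball p r \<subseteq> \<Omega>"
  shows "\<phi> \<in> test_functions \<Omega>"
proof -
  have "closure {x. \<phi> x \<noteq> 0} \<subseteq> cball p r"
    by (rule closure_minimal) (use assms(2) in \<open>auto simp: dist_norm norm_minus_commute\<close>)
  then show ?thesis using assms unfolding test_functions_def
    by (auto intro: bounded_subset simp: compact_eq_bounded_closed)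
qed

lemma test_functionsD:
  fixes \<phi> :: "real^'n::finite \<Rightarrow> real"
  assumes "\<phi> \<in> test_functions \<Omega>"
  shows "Ck_on k UNIV \<phi>" "bounded {x. \<phi> x \<noteq> 0}" "bounded {x. laplacian \<phi> x \<noteq> 0}"
    "x \<notin> \<Omega> \<Longrightarrow> \<phi> x = 0" "x \<notin> \<Omega> \<Longrightarrow> laplacian \<phi> x = 0"
    "continuous_on UNIV \<phi>" "continuous_on UNIV (laplacian \<phi>)"
    "bounded {x. partial i \<phi> x \<noteq> 0}"
proof -
  show C: "Ck_on k UNIV \<phi>" for k using assms by (simp add: test_functions_def)
  let ?K = "closure {x. \<phi> x \<noteq> 0}"
  have K: "bounded ?K" "?K \<subseteq> \<Omega>" using assms by (auto simp: test_functions_def compact_imp_bounded)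
  have z0: "{x. \<phi> x \<noteq> 0} \<subseteq> ?K" by (rule closure_subset)
  have z1: "{x. partial i \<phi> x \<noteq> 0} \<subseteq> ?K" for i using partial_eq_0_off_support[of _ \<phi> i] by blast
  have z2: "partial i (partial i \<phi>) x = 0" if "x \<notin> ?K" for i x
  proof (rule partial_eq_0_off_support)
    have "closure {x. partial i \<phi> x \<noteq> 0} \<subseteq> ?K" by (rule closure_minimal[OF z1]) simp
    then show "x \<notin> closure {x. partial i \<phi> x \<noteq> 0}" using that by blast
  qed
  have z3: "laplacian \<phi> x = 0" if "x \<notin> ?K" for x using z2[OF that] by (simp add: laplacian_def)
  show "bounded {x. \<phi> x \<noteq> 0}" "bounded {x. partial i \<phi> x \<noteq> 0}"
    using K(1) z0 z1 bounded_subset by blast+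
  show "bounded {x. laplacian \<phi> x \<noteq> 0}"
    by (rule bounded_subset[OF K(1)]) (use z3 in auto)
  show "x \<notin> \<Omega> \<Longrightarrow> \<phi> x = 0" "x \<notin> \<Omega> \<Longrightarrow> laplacian \<phi> x = 0" using z0 z3 K(2) by auto
  show "continuous_on UNIV \<phi>" using C[of 0] by simp
  show "continuous_on UNIV (laplacian \<phi>)" using C by (rule continuous_on_laplacian)
qed

text \<open>The field with components \<open>W i\<close> has bounded support because
  \<open>\<phi>\<close> has, and its divergence is the difference of the two integrands.\<close>

lemma green_identity:
  fixes f \<phi> :: "real^'n::finite \<Rightarrow> real"
  assumes f: "Ck_on (Suc (Suc 0)) UNIV f" and \<phi>: "\<phi> \<in> test_functions \<Omega>"
  shows "(LINT x|lborel. f x * laplacian \<phi> x) = (LINT x|lborel. laplacian f x * \<phi> x)"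
proof -
  note p = test_functionsD[OF \<phi>]
  have p2: "Ck_on (Suc (Suc 0)) UNIV \<phi>" by (rule p(1))
  note fd = Ck_on_2D[OF f] and pd = Ck_on_2D[OF p2]
  define W where "W i x = f x * partial i \<phi> x - \<phi> x * partial i f x" for i x
  have C: "Ck_on (Suc 0) UNIV (W i)" for i
  proof -
    have "Ck_on (Suc 0) UNIV f" "Ck_on (Suc 0) UNIV (partial i \<phi>)" "Ck_on (Suc 0) UNIV (partial i f)"
      using f p2 Ck_on_Suc_imp[OF f] by auto
    then show ?thesis unfolding W_def using p(1) by (intro Ck_on_diff Ck_on_mult)
  qed
  have bd: "bounded {x. W i x \<noteq> 0}" for i
    by (rule bounded_subset[of "{x. \<phi> x \<noteq> 0} \<union> {x. partial i \<phi> x \<noteq> 0}"]) (use p in \<open>auto simp: W_def\<close>)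
  have pW: "partial i (W i) x = f x * partial i (partial i \<phi>) x - \<phi> x * partial i (partial i f) x" for i x
  proof -
    have "partial i (\<lambda>x. f x * partial i \<phi> x) x = partial i (\<lambda>x. W i x + \<phi> x * partial i f x) x"
      by (simp add: W_def)
    also have "\<dots> = partial i (W i) x + partial i (\<lambda>x. \<phi> x * partial i f x) x"
      using C[of i] fd pd by (intro partial_add differentiable_mult) auto
    finally show ?thesis using fd pd by (simp add: partial_mult)
  qed
  have sumW: "(\<Sum>i\<in>UNIV. partial i (W i) x) = f x * laplacian \<phi> x - laplacian f x * \<phi> x" for x
    by (simp add: pW laplacian_def sum_subtractf sum_distrib_left sum_distrib_right mult.commute)
  have int: "integrable lborel (partial i (W i))" for i
  proof (rule integrable_continuous_bounded_support)
    show "continuous_on UNIV (partial i (W i))" using C[of i] by auto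
    have "{x. partial i (W i) x \<noteq> 0} \<subseteq> closure {x. W i x \<noteq> 0}"
      using partial_eq_0_off_support by blast
    then show "bounded {x. partial i (W i) x \<noteq> 0}" using bd bounded_closure bounded_subset by blast
  qed
  have i1: "integrable lborel (\<lambda>x. f x * laplacian \<phi> x)"
  proof (rule integrable_continuous_bounded_support)
    show "continuous_on UNIV (\<lambda>x. f x * laplacian \<phi> x)" by (intro continuous_on_mult fd p)
    show "bounded {x. f x * laplacian \<phi> x \<noteq> 0}" by (rule bounded_subset[OF p(3)]) auto
  qed
  have i2: "integrable lborel (\<lambda>x. laplacian f x * \<phi> x)"
  proof (rule integrable_continuous_bounded_support)
    show "continuous_on UNIV (\<lambda>x. laplacian f x * \<phi> x)"
      by (intro continuous_on_mult continuous_on_laplacian f p)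
    show "bounded {x. laplacian f x * \<phi> x \<noteq> 0}" by (rule bounded_subset[OF p(2)]) auto
  qed
  have "(LINT x|lborel. f x * laplacian \<phi> x - laplacian f x * \<phi> x) =
      (LINT x|lborel. (\<Sum>i\<in>UNIV. partial i (W i) x))"
    by (simp add: sumW)
  also have "\<dots> = (\<Sum>i\<in>UNIV. LINT x|lborel. partial i (W i) x)"
    using int by (intro Bochner_Integration.integral_sum) auto
  also have "\<dots> = 0" using integral_partial_eq_0[OF C bd] by simp
  finally show ?thesis using i1 i2 by simp
qed

lemma integral_laplacian_eq_0:
  assumes "\<phi> \<in> test_functions \<Omega>" shows "(LINT x|lborel. laplacian \<phi> x) = 0"
  using green_identity[OF Ck_on_const[of _ _ 1] assms] by (simp add: laplacian_const)

lemma set_integral_eq_lborel_integral: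
  fixes f :: "'a::euclidean_space \<Rightarrow> real"
  assumes "\<And>x. x \<notin> A \<Longrightarrow> f x = 0"
  shows "(LINT x:A|lborel. f x) = (LINT x|lborel. f x)"
  unfolding set_lebesgue_integral_def
  by (rule Bochner_Integration.integral_cong) (use assms in \<open>auto simp: indicator_def\<close>)

section \<open>Mollifiers and the maximum principle\<close>

definition mollifier :: "real \<Rightarrow> real^'n::finite \<Rightarrow> real" where
  "mollifier e x = radial_mollifier (real CARD('n)) e ((norm x)\<^sup>2)"

definition smoothed_newton :: "real \<Rightarrow> real^'n::finite \<Rightarrow> real" where
  "smoothed_newton e x = smoothed_profile (real CARD('n)) e ((norm x)\<^sup>2)"

text \<open>The type argument only carries the dimension. The mass is read off at scale 1; that
  other scales share it is proved below.\<close>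

definition mollifier_mass :: "'n::finite itself \<Rightarrow> real" where
  "mollifier_mass _ = (LINT x::real^'n|lborel. mollifier 1 x)"

lemma Ck_on_smoothed_newton: "0 < e \<Longrightarrow> Ck_on k UNIV (\<lambda>x. smoothed_newton e (x - p))"
  unfolding smoothed_newton_def by (rule Ck_on_comp[OF Ck_real_smoothed_profile Ck_on_norm2])

lemma laplacian_smoothed_newton:
  assumes "0 < e" shows "laplacian (\<lambda>x. smoothed_newton e (x - p)) x = mollifier e (x - p)"
  unfolding smoothed_newton_def mollifier_def
  by (simp add: laplacian_radial[OF DERIV_smoothed_profile[OF assms] DERIV_radial_deriv[OF assms]]
      radial_deriv_ode[OF assms])

lemma Ck_on_mollifier: "0 < e \<Longrightarrow> Ck_on k UNIV (\<lambda>x. mollifier e (x - p))"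
  unfolding mollifier_def by (rule Ck_on_comp[OF Ck_real_radial_mollifier Ck_on_norm2])

lemma continuous_mollifier: "0 < e \<Longrightarrow> continuous_on UNIV (\<lambda>x. mollifier e (x - p))"
  using Ck_on_mollifier[of e 0 p] by simp

lemma mollifier_nonneg: "0 \<le> mollifier e x"
  by (simp add: mollifier_def radial_mollifier_nonneg)

lemma mollifier_eq_0: "0 < e \<Longrightarrow> e \<le> norm x \<Longrightarrow> mollifier e x = 0"
  unfolding mollifier_def by (intro radial_mollifier_eq_0) (auto simp: power_mono)

lemma bounded_mollifier: "0 < e \<Longrightarrow> bounded {x. mollifier e (x - p) \<noteq> 0}"
  by (rule bounded_subset[OF bounded_cball[of p e]])
    (use mollifier_eq_0 in \<open>force simp: dist_norm norm_minus_commute\<close>)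

lemma integrable_mult_mollifier:
  assumes "0 < e" "continuous_on UNIV f"
  shows "integrable lborel (\<lambda>x. f x * mollifier e (x - p))"
proof (rule integrable_continuous_bounded_support)
  show "continuous_on UNIV (\<lambda>x. f x * mollifier e (x - p))"
    by (intro continuous_on_mult continuous_mollifier assms)
  show "bounded {x. f x * mollifier e (x - p) \<noteq> 0}"
    by (rule bounded_subset[OF bounded_mollifier[OF assms(1)]]) auto
qed

lemma integrable_mollifier: "0 < e \<Longrightarrow> integrable lborel (\<lambda>x. mollifier e (x - p))"
  using integrable_mult_mollifier[of e "\<lambda>_. 1" p] by simp

text \<open>Outside the ball of radius \<open>r\<close> both terms equal the same fundamental
  profile, so the difference has compact support. The bound \<open>r <= 1\<close> comes from the
  normalisation at 1.\<close>

lemma smoothed_newton_diff_test: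
  assumes e: "0 < e" "e \<le> r" "r \<le> 1" and sub: "cball p r \<subseteq> \<Omega>"
  shows "(\<lambda>x. smoothed_newton e (x - p) - smoothed_newton r (x - p)) \<in> test_functions \<Omega>"
    and "laplacian (\<lambda>x. smoothed_newton e (x - p) - smoothed_newton r (x - p)) x =
      mollifier e (x - p) - mollifier r (x - p)"
proof -
  have r: "0 < r" using e by simp
  show "(\<lambda>x. smoothed_newton e (x - p) - smoothed_newton r (x - p)) \<in> test_functions \<Omega>"
  proof (rule test_functionsI[OF _ _ sub])
    show "Ck_on k UNIV (\<lambda>x. smoothed_newton e (x - p) - smoothed_newton r (x - p))" for k
      by (intro Ck_on_diff Ck_on_smoothed_newton e r)
    show "norm (x - p) \<le> r" if "smoothed_newton e (x - p) - smoothed_newton r (x - p) \<noteq> 0" for x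
    proof (rule ccontr)
      assume "\<not> norm (x - p) \<le> r"
      then have "r\<^sup>2 \<le> (norm (x - p))\<^sup>2" "e\<^sup>2 \<le> (norm (x - p))\<^sup>2" using e by (auto intro!: power_mono)
      with that e r show False by (simp add: smoothed_newton_def smoothed_profile_eq)
    qed
  qed
  show "laplacian (\<lambda>x. smoothed_newton e (x - p) - smoothed_newton r (x - p)) x =
      mollifier e (x - p) - mollifier r (x - p)"
    by (simp only: laplacian_diff[OF Ck_on_smoothed_newton[OF e(1)] Ck_on_smoothed_newton[OF r]]
        laplacian_smoothed_newton e r)
qed

text \<open>The difference of two mollifiers with the same centre is the Laplacian of a test
  function and so has integral zero.\<close>

lemma integral_mollifier:
  fixes p :: "real^'n::finite"
  assumes "0 < e" "e \<le> 1"
  shows "(LINT x|lborel. mollifier e (x - p)) = mollifier_mass TYPE('n)"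
proof -
  have 1: "(LINT x|lborel. mollifier a (x - p)) = (LINT x::real^'n|lborel. mollifier a x)" if "0 < a" for a
  proof -
    have "mollifier a \<in> borel_measurable (borel :: (real^'n) measure)"
      using continuous_mollifier[OF that, of 0] by (intro borel_measurable_continuous_onI) simp
    from lborel_integral_translate[OF this, of "- p"] show ?thesis by simp
  qed
  have "(LINT x|lborel. mollifier e (x - p) - mollifier 1 (x - p)) = 0"
    using integral_laplacian_eq_0[OF smoothed_newton_diff_test(1)[of e 1 p UNIV]]
      smoothed_newton_diff_test(2)[of e 1 p UNIV] assms by simp
  then have "(LINT x|lborel. mollifier e (x - p)) = (LINT x|lborel. mollifier 1 (x - p))"
    using Bochner_Integration.integral_diff[OF integrable_mollifier[OF assms(1), of p] integrable_mollifier[of 1 p]]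
    by simp
  then show ?thesis using 1[of 1] by (simp add: mollifier_mass_def)
qed

lemma continuous_nonneg_integral_0:
  fixes f :: "'a::euclidean_space \<Rightarrow> real"
  assumes "continuous_on UNIV f" "\<And>x. 0 \<le> f x" "integrable lborel f" "(LINT x|lborel. f x) \<le> 0"
  shows "f x = 0"
proof (rule ccontr)
  assume "f x \<noteq> 0"
  let ?S = "{x. f x \<noteq> 0}"
  have "(LINT x|lborel. f x) = 0" using assms by (intro antisym integral_nonneg_AE) auto
  then have "AE x in lborel. f x = 0"
    using integral_nonneg_eq_0_iff_AE[OF assms(3)] assms(2) by simp
  moreover have "open ?S"
    using assms(1) by (intro open_Collect_neq) auto
  ultimately have "?S \<in> null_sets lborel"
    by (subst AE_iff_null_sets) auto
  then have "negligible ?S"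
    by (simp add: negligible_iff_null_sets null_sets_completionI)
  then show False using open_not_negligible \<open>open ?S\<close> \<open>f x \<noteq> 0\<close> by blast
qed

lemma mollifier_pos:
  assumes "0 < e" "e / 2 < norm x" "norm x < e" shows "0 < mollifier e x"
proof -
  have "(e / 2)\<^sup>2 < (norm x)\<^sup>2" "(norm x)\<^sup>2 < e\<^sup>2"
    using assms by (auto intro!: power_strict_mono)
  then show ?thesis unfolding mollifier_def
    using assms(1) by (intro radial_mollifier_pos) (auto simp: power_divide)
qed

lemma mollifier_mass_pos: "0 < mollifier_mass TYPE('n::finite)"
proof (rule ccontr)
  assume "\<not> 0 < mollifier_mass TYPE('n)"
  then have *: "(LINT x::real^'n|lborel. mollifier 1 x) \<le> 0" by (simp add: mollifier_mass_def)
  define x :: "real^'n" where "x = (3/4) *\<^sub>R axis undefined 1"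
  have "mollifier 1 x = 0"
    by (rule continuous_nonneg_integral_0[OF _ mollifier_nonneg _ *])
      (use continuous_mollifier[of 1 "0 :: real^'n"] integrable_mollifier[of 1 "0 :: real^'n"] in auto)
  moreover have "0 < mollifier 1 x" by (rule mollifier_pos) (auto simp: x_def)
  ultimately show False by simp
qed

text \<open>At a maximum point \<open>p\<close> of largest norm, the mollified means of \<open>M - d\<close> around \<open>p\<close> do not depend on the radius, hence vanish.\<close>

lemma weakly_harmonic_nonpos:
  fixes d :: "real^'n::finite \<Rightarrow> real"
  assumes cont: "continuous_on UNIV d"
    and bdry: "\<And>x. norm x = 1 \<Longrightarrow> d x \<le> 0"
    and weak: "\<And>\<phi>. \<phi> \<in> test_functions (ball 0 1) \<Longrightarrow> (LINT x|lborel. d x * laplacian \<phi> x) = 0"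
    and y: "norm y \<le> 1"
  shows "d y \<le> 0"
proof (rule ccontr)
  assume "\<not> d y \<le> 0"
  obtain q where q: "q \<in> cball 0 1" "\<And>x. x \<in> cball 0 1 \<Longrightarrow> d x \<le> d q"
    using continuous_attains_sup[of "cball 0 1" d] continuous_on_subset[OF cont, of "cball 0 1"] by auto
  define M where "M = d q"
  have M: "M > 0" using q(2)[of y] y \<open>\<not> d y \<le> 0\<close> by (simp add: M_def)
  let ?K = "cball 0 1 \<inter> {x. d x = M}"
  have "closed {x. d x = M}" using cont by (intro closed_Collect_eq continuous_on_const)
  then have K: "compact ?K" by (intro compact_Int_closed) auto
  have "q \<in> ?K" using q by (simp add: M_def)
  then obtain p where p: "p \<in> ?K" "\<And>x. x \<in> ?K \<Longrightarrow> norm x \<le> norm p"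
    using continuous_attains_sup[OF K, of norm] continuous_on_norm_id[of ?K] by blast
  have p1: "norm p < 1" using p(1) bdry[of p] M by force
  \<comment> \<open>Half the distance from \<open>p\<close> to the unit sphere; the boundary values
    exclude a positive maximum on the sphere itself.\<close>
  define r where "r = (1 - norm p) / 2"
  have r: "0 < r" "r \<le> 1" using p1 norm_ge_zero[of p] by (auto simp: r_def simp del: norm_ge_zero)
  have inball: "norm x < 1" if "norm (x - p) \<le> r" for x
  proof -
    have "norm x \<le> norm (x - p) + norm p" using norm_triangle_ineq[of "x - p" p] by simp
    then show ?thesis using that p1 by (simp add: r_def)
  qed
  have sub: "cball p r \<subseteq> ball 0 1" using inball by (auto simp: dist_norm norm_minus_commute)
  define I where "I e = (LINT x|lborel. (M - d x) * mollifier e (x - p))" for e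
  have dint: "integrable lborel (\<lambda>x. d x * mollifier e (x - p))" if "0 < e" for e
    by (rule integrable_mult_mollifier[OF that cont])
  have I: "I e = M * mollifier_mass TYPE('n) - (LINT x|lborel. d x * mollifier e (x - p))"
    if "0 < e" "e \<le> 1" for e
    unfolding I_def left_diff_distrib
    using dint[OF that(1)] integrable_mollifier[OF that(1), of p] integral_mollifier[OF that, of p] by simp
  have Ieq: "I e = I r" if "0 < e" "e \<le> r" for e
  proof -
    have "(LINT x|lborel. d x * mollifier e (x - p) - d x * mollifier r (x - p)) = 0"
      using weak[OF smoothed_newton_diff_test(1)[OF that r(2) sub]]
        smoothed_newton_diff_test(2)[OF that r(2) sub] by (simp add: right_diff_distrib)
    then show ?thesis using that r I[of e] I[of r] dint by simp
  qed
  have dle: "d x \<le> M" if "norm (x - p) \<le> r" for x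
    using q(2)[of x] inball[OF that] by (simp add: M_def)
  \<comment> \<open>Continuity at \<open>p\<close> makes \<open>I e\<close> small for small
    \<open>e\<close>, and \<open>I e\<close> equals \<open>I r\<close>.\<close>
  have small: "I r \<le> \<eta> * mollifier_mass TYPE('n)" if \<eta>: "\<eta> > 0" for \<eta>
  proof -
    have "isCont d p" using cont by (simp add: continuous_on_eq_continuous_at)
    then obtain \<delta> where \<delta>: "\<delta> > 0" "\<And>x. dist x p < \<delta> \<Longrightarrow> dist (d x) (d p) < \<eta>"
      using \<eta> unfolding continuous_at_eps_delta by blast
    define e where "e = min \<delta> r"
    have e: "0 < e" "e \<le> r" "e \<le> 1" "e \<le> \<delta>" using \<delta> r by (auto simp: e_def)
    have "I e \<le> (LINT x|lborel. \<eta> * mollifier e (x - p))"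
      unfolding I_def
    proof (rule integral_mono)
      show "integrable lborel (\<lambda>x. (M - d x) * mollifier e (x - p))"
        by (intro integrable_mult_mollifier e continuous_intros cont)
      show "integrable lborel (\<lambda>x. \<eta> * mollifier e (x - p))"
        using integrable_mollifier[OF e(1), of p] by simp
      show "(M - d x) * mollifier e (x - p) \<le> \<eta> * mollifier e (x - p)" for x
      proof (cases "norm (x - p) < e")
        case True
        then have "\<bar>d x - M\<bar> < \<eta>" using \<delta>(2)[of x] e p(1) by (auto simp: dist_norm)
        then show ?thesis by (intro mult_right_mono mollifier_nonneg) auto
      next
        case False
        then show ?thesis using mollifier_eq_0[OF e(1), of "x - p"] by simp
      qed
    qed
    then show ?thesis using integral_mollifier[OF e(1,3), of p] Ieq[OF e(1,2)] by simp
  qed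
  have "I r \<le> 0"
  proof (rule field_le_epsilon)
    fix \<eta> :: real assume "0 < \<eta>"
    then show "I r \<le> 0 + \<eta>"
      using small[of "\<eta> / mollifier_mass TYPE('n)"] mollifier_mass_pos[where 'n='n] by simp
  qed
  then have zero: "(M - d x) * mollifier r (x - p) = 0" for x
    unfolding I_def
  proof (intro continuous_nonneg_integral_0[of "\<lambda>x. (M - d x) * mollifier r (x - p)"])
    show "continuous_on UNIV (\<lambda>x. (M - d x) * mollifier r (x - p))"
      by (intro continuous_on_mult continuous_mollifier continuous_on_diff continuous_on_const cont r)
    show "integrable lborel (\<lambda>x. (M - d x) * mollifier r (x - p))"
      by (intro integrable_mult_mollifier r continuous_intros cont)
    show "0 \<le> (M - d x) * mollifier r (x - p)" for x
    proof (cases "norm (x - p) \<le> r")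
      case True
      then show ?thesis using dle[OF True] mollifier_nonneg[of r "x - p"] by simp
    next
      case False
      then show ?thesis using mollifier_eq_0[OF r(1), of "x - p"] by simp
    qed
  qed
  \<comment> \<open>The outward direction at \<open>p\<close>, or an arbitrary one when
    \<open>p = 0\<close>. Moving by \<open>3/4 * r\<close> along it reaches the annulus where the
    mollifier is positive, at a point of larger norm where \<open>d\<close> would again attain
    \<open>M\<close>.\<close>
  define v :: "real^'n" where "v = (if p = 0 then axis undefined 1 else (1 / norm p) *\<^sub>R p)"
  have v: "norm v = 1" "p = norm p *\<^sub>R v" by (auto simp: v_def)
  define x where "x = p + (3/4 * r) *\<^sub>R v"
  have "x = (norm p + 3/4 * r) *\<^sub>R v" using v(2) by (simp add: x_def scaleR_left_distrib)
  then have nx: "norm x > norm p" using v(1) r by simp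
  have xp: "norm (x - p) = 3/4 * r" using v(1) r by (simp add: x_def)
  have "0 < mollifier r (x - p)" using r xp by (intro mollifier_pos) auto
  with zero[of x] have "d x = M" by simp
  moreover have "norm x < 1" using inball[of x] xp r by simp
  ultimately show False using p(2)[of x] nx by auto
qed

section \<open>Hausdorff measure\<close>

definition hausdorff_pre :: "nat \<Rightarrow> real \<Rightarrow> 'a::metric_space set \<Rightarrow> ennreal" where
  "hausdorff_pre m \<delta> A = (INF C\<in>hausdorff_covers \<delta> A. \<Sum>j. ennreal (hausdorff_weight m (C j)))"

lemma hausdorff_outer_pre: "hausdorff_outer m A = (SUP \<delta>\<in>{0<..}. hausdorff_pre m \<delta> A)"
  by (simp add: hausdorff_outer_def hausdorff_pre_def)

lemma hausdorff_pre_le: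
  "C \<in> hausdorff_covers \<delta> A \<Longrightarrow> hausdorff_pre m \<delta> A \<le> (\<Sum>j. ennreal (hausdorff_weight m (C j)))"
  unfolding hausdorff_pre_def by (rule INF_lower)

lemma hausdorff_pre_le_outer: "0 < \<delta> \<Longrightarrow> hausdorff_pre m \<delta> A \<le> hausdorff_outer m A"
  unfolding hausdorff_outer_pre by (rule SUP_upper) simp

lemma hausdorff_pre_mono: "A \<subseteq> B \<Longrightarrow> hausdorff_pre m \<delta> A \<le> hausdorff_pre m \<delta> B"
  unfolding hausdorff_pre_def by (rule INF_superset_mono) (auto simp: hausdorff_covers_def)

lemma hausdorff_pre_antimono: "\<epsilon> \<le> \<delta> \<Longrightarrow> hausdorff_pre m \<delta> A \<le> hausdorff_pre m \<epsilon> A"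
  unfolding hausdorff_pre_def
  by (rule INF_superset_mono) (auto simp: hausdorff_covers_def intro: order_trans)

lemma hausdorff_outer_mono: "A \<subseteq> B \<Longrightarrow> hausdorff_outer m A \<le> hausdorff_outer m B"
  unfolding hausdorff_outer_pre by (intro SUP_mono') (auto intro: hausdorff_pre_mono)

lemma hausdorff_outer_empty: "hausdorff_outer m {} = 0"
proof -
  have "hausdorff_pre m \<delta> {} \<le> 0" if "0 < \<delta>" for \<delta>
    using hausdorff_pre_le[of "\<lambda>_. {}" \<delta> "{}" m] that
    by (simp add: hausdorff_covers_def hausdorff_weight_def)
  then have "hausdorff_outer m {} \<le> 0"
    unfolding hausdorff_outer_pre by (intro SUP_least) auto
  then show ?thesis by simp
qed

lemma hausdorff_pre_subadditive:
  "hausdorff_pre m \<delta> (\<Union>i. A i) \<le> (\<Sum>i. hausdorff_pre m \<delta> (A i))"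
proof (rule ennreal_le_epsilon)
  fix e :: real assume e: "0 < e" and fin: "(\<Sum>i. hausdorff_pre m \<delta> (A i)) < top"
  have "\<exists>C\<in>hausdorff_covers \<delta> (A i). (\<Sum>j. ennreal (hausdorff_weight m (C j))) <
      hausdorff_pre m \<delta> (A i) + ennreal (e * (1/2) ^ Suc i)" for i
  proof -
    have "hausdorff_pre m \<delta> (A i) \<le> (\<Sum>i. hausdorff_pre m \<delta> (A i))"
      using sum_le_suminf[of "\<lambda>i. hausdorff_pre m \<delta> (A i)" "{i}"] by simp
    then have "hausdorff_pre m \<delta> (A i) < top" using fin by (rule le_less_trans)
    then have "hausdorff_pre m \<delta> (A i) < hausdorff_pre m \<delta> (A i) + ennreal (e * (1/2) ^ Suc i)"
      using e ennreal_add_left_cancel_less[of "hausdorff_pre m \<delta> (A i)" 0 "ennreal (e * (1/2) ^ Suc i)"] by simp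
    then show ?thesis unfolding hausdorff_pre_def INF_less_iff .
  qed
  then obtain C where C: "\<And>i. C i \<in> hausdorff_covers \<delta> (A i)"
    "\<And>i. (\<Sum>j. ennreal (hausdorff_weight m (C i j))) \<le> hausdorff_pre m \<delta> (A i) + ennreal (e * (1/2) ^ Suc i)"
    by (metis less_imp_le)
  define D where "D k = (case prod_decode k of (i, j) \<Rightarrow> C i j)" for k
  have "D \<in> hausdorff_covers \<delta> (\<Union>i. A i)"
    unfolding hausdorff_covers_def
  proof (intro CollectI conjI allI subsetI)
    fix x assume "x \<in> (\<Union>i. A i)"
    then obtain i where "x \<in> A i" by blast
    with C(1)[of i] obtain j where "x \<in> C i j" by (auto simp: hausdorff_covers_def)
    then have "x \<in> D (prod_encode (i, j))" by (simp add: D_def)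
    then show "x \<in> (\<Union>k. D k)" by blast
  qed (use C(1) in \<open>auto simp: D_def hausdorff_covers_def split: prod.split\<close>)
  then have "hausdorff_pre m \<delta> (\<Union>i. A i) \<le> (\<Sum>k. ennreal (hausdorff_weight m (D k)))"
    by (rule hausdorff_pre_le)
  also have "\<dots> = (\<Sum>k. (\<lambda>(i, j). ennreal (hausdorff_weight m (C i j))) (prod_decode k))"
    by (simp add: D_def split_beta)
  also have "\<dots> = (\<Sum>i. \<Sum>j. ennreal (hausdorff_weight m (C i j)))"
    by (rule suminf_ennreal_2dimen) simp
  also have "\<dots> \<le> (\<Sum>i. hausdorff_pre m \<delta> (A i) + ennreal (e * (1/2) ^ Suc i))"
    by (intro suminf_le C) auto
  also have "\<dots> = (\<Sum>i. hausdorff_pre m \<delta> (A i)) + (\<Sum>i. ennreal (e * (1/2) ^ Suc i))"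
    by (rule suminf_add[symmetric]) auto
  also have "(\<Sum>i. ennreal (e * (1/2) ^ Suc i)) = ennreal e"
  proof (rule suminf_ennreal_eq)
    show "(\<lambda>i. e * (1/2) ^ Suc i) sums e" using sums_mult[OF power_half_series, of e] by simp
  qed (use e in simp)
  finally show "hausdorff_pre m \<delta> (\<Union>i. A i) \<le> (\<Sum>i. hausdorff_pre m \<delta> (A i)) + ennreal e" .
qed

lemma hausdorff_outer_subadditive:
  "hausdorff_outer m (\<Union>i. A i) \<le> (\<Sum>i. hausdorff_outer m (A i))"
proof -
  have "hausdorff_pre m \<delta> (\<Union>i. A i) \<le> (\<Sum>i. hausdorff_outer m (A i))" if "0 < \<delta>" for \<delta>
    using hausdorff_pre_subadditive
    by (rule order_trans) (auto intro!: suminf_le hausdorff_pre_le_outer that)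
  then show ?thesis by (subst hausdorff_outer_pre) (auto intro!: SUP_least)
qed

lemma outer_measure_space_hausdorff: "outer_measure_space UNIV (hausdorff_outer m)"
  unfolding outer_measure_space_def positive_def increasing_def countably_subadditive_def
  by (auto simp: hausdorff_outer_empty hausdorff_outer_mono hausdorff_outer_subadditive)

lemma hausdorff_outer_Un: "hausdorff_outer m (A \<union> B) \<le> hausdorff_outer m A + hausdorff_outer m B"
proof -
  have "hausdorff_outer m (\<Union>i::nat. if i = 0 then A else if i = 1 then B else {}) \<le>
      (\<Sum>i. hausdorff_outer m (if i = 0 then A else if i = 1 then B else {}))"
    by (rule hausdorff_outer_subadditive)
  also have "(\<Union>i::nat. if i = 0 then A else if i = 1 then B else {}) = A \<union> B"
    by (auto split: if_splits)
  also have "(\<Sum>i. hausdorff_outer m (if i = 0 then A else if i = 1 then B else {})) =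
      (\<Sum>i<(2::nat). hausdorff_outer m (if i = 0 then A else if i = 1 then B else {}))"
    by (rule suminf_finite) (auto simp: hausdorff_outer_empty)
  also have "\<dots> = hausdorff_outer m A + hausdorff_outer m B" by (simp add: numeral_2_eq_2)
  finally show ?thesis .
qed

text \<open>A covering set of diameter at most \<open>d / 2\<close> cannot meet both
  \<open>A\<close> and \<open>B\<close>, so every fine cover splits into a cover of each.\<close>

lemma hausdorff_outer_add_separated:
  assumes d: "0 < d" "\<And>a b. a \<in> A \<Longrightarrow> b \<in> B \<Longrightarrow> d \<le> dist a b"
  shows "hausdorff_outer m A + hausdorff_outer m B \<le> hausdorff_outer m (A \<union> B)"
proof -
  have *: "hausdorff_pre m \<delta> A + hausdorff_pre m \<delta> B \<le> hausdorff_pre m \<delta> (A \<union> B)"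
    if \<delta>: "\<delta> \<le> d / 2" for \<delta>
    unfolding hausdorff_pre_def[of m \<delta> "A \<union> B"]
  proof (rule INF_greatest)
    fix C assume C: "C \<in> hausdorff_covers \<delta> (A \<union> B)"
    define CA where "CA j = (if C j \<inter> A = {} then {} else C j)" for j
    define CB where "CB j = (if C j \<inter> B = {} then {} else C j)" for j
    have dpos: "0 \<le> \<delta>" using C diameter_ge_0 unfolding hausdorff_covers_def
      by (metis (mono_tags, lifting) mem_Collect_eq order_trans)
    have "CA \<in> hausdorff_covers \<delta> A" "CB \<in> hausdorff_covers \<delta> B"
      using C dpos unfolding hausdorff_covers_def CA_def CB_def by (fastforce split: if_splits)+
    then have "hausdorff_pre m \<delta> A + hausdorff_pre m \<delta> B \<le>
        (\<Sum>j. ennreal (hausdorff_weight m (CA j))) + (\<Sum>j. ennreal (hausdorff_weight m (CB j)))"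
      by (intro add_mono hausdorff_pre_le)
    also have "\<dots> = (\<Sum>j. ennreal (hausdorff_weight m (CA j)) + ennreal (hausdorff_weight m (CB j)))"
      by (rule suminf_add) auto
    also have "\<dots> \<le> (\<Sum>j. ennreal (hausdorff_weight m (C j)))"
    proof (intro suminf_le)
      fix j
      have "C j \<inter> A = {} \<or> C j \<inter> B = {}"
      proof (rule ccontr)
        assume "\<not> ?thesis"
        then obtain a b where ab: "a \<in> C j" "a \<in> A" "b \<in> C j" "b \<in> B" by blast
        have "dist a b \<le> diameter (C j)"
          using C ab by (intro diameter_bounded_bound) (auto simp: hausdorff_covers_def)
        also have "\<dots> \<le> d / 2" using C \<delta> by (force simp: hausdorff_covers_def dest: spec[of _ j])
        finally show False using d(1) d(2)[OF ab(2,4)] by simp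
      qed
      then show "ennreal (hausdorff_weight m (CA j)) + ennreal (hausdorff_weight m (CB j)) \<le>
          ennreal (hausdorff_weight m (C j))"
        by (auto simp: CA_def CB_def hausdorff_weight_def)
    qed auto
    finally show "hausdorff_pre m \<delta> A + hausdorff_pre m \<delta> B \<le> (\<Sum>j. ennreal (hausdorff_weight m (C j)))" .
  qed
  have le: "hausdorff_pre m \<delta> A + hausdorff_pre m \<epsilon> B \<le> hausdorff_outer m (A \<union> B)"
    if "0 < \<delta>" "0 < \<epsilon>" for \<delta> \<epsilon>
  proof -
    \<comment> \<open>The two suprema run over independent scales; a common finer scale reduces to
      the previous estimate.\<close>
    define \<gamma> where "\<gamma> = min (min \<delta> \<epsilon>) (d / 2)"
    have "hausdorff_pre m \<delta> A + hausdorff_pre m \<epsilon> B \<le> hausdorff_pre m \<gamma> A + hausdorff_pre m \<gamma> B"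
      by (intro add_mono hausdorff_pre_antimono) (auto simp: \<gamma>_def)
    also have "\<dots> \<le> hausdorff_pre m \<gamma> (A \<union> B)" by (rule *) (simp add: \<gamma>_def)
    also have "\<dots> \<le> hausdorff_outer m (A \<union> B)"
      using that d(1) by (intro hausdorff_pre_le_outer) (auto simp: \<gamma>_def)
    finally show ?thesis .
  qed
  have "hausdorff_pre m \<delta> A + hausdorff_outer m B \<le> hausdorff_outer m (A \<union> B)" if "0 < \<delta>" for \<delta>
    unfolding hausdorff_outer_pre[of m B]
    by (subst ennreal_SUP_add_right) (use le[OF that] in \<open>auto intro!: SUP_least\<close>)
  then show ?thesis
    unfolding hausdorff_outer_pre[of m A]
    by (subst ennreal_SUP_add_left[symmetric]) (auto intro!: SUP_least)
qed

text \<open>The shells \<open>S i\<close> of points of \<open>A\<close> at distance about \<open>1/i\<close> from \<open>F\<close>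
  have summable measure, because every second one is separated from the previous ones.\<close>

lemma closed_hausdorff_measurable:
  fixes F :: "'a::metric_space set"
  assumes F: "closed F"
  shows "hausdorff_outer m (F \<inter> A) + hausdorff_outer m (A - F) \<le> hausdorff_outer m A"
proof (cases "F = {} \<or> hausdorff_outer m A = top")
  case True
  then show ?thesis by (auto simp: hausdorff_outer_empty)
next
  case False
  let ?f = "hausdorff_outer m"
  have fin: "?f A < top" and ne: "F \<noteq> {}" using False by (auto simp: less_top)
  \<comment> \<open>\<open>D k\<close> stays at positive distance from \<open>F\<close>, so
    additivity for separated sets applies to it; the shells \<open>S i\<close> with
    \<open>i >= k\<close> fill the rest of \<open>A - F\<close>.\<close>
  define D where "D k = {x \<in> A. 1 / (real k + 1) \<le> infdist x F}" for k
  define S where "S k = {x \<in> A. 1 / (real k + 2) \<le> infdist x F \<and> infdist x F < 1 / (real k + 1)}" for k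
  have sep: "min_gap \<le> dist a b"
    if "s + min_gap \<le> infdist a F" "infdist b F \<le> s" for a b s min_gap
    using infdist_triangle[of a F b] that by (simp add: dist_commute)
  have Dle: "?f (F \<inter> A) + ?f (D k) \<le> ?f A" for k
  proof -
    have "?f (F \<inter> A) + ?f (D k) \<le> ?f (F \<inter> A \<union> D k)"
    proof (rule hausdorff_outer_add_separated[where d="1 / (real k + 1)"])
      fix a b assume "a \<in> F \<inter> A" "b \<in> D k"
      then show "1 / (real k + 1) \<le> dist a b"
        using sep[of 0 "1 / (real k + 1)" b a] by (simp add: D_def dist_commute)
    qed simp
    also have "\<dots> \<le> ?f A" by (intro hausdorff_outer_mono) (auto simp: D_def)
    finally show ?thesis .
  qed
  \<comment> \<open>Shells of equal parity \<open>c\<close> are separated by the width of the shell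
    skipped between them.\<close>
  have alt: "(\<Sum>i<N. ?f (S (2 * i + c))) \<le> ?f (A \<inter> (\<Union>i<N. S (2 * i + c)))" for N c
  proof (induction N)
    case (Suc N)
    let ?U = "A \<inter> (\<Union>i<N. S (2 * i + c))"
    have "(\<Sum>i<Suc N. ?f (S (2 * i + c))) \<le> ?f ?U + ?f (S (2 * N + c))"
      using Suc.IH by (simp add: add_right_mono)
    also have "\<dots> \<le> ?f (?U \<union> S (2 * N + c))"
    \<comment> \<open>Here the union is empty; the case is split off because
      \<open>1 / (2 * N + c)\<close> below needs a positive denominator.\<close>
    proof (cases "N = 0")
      case True
      then show ?thesis by (simp add: hausdorff_outer_empty)
    next
      case N: False
      define s where "s = 1 / (real (2 * N + c) + 1)"
      define g where "g = 1 / (real (2 * N + c)) - s"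
      show ?thesis
      proof (rule hausdorff_outer_add_separated[where d=g])
        show "0 < g" using N divide_strict_left_mono[of "real (2 * N + c)" "real (2 * N + c) + 1" 1]
          by (simp add: g_def s_def)
        fix a b assume a: "a \<in> ?U" and b: "b \<in> S (2 * N + c)"
        from a obtain i where i: "i < N" "a \<in> S (2 * i + c)" by blast
        have "1 / real (2 * N + c) \<le> 1 / (real (2 * i + c) + 2)"
          using i by (intro divide_left_mono) auto
        with i(2) have "s + g \<le> infdist a F" by (simp add: S_def g_def)
        moreover have "infdist b F \<le> s" using b by (simp add: S_def s_def)
        ultimately show "g \<le> dist a b" by (rule sep)
      qed
    qed
    also have "\<dots> \<le> ?f (A \<inter> (\<Union>i<Suc N. S (2 * i + c)))"
      by (intro hausdorff_outer_mono) (auto simp: S_def lessThan_Suc)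
    finally show ?case .
  qed (simp add: hausdorff_outer_empty)
  have altA: "(\<Sum>i<N. ?f (S (2 * i + c))) \<le> ?f A" for N c
    by (rule order_trans[OF alt]) (intro hausdorff_outer_mono Int_lower1)
  have dbl: "(\<Sum>i<2 * N. g i) = (\<Sum>i<N. g (2 * i + 0)) + (\<Sum>i<N. g (2 * i + 1))" for N and g :: "nat \<Rightarrow> ennreal"
    by (induction N) (auto simp: algebra_simps)
  have Ssum: "(\<Sum>i. ?f (S i)) \<le> ?f A + ?f A"
  proof (rule suminf_le_const)
    fix N
    have "(\<Sum>i<N. ?f (S i)) \<le> (\<Sum>i<2 * N. ?f (S i))" by (intro sum_mono2) auto
    also have "\<dots> \<le> ?f A + ?f A" unfolding dbl by (intro add_mono altA)
    finally show "(\<Sum>i<N. ?f (S i)) \<le> ?f A + ?f A" .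
  qed simp
  define r where "r i = enn2real (?f (S i))" for i
  have Sfin: "?f (S i) < top" for i
    using hausdorff_outer_mono[of "S i" A m] fin by (auto simp: S_def intro: le_less_trans)
  have r: "?f (S i) = ennreal (r i)" for i using Sfin[of i] by (simp add: r_def)
  have rsum: "summable r"
  proof (rule summable_suminf_not_top)
    show "(\<Sum>i. ennreal (r i)) \<noteq> top"
      using Ssum fin unfolding r by (metis ennreal_add_eq_top less_top top.extremum_unique)
  qed (simp add: r_def)
  have tail: "(\<lambda>k. ennreal (\<Sum>i. r (i + k))) \<longlonglongrightarrow> ennreal 0"
    using suminf_exist_split2[OF rsum] by (intro tendsto_ennrealI)
  \<comment> \<open>Since \<open>F\<close> is closed, points of \<open>A - F\<close> have positive
    distance to it. Those missed by \<open>D k\<close> lie in shells of index at least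
    \<open>k\<close>, whose total is the tail of a convergent series.\<close>
  have le: "?f (F \<inter> A) + ?f (A - F) \<le> ?f A + ennreal (\<Sum>i. r (i + k))" for k
  proof -
    have "A - F \<subseteq> D k \<union> (\<Union>i. S (i + k))"
    proof
      fix x assume x: "x \<in> A - F"
      then have pos: "0 < infdist x F"
        using F ne in_closed_iff_infdist_zero[of F x] infdist_nonneg[of x F] by auto
      show "x \<in> D k \<union> (\<Union>i. S (i + k))"
      proof (cases "1 / (real k + 1) \<le> infdist x F")
        case True
        then show ?thesis using x by (simp add: D_def)
      next
        case less: False
        have "\<exists>j. 1 / (real j + 2) \<le> infdist x F"
        proof -
          obtain j where "inverse (real (Suc j)) < infdist x F" using reals_Archimedean[OF pos] by blast
          moreover have "1 / (real j + 2) \<le> inverse (real (Suc j))" by (simp add: field_simps)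
          ultimately show ?thesis by (intro exI[of _ j]) simp
        qed
        define j where "j = (LEAST j. 1 / (real j + 2) \<le> infdist x F)"
        have j: "1 / (real j + 2) \<le> infdist x F" unfolding j_def by (rule LeastI_ex) fact
        have j2: "infdist x F < 1 / (real j + 1)" if "k \<le> j"
        proof (cases j)
          case 0
          then show ?thesis using less that by simp
        next
          case (Suc j')
          then have "\<not> 1 / (real j' + 2) \<le> infdist x F"
            using not_less_Least[of j' "\<lambda>j. 1 / (real j + 2) \<le> infdist x F"] j_def by simp
          then show ?thesis using Suc by (simp add: add.commute)
        qed
        have "k \<le> j"
        proof (rule ccontr)
          assume "\<not> k \<le> j"
          then have "1 / (real k + 1) \<le> 1 / (real j + 2)" by (intro divide_left_mono) auto
          with j less show False by simp
        qed
        then have "x \<in> S ((j - k) + k)" using j j2 x by (simp add: S_def)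
        then show ?thesis by blast
      qed
    qed
    then have "?f (A - F) \<le> ?f (D k) + ?f (\<Union>i. S (i + k))"
      by (meson hausdorff_outer_mono hausdorff_outer_Un order_trans)
    also have "?f (\<Union>i. S (i + k)) \<le> (\<Sum>i. ?f (S (i + k)))" by (rule hausdorff_outer_subadditive)
    also have "(\<Sum>i. ?f (S (i + k))) = ennreal (\<Sum>i. r (i + k))"
      unfolding r
    proof (rule suminf_ennreal2)
      show "summable (\<lambda>i. r (i + k))" using rsum by (simp add: summable_iff_shift)
    qed (simp add: r_def)
    finally have "?f (A - F) \<le> ?f (D k) + ennreal (\<Sum>i. r (i + k))" by (simp add: add_left_mono)
    then have "?f (F \<inter> A) + ?f (A - F) \<le> (?f (F \<inter> A) + ?f (D k)) + ennreal (\<Sum>i. r (i + k))"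
      by (metis add.assoc add_left_mono)
    also have "\<dots> \<le> ?f A + ennreal (\<Sum>i. r (i + k))" by (intro add_right_mono Dle)
    finally show ?thesis .
  qed
  have "(\<lambda>k. ?f A + ennreal (\<Sum>i. r (i + k))) \<longlonglongrightarrow> ?f A + ennreal 0"
    by (intro tendsto_add tendsto_const tail)
  then show ?thesis using le by (intro LIMSEQ_le_const) auto
qed

text \<open>Without this fact \<open>measure_of\<close> would yield the zero measure. The
  Caratheodory-measurable sets form a sigma-algebra that contains the closed sets, hence all Borel
  sets.\<close>

lemma measure_space_hausdorff: "measure_space UNIV (sets borel) (hausdorff_outer m)"
proof -
  interpret P: sigma_algebra UNIV "UNIV :: 'a set set" by (metis Pow_UNIV sigma_algebra_Pow)
  let ?L = "lambda_system UNIV UNIV (hausdorff_outer m) :: 'a set set"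
  have L: "measure_space UNIV ?L (hausdorff_outer m)"
    by (rule P.caratheodory_lemma) (rule outer_measure_space_hausdorff)
  then interpret L: sigma_algebra UNIV ?L by (simp add: measure_space_def)
  have "Collect closed \<subseteq> ?L"
  proof
    fix F :: "'a set" assume "F \<in> Collect closed"
    then have "hausdorff_outer m (F \<inter> A) + hausdorff_outer m ((UNIV - F) \<inter> A) = hausdorff_outer m A" for A
      using closed_hausdorff_measurable[of F m A] hausdorff_outer_Un[of m "F \<inter> A" "A - F"]
      by (intro antisym) (auto simp: Int_commute Int_Diff Un_commute Diff_Int_distrib2 Compl_eq_Diff_UNIV[symmetric]
          Diff_eq Int_Un_distrib2[symmetric] Un_Int_distrib)
    then show "F \<in> ?L" by (simp add: lambda_system_def)
  qed
  then have "sigma_sets UNIV (Collect closed) \<subseteq> ?L" by (rule L.sigma_sets_subset)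
  then have "sets borel \<subseteq> ?L" by (simp add: borel_eq_closed)
  moreover have "sigma_algebra UNIV (sets borel :: 'a set set)"
    using sets.sigma_algebra_axioms[of borel] by simp
  ultimately show ?thesis using measure_down[OF L] by blast
qed

lemma sets_hausdorff_measure [simp]: "sets (hausdorff_measure m) = sets borel"
  and space_hausdorff_measure [simp]: "space (hausdorff_measure m) = UNIV"
  using sigma_algebra.sets_measure_of_eq[of UNIV "sets borel"] sets.sigma_algebra_axioms[of borel]
  unfolding hausdorff_measure_def by (auto simp: space_measure_of_conv)

lemma emeasure_hausdorff_measure:
  "A \<in> sets borel \<Longrightarrow> emeasure (hausdorff_measure m) A = hausdorff_outer m A"
  unfolding hausdorff_measure_def
  using measure_space_hausdorff[of m] by (intro emeasure_measure_of_sigma) (auto simp: measure_space_def)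

section \<open>Growth of the area of hypersurfaces\<close>

lemma hausdorff_outer_le_finite_covers:
  assumes "\<And>\<delta>. 0 < \<delta> \<Longrightarrow> \<exists>(I :: 'i set) C. finite I \<and> A \<subseteq> (\<Union>i\<in>I. C i) \<and>
      (\<forall>i\<in>I. bounded (C i) \<and> diameter (C i) \<le> \<delta>) \<and> (\<Sum>i\<in>I. hausdorff_weight m (C i)) \<le> K"
  shows "hausdorff_outer m A \<le> ennreal K"
proof -
  have "(INF C\<in>hausdorff_covers \<delta> A. \<Sum>j. ennreal (hausdorff_weight m (C j))) \<le> ennreal K"
    if \<delta>: "0 < \<delta>" for \<delta>
  proof -
    obtain I :: "'i set" and C where I: "finite I" "A \<subseteq> (\<Union>i\<in>I. C i)"
      "\<And>i. i \<in> I \<Longrightarrow> bounded (C i)" "\<And>i. i \<in> I \<Longrightarrow> diameter (C i) \<le> \<delta>"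
      "(\<Sum>i\<in>I. hausdorff_weight m (C i)) \<le> K" using assms[OF \<delta>] by blast
    obtain h where h: "bij_betw h {..<card I} I"
      using ex_bij_betw_nat_finite[OF I(1)] by (auto simp: atLeast0LessThan)
    \<comment> \<open>Padding the finite cover with empty sets is free, also for
      \<open>m = 0\<close>, because the empty set has weight 0 by definition.\<close>
    define D where "D j = (if j < card I then C (h j) else {})" for j
    have hI: "h j \<in> I" if "j < card I" for j using h that by (auto simp: bij_betw_def)
    have "A \<subseteq> (\<Union>j. D j)"
    proof
      fix x assume "x \<in> A"
      then obtain i where "i \<in> I" "x \<in> C i" using I(2) by blast
      moreover obtain j where "j < card I" "h j = i" using h \<open>i \<in> I\<close>
        unfolding bij_betw_def by (metis imageE lessThan_iff)
      ultimately have "x \<in> D j" by (simp add: D_def)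
      then show "x \<in> (\<Union>j. D j)" by blast
    qed
    then have "D \<in> hausdorff_covers \<delta> A"
      using I(3,4) hI \<delta> by (auto simp: hausdorff_covers_def D_def)
    then have "(INF C\<in>hausdorff_covers \<delta> A. \<Sum>j. ennreal (hausdorff_weight m (C j))) \<le>
        (\<Sum>j. ennreal (hausdorff_weight m (D j)))" by (rule INF_lower)
    also have "\<dots> = (\<Sum>j<card I. ennreal (hausdorff_weight m (D j)))"
      by (rule suminf_finite) (auto simp: D_def hausdorff_weight_def)
    also have "\<dots> = (\<Sum>j<card I. ennreal (hausdorff_weight m (C (h j))))" by (simp add: D_def)
    also have "\<dots> = (\<Sum>i\<in>I. ennreal (hausdorff_weight m (C i)))"
      by (rule sum.reindex_bij_betw[OF h])
    also have "\<dots> = ennreal (\<Sum>i\<in>I. hausdorff_weight m (C i))"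
      using I(3) by (intro sum_ennreal) (auto simp: hausdorff_weight_def diameter_ge_0)
    also have "\<dots> \<le> ennreal K" using I(5) by (rule ennreal_leI)
    finally show ?thesis .
  qed
  then show ?thesis unfolding hausdorff_outer_def by (auto intro!: SUP_least)
qed

lemma norm_le_coord_split:
  fixes v :: "real^'n::finite"
  assumes "\<And>i. i \<noteq> k \<Longrightarrow> \<bar>v $ i\<bar> \<le> b" "0 \<le> b"
  shows "norm v \<le> \<bar>v $ k\<bar> + real CARD('n) * b"
proof -
  have "norm v \<le> (\<Sum>i\<in>UNIV. \<bar>v $ i\<bar>)" by (rule norm_le_l1_cart)
  also have "\<dots> = \<bar>v $ k\<bar> + (\<Sum>i\<in>UNIV - {k}. \<bar>v $ i\<bar>)"
    by (simp add: sum.remove[of UNIV k])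
  also have "(\<Sum>i\<in>UNIV - {k}. \<bar>v $ i\<bar>) \<le> (\<Sum>i\<in>UNIV - {k}. b)"
    by (rule sum_mono) (use assms in auto)
  also have "\<dots> \<le> real CARD('n) * b"
    using assms(2) by (auto intro!: mult_right_mono simp: card_Diff_singleton)
  finally show ?thesis by simp
qed

lemma horizontal_nth [simp]: "horizontal k x $ i = (if i = k then 0 else x $ i)"
  by (simp add: horizontal_def)

text \<open>The horizontal coordinates are cut into \<open>N ^ (n - 1)\<close> cubes of side
  \<open>2 * r / N\<close>. Over each cube the Lipschitz graph has diameter at most a constant times
  \<open>r / N\<close>, so the sum of the weights does not depend on \<open>N\<close>.\<close>

lemma hausdorff_outer_graph_le:
  fixes A :: "(real^'n::finite) set"
  assumes graph: "\<And>z. z \<in> A \<Longrightarrow> z $ k = f (horizontal k z)"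
    and lip: "L-lipschitz_on H f" and H: "\<And>z. z \<in> A \<Longrightarrow> horizontal k z \<in> H"
    and ball: "A \<subseteq> ball x r" and r: "0 < r"
  shows "hausdorff_outer (CARD('n) - 1) A \<le>
    ennreal (unit_ball_vol (real (CARD('n) - 1)) * ((1 + L) * real CARD('n)) ^ (CARD('n) - 1) * r ^ (CARD('n) - 1))"
proof (rule hausdorff_outer_le_finite_covers)
  let ?n = "real CARD('n)" and ?m = "CARD('n) - 1"
  have L: "0 \<le> L" using lip by (rule lipschitz_on_nonneg)
  fix \<delta> :: real assume \<delta>: "0 < \<delta>"
  \<comment> \<open>\<open>N\<close> is so large that the diameter bound \<open>D\<close> below is
    at most the prescribed scale.\<close>
  obtain N :: nat where N0: "(1 + L) * ?n * 2 * r / \<delta> < real N" using reals_Archimedean2 by blast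
  moreover have "0 \<le> (1 + L) * ?n * 2 * r / \<delta>" using L r \<delta> by simp
  ultimately have N: "0 < N" by linarith
  define D where "D = (1 + L) * ?n * (2 * r / N)"
  have D: "0 \<le> D" "D \<le> \<delta>" using N0 N \<delta> L r by (auto simp: D_def field_simps)
  define I where "I = PiE (UNIV - {k}) (\<lambda>_::'n. {..<N})"
  define C where "C a = {z \<in> A. \<forall>i. i \<noteq> k \<longrightarrow>
      x $ i - r + 2 * r * real (a i) / N \<le> z $ i \<and> z $ i \<le> x $ i - r + 2 * r * (real (a i) + 1) / N}" for a
  have finI: "finite I" unfolding I_def by (intro finite_PiE) auto
  have cardI: "card I = N ^ ?m" unfolding I_def by (simp add: card_PiE card_Diff_singleton)
  have cover: "A \<subseteq> (\<Union>a\<in>I. C a)"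
  proof
    fix z assume z: "z \<in> A"
    define t where "t i = (z $ i - x $ i + r) * N / (2 * r)" for i
    define a where "a = restrict (\<lambda>i. nat \<lfloor>t i\<rfloor>) (UNIV - {k})"
    have t: "0 \<le> t i" "t i < N" for i
    proof -
      have "\<bar>(z - x) $ i\<bar> \<le> norm (z - x)" by (rule component_le_norm_cart)
      also have "\<dots> < r" using ball z by (auto simp: dist_norm norm_minus_commute)
      finally have "0 < z $ i - x $ i + r" "z $ i - x $ i + r < 2 * r" by auto
      then show "0 \<le> t i" "t i < N"
        using r N mult_strict_right_mono[of "z $ i - x $ i + r" "2 * r" "real N"]
        by (auto simp: t_def pos_divide_less_eq mult.commute)
    qed
    have "a \<in> I" unfolding I_def a_def using t by (auto simp: nat_less_iff floor_less_iff)
    moreover have "z \<in> C a"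
      unfolding C_def
    proof (intro CollectI conjI z allI impI)
      fix i assume "i \<noteq> k"
      then have "real (a i) = of_int \<lfloor>t i\<rfloor>" using t by (simp add: a_def)
      then have "real (a i) \<le> t i" "t i \<le> real (a i) + 1" by linarith+
      moreover have "z $ i = x $ i - r + 2 * r * t i / N" using r N by (simp add: t_def)
      ultimately show "x $ i - r + 2 * r * real (a i) / N \<le> z $ i"
        "z $ i \<le> x $ i - r + 2 * r * (real (a i) + 1) / N"
        using r N by (auto intro!: divide_right_mono mult_left_mono)
    qed
    ultimately show "z \<in> (\<Union>a\<in>I. C a)" by blast
  qed
  have diam: "diameter (C a) \<le> D" for a
  proof (rule diameter_le)
    fix z w assume z: "z \<in> C a" and w: "w \<in> C a"
    have 1: "\<bar>(z - w) $ i\<bar> \<le> 2 * r / N" if "i \<noteq> k" for i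
    proof -
      have "2 * r * (real (a i) + 1) / N = 2 * r * real (a i) / N + 2 * r / N"
        by (simp add: add_divide_distrib distrib_left)
      then show ?thesis using z w that unfolding C_def by (force simp: abs_le_iff)
    qed
    have b: "0 \<le> 2 * r / N" using r by simp
    have zA: "z \<in> A" "w \<in> A" using z w by (auto simp: C_def)
    have "norm (horizontal k z - horizontal k w) \<le> ?n * (2 * r / N)"
      using norm_le_coord_split[of k "horizontal k z - horizontal k w" "2 * r / N"] 1 b by simp
    moreover have "\<bar>(z - w) $ k\<bar> \<le> L * norm (horizontal k z - horizontal k w)"
      using lipschitz_onD[OF lip H[OF zA(1)] H[OF zA(2)]] graph zA by (simp add: dist_norm)
    ultimately have "\<bar>(z - w) $ k\<bar> \<le> L * (?n * (2 * r / N))"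
      using L by (meson mult_left_mono order_trans)
    then show "norm (z - w) \<le> D"
      using norm_le_coord_split[of k "z - w" "2 * r / N", OF 1 b] by (simp add: D_def algebra_simps)
  qed (use D in simp)
  have bdd: "bounded (C a)" for a
    by (rule bounded_subset[OF bounded_ball[of x r]]) (use ball in \<open>auto simp: C_def\<close>)
  have "(\<Sum>a\<in>I. hausdorff_weight ?m (C a)) \<le> (\<Sum>a\<in>I. unit_ball_vol (real ?m) * (D / 2) ^ ?m)"
    by (rule sum_mono) (auto simp: hausdorff_weight_def D diam diameter_ge_0[OF bdd]
        intro!: mult_left_mono power_mono)
  also have "\<dots> = unit_ball_vol (real ?m) * (real N * (D / 2)) ^ ?m"
    by (simp only: sum_constant cardI of_nat_power power_mult_distrib mult_ac)
  also have "real N * (D / 2) = ((1 + L) * ?n) * r" using N by (simp add: D_def)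
  also have "unit_ball_vol (real ?m) * ((1 + L) * ?n * r) ^ ?m =
      unit_ball_vol (real ?m) * ((1 + L) * ?n) ^ ?m * r ^ ?m" by (simp add: power_mult_distrib mult_ac)
  finally show "\<exists>(I :: ('n \<Rightarrow> nat) set) C. finite I \<and> A \<subseteq> (\<Union>i\<in>I. C i) \<and>
      (\<forall>i\<in>I. bounded (C i) \<and> diameter (C i) \<le> \<delta>) \<and> (\<Sum>i\<in>I. hausdorff_weight ?m (C i)) \<le>
      unit_ball_vol (real ?m) * ((1 + L) * ?n) ^ ?m * r ^ ?m"
    using finI cover bdd diam D(2) by (intro exI[of _ I] exI[of _ C]) (auto intro: order_trans)
qed

lemma C1_lipschitz_on_cball:
  fixes f :: "real^'n::finite \<Rightarrow> real"
  assumes f: "Ck_on 1 UNIV f"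
  shows "\<exists>L. L-lipschitz_on (cball p 1) f"
proof -
  have diff: "f differentiable at x" and cont: "continuous_on UNIV (partial i f)" for x i
    using f by auto
  have "\<exists>B\<ge>0. \<forall>x\<in>cball p 1. \<bar>partial i f x\<bar> \<le> B" for i
    using continuous_on_subset[OF cont] by (intro ex_abs_bound_on_compact) auto
  then obtain B where B: "\<And>i. 0 \<le> B i" "\<And>i x. x \<in> cball p 1 \<Longrightarrow> \<bar>partial i f x\<bar> \<le> B i" by metis
  define L where "L = (\<Sum>i\<in>UNIV. B i)"
  have L: "0 \<le> L" unfolding L_def by (intro sum_nonneg B)
  have "norm (f x - f y) \<le> L * norm (x - y)" if "x \<in> cball p 1" "y \<in> cball p 1" for x y
  proof (rule differentiable_bound[of "cball p 1" f "\<lambda>x. frechet_derivative f (at x)"])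
    fix x assume x: "x \<in> cball p 1"
    have d: "(f has_derivative frechet_derivative f (at x)) (at x)"
      using diff frechet_derivative_works by blast
    then show "(f has_derivative frechet_derivative f (at x)) (at x within cball p 1)"
      by (rule has_derivative_at_withinI)
    interpret bl: bounded_linear "frechet_derivative f (at x)" using d by (rule has_derivative_bounded_linear)
    show "onorm (frechet_derivative f (at x)) \<le> L"
    proof (rule onorm_le)
      fix h :: "real^'n"
      have "frechet_derivative f (at x) h = frechet_derivative f (at x) (\<Sum>i\<in>UNIV. h $ i *\<^sub>R axis i 1)"
        using basis_expansion[of h] by (simp add: scalar_mult_eq_scaleR)
      also have "\<dots> = (\<Sum>i\<in>UNIV. h $ i * partial i f x)"
        by (simp add: bl.sum bl.scaleR partial_def)
      finally have "norm (frechet_derivative f (at x) h) \<le> (\<Sum>i\<in>UNIV. \<bar>h $ i * partial i f x\<bar>)" by simp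
      also have "\<dots> \<le> (\<Sum>i\<in>UNIV. B i * norm h)"
        using B x component_le_norm_cart[of h]
        by (intro sum_mono) (auto simp: abs_mult mult.commute[of "B _"] intro!: mult_mono)
      finally show "norm (frechet_derivative f (at x) h) \<le> L * norm h"
        by (simp add: L_def sum_distrib_right)
    qed
  qed (use that in auto)
  then have "L-lipschitz_on (cball p 1) f" using L by (intro lipschitz_onI) (auto simp: dist_norm)
  then show ?thesis by blast
qed

lemma norm_horizontal_diff_le: "norm (horizontal k x - horizontal k y) \<le> norm (x - y)"
  by (rule norm_le_componentwise_cart) auto

text \<open>Compactness leaves finitely many graph patches, each obeying the bound; their constants
  add up.\<close>

lemma hypersurface_growth:
  fixes \<Gamma> :: "(real^'n::finite) set"
  assumes "closed_C1_hypersurface \<Gamma>"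
  shows "\<exists>K\<ge>0. \<forall>x r. 0 < r \<longrightarrow>
    hausdorff_outer (CARD('n) - 1) (\<Gamma> \<inter> ball x r) \<le> ennreal (K * r ^ (CARD('n) - 1))"
proof -
  let ?m = "CARD('n) - 1"
  \<comment> \<open>The growth bound localised to a patch, in a form that is stable under finite
    unions of patches.\<close>
  define good where "good V K \<longleftrightarrow> 0 \<le> K \<and>
    (\<forall>x r. 0 < r \<longrightarrow> hausdorff_outer ?m (\<Gamma> \<inter> V \<inter> ball x r) \<le> ennreal (K * r ^ ?m))" for V K
  have "\<exists>V K. open V \<and> p \<in> V \<and> good V K" if p: "p \<in> \<Gamma>" for p
  proof -
    obtain U k f where U: "open U" "p \<in> U" "Ck_on 1 UNIV f" "\<Gamma> \<inter> U = {x \<in> U. x $ k = f (horizontal k x)}"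
      using assms p unfolding closed_C1_hypersurface_def C1_hypersurface_def by blast
    obtain L where L: "L-lipschitz_on (cball (horizontal k p) 1) f" using C1_lipschitz_on_cball[OF U(3)] by blast
    define V where "V = U \<inter> ball p 1"
    define K where "K = unit_ball_vol (real ?m) * ((1 + L) * real CARD('n)) ^ ?m"
    have "hausdorff_outer ?m (\<Gamma> \<inter> V \<inter> ball x r) \<le> ennreal (K * r ^ ?m)" if "0 < r" for x r
      unfolding K_def
    proof (rule hausdorff_outer_graph_le[OF _ L])
      show "z $ k = f (horizontal k z)" if "z \<in> \<Gamma> \<inter> V \<inter> ball x r" for z
        using that U(4) by (auto simp: V_def)
      show "horizontal k z \<in> cball (horizontal k p) 1" if "z \<in> \<Gamma> \<inter> V \<inter> ball x r" for z
        using that norm_horizontal_diff_le[of k p z] by (auto simp: V_def dist_norm)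
    qed (use that in auto)
    moreover have "0 \<le> K" using lipschitz_on_nonneg[OF L] by (simp add: K_def)
    ultimately show ?thesis using U by (intro exI[of _ V] exI[of _ K]) (auto simp: V_def good_def)
  qed
  then obtain V K where VK: "\<And>p. p \<in> \<Gamma> \<Longrightarrow> open (V p) \<and> p \<in> V p \<and> good (V p) (K p)" by metis
  have "compact \<Gamma>" using assms by (simp add: closed_C1_hypersurface_def)
  then obtain T where T: "T \<subseteq> \<Gamma>" "finite T" "\<Gamma> \<subseteq> (\<Union>p\<in>T. V p)"
    by (rule compactE_image[of \<Gamma> \<Gamma> V]) (use VK in auto)
  have "good (\<Union>p\<in>T. V p) (\<Sum>p\<in>T. K p)"
    using T(2,1)
  proof (induction T)
    case empty
    then show ?case by (simp add: good_def hausdorff_outer_empty)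
  next
    case (insert p T)
    then have g: "good (V p) (K p)" "good (\<Union>p\<in>T. V p) (\<Sum>p\<in>T. K p)" using VK by auto
    show ?case
      unfolding good_def
    proof (intro conjI allI impI)
      show "0 \<le> (\<Sum>p\<in>insert p T. K p)" using g insert.hyps by (simp add: good_def)
      fix x r assume r: "0 < (r::real)"
      have "\<Gamma> \<inter> (\<Union>p\<in>insert p T. V p) \<inter> ball x r =
          (\<Gamma> \<inter> V p \<inter> ball x r) \<union> (\<Gamma> \<inter> (\<Union>p\<in>T. V p) \<inter> ball x r)" by auto
      then have "hausdorff_outer ?m (\<Gamma> \<inter> (\<Union>p\<in>insert p T. V p) \<inter> ball x r) \<le>
          hausdorff_outer ?m (\<Gamma> \<inter> V p \<inter> ball x r) + hausdorff_outer ?m (\<Gamma> \<inter> (\<Union>p\<in>T. V p) \<inter> ball x r)"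
        using hausdorff_outer_Un by simp
      also have "\<dots> \<le> ennreal (K p * r ^ ?m) + ennreal ((\<Sum>p\<in>T. K p) * r ^ ?m)"
        using g r by (intro add_mono) (auto simp: good_def)
      also have "\<dots> = ennreal ((\<Sum>p\<in>insert p T. K p) * r ^ ?m)"
        using g r insert.hyps by (subst ennreal_plus[symmetric]) (auto simp: good_def distrib_right)
      finally show "hausdorff_outer ?m (\<Gamma> \<inter> (\<Union>p\<in>insert p T. V p) \<inter> ball x r) \<le>
          ennreal ((\<Sum>p\<in>insert p T. K p) * r ^ ?m)" .
    qed
  qed
  moreover have "\<Gamma> \<inter> (\<Union>p\<in>T. V p) = \<Gamma>" using T(3) by blast
  ultimately show ?thesis by (intro exI[of _ "\<Sum>p\<in>T. K p"]) (auto simp: good_def)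
qed

text \<open>Each covering set is thickened in the direction \<open>k\<close> to a box of height one,
  so that Lebesgue measure on the whole space bounds the sum of the weights.\<close>

lemma hausdorff_outer_ge_box:
  fixes A :: "(real^'n::finite) set"
  assumes ab: "\<And>i. a $ i \<le> b $ i" "b $ k - a $ k = 1"
    and proj: "\<And>y. y \<in> cbox a b \<Longrightarrow> \<exists>z\<in>A. horizontal k z = horizontal k y"
  shows "ennreal (unit_ball_vol (real (CARD('n) - 1)) / 4 ^ (CARD('n) - 1) * (\<Prod>i\<in>UNIV. b $ i - a $ i))
    \<le> hausdorff_outer (CARD('n) - 1) A"
proof -
  let ?m = "CARD('n) - 1"
  \<comment> \<open>A set of diameter \<open>d\<close> gets a box with \<open>n - 1\<close> sides
    \<open>2 * d\<close>; the factor \<open>4 ^ (n - 1)\<close> turns its volume into the weight,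
    which uses \<open>d / 2\<close>.\<close>
  let ?u = "unit_ball_vol (real ?m) / 4 ^ ?m"
  have u: "0 < ?u" by simp
  have box: "emeasure lborel (cbox c d) = ennreal (\<Prod>i\<in>UNIV. d $ i - c $ i)" if "\<And>i. c $ i \<le> d $ i" for c d :: "real^'n"
  proof -
    have "c \<in> cbox c d" using that by (simp add: mem_box_cart)
    then have "measure lborel (cbox c d) = (\<Prod>i\<in>UNIV. d $ i - c $ i)"
      by (intro content_cbox_cart) auto
    then show ?thesis using emeasure_eq_ennreal_measure[of lborel "cbox c d"] emeasure_lborel_cbox_finite[of c d] by simp
  qed
  have "ennreal (?u * (\<Prod>i\<in>UNIV. b $ i - a $ i)) \<le> (\<Sum>j. ennreal (hausdorff_weight ?m (C j)))"
    if C: "C \<in> hausdorff_covers 1 A" for C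
  proof -
    define z where "z j = (SOME z. z \<in> C j)" for j
    define lo where "lo j = (\<chi> i. if i = k then a $ k else z j $ i - diameter (C j))" for j
    define hi where "hi j = (\<chi> i. if i = k then b $ k else z j $ i + diameter (C j))" for j
    define D where "D j = (if C j = {} then {} else cbox (lo j) (hi j))" for j
    have bd: "bounded (C j)" for j using C by (auto simp: hausdorff_covers_def)
    note d0 = diameter_ge_0[OF bd]
    have lohi: "lo j $ i \<le> hi j $ i" for i j using d0[of j] ab(2) by (simp add: lo_def hi_def)
    have eD: "ennreal ?u * emeasure lborel (D j) = ennreal (hausdorff_weight ?m (C j))" for j
    proof (cases "C j = {}")
      case True
      then show ?thesis by (simp add: D_def hausdorff_weight_def)
    next
      case False
      have "(\<Prod>i\<in>UNIV. hi j $ i - lo j $ i) = (b $ k - a $ k) * (\<Prod>i\<in>UNIV - {k}. 2 * diameter (C j))"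
        by (subst prod.remove[of UNIV k]) (auto simp: lo_def hi_def intro!: prod.cong)
      also have "\<dots> = (2 * diameter (C j)) ^ ?m" using ab(2) by (simp add: card_Diff_singleton)
      finally have "emeasure lborel (D j) = ennreal ((2 * diameter (C j)) ^ ?m)"
        using False lohi box by (simp add: D_def)
      then have "ennreal ?u * emeasure lborel (D j) = ennreal (?u * (2 * diameter (C j)) ^ ?m)"
        using u d0[of j] ennreal_mult[of ?u "(2 * diameter (C j)) ^ ?m"] by simp
      also have "?u * (2 * diameter (C j)) ^ ?m = unit_ball_vol (real ?m) * (2 * diameter (C j) / 4) ^ ?m"
        unfolding power_divide by (simp only: times_divide_eq_left times_divide_eq_right)
      also have "\<dots> = hausdorff_weight ?m (C j)" using False by (simp add: hausdorff_weight_def)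
      finally show ?thesis .
    qed
    have "cbox a b \<subseteq> (\<Union>j. D j)"
    proof
      fix y assume y: "y \<in> cbox a b"
      obtain w where w: "w \<in> A" "horizontal k w = horizontal k y" using proj[OF y] by blast
      then obtain j where j: "w \<in> C j" using C by (auto simp: hausdorff_covers_def)
      then have zj: "z j \<in> C j" unfolding z_def by (rule someI)
      have "y \<in> cbox (lo j) (hi j)"
        unfolding mem_box_cart
      proof
        fix i
        show "lo j $ i \<le> y $ i \<and> y $ i \<le> hi j $ i"
        proof (cases "i = k")
          case True
          then show ?thesis using y by (simp add: lo_def hi_def mem_box_cart)
        next
          case False
          have "y $ i = w $ i" using arg_cong[OF w(2), of "\<lambda>v. v $ i"] False by simp
          moreover have "\<bar>(w - z j) $ i\<bar> \<le> norm (w - z j)" by (rule component_le_norm_cart)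
          moreover have "norm (w - z j) \<le> diameter (C j)"
            using diameter_bounded_bound[OF bd j zj] by (simp add: dist_norm)
          ultimately show ?thesis using False by (auto simp: lo_def hi_def abs_le_iff)
        qed
      qed
      then show "y \<in> (\<Union>j. D j)" using j by (auto simp: D_def)
    qed
    then have "emeasure lborel (cbox a b) \<le> (\<Sum>j. emeasure lborel (D j))"
      by (intro order_trans[OF emeasure_mono emeasure_subadditive_countably]) (auto simp: D_def)
    then have le: "ennreal ?u * emeasure lborel (cbox a b) \<le> ennreal ?u * (\<Sum>j. emeasure lborel (D j))"
      by (rule mult_left_mono) simp
    have "ennreal (?u * (\<Prod>i\<in>UNIV. b $ i - a $ i)) = ennreal ?u * emeasure lborel (cbox a b)"
      unfolding box[OF ab(1)] by (rule ennreal_mult) (use u ab in \<open>auto intro!: prod_nonneg\<close>)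
    also note le
    also have "ennreal ?u * (\<Sum>j. emeasure lborel (D j)) = (\<Sum>j. ennreal ?u * emeasure lborel (D j))"
      by (rule ennreal_suminf_cmult[symmetric])
    also have "\<dots> = (\<Sum>j. ennreal (hausdorff_weight ?m (C j)))" by (simp only: eD)
    finally show ?thesis .
  qed
  then have "ennreal (?u * (\<Prod>i\<in>UNIV. b $ i - a $ i)) \<le>
      (INF C\<in>hausdorff_covers 1 A. \<Sum>j. ennreal (hausdorff_weight ?m (C j)))" by (rule INF_greatest)
  \<comment> \<open>One scale suffices for a lower bound, because the outer measure is a supremum
    over scales.\<close>
  also have "\<dots> \<le> hausdorff_outer ?m A" unfolding hausdorff_outer_def by (rule SUP_upper) simp
  finally show ?thesis .
qed

section \<open>Existence of the Green potential\<close>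

lemma ex_dyadic_shell:
  fixes d e :: real
  assumes "0 < d" "d < e"
  shows "\<exists>j. e * (1/2) ^ Suc j \<le> d \<and> d < e * (1/2) ^ j"
proof -
  have ex: "\<exists>j. e * (1/2) ^ Suc j \<le> d"
  proof -
    obtain j where "(1/2) ^ j < d / e" using real_arch_pow_inv[of "d / e" "1/2"] assms by auto
    moreover have "(1/2) ^ Suc j \<le> (1/2 :: real) ^ j" by simp
    ultimately have "(1/2) ^ Suc j \<le> d / e" by linarith
    then show ?thesis using assms by (auto simp: field_simps)
  qed
  define j where "j = (LEAST j. e * (1/2) ^ Suc j \<le> d)"
  have "e * (1/2) ^ Suc j \<le> d" unfolding j_def by (rule LeastI_ex[OF ex])
  moreover have "d < e * (1/2) ^ j"
  proof (cases j)
    case 0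
    then show ?thesis using assms by simp
  next
    case (Suc i)
    then have "\<not> e * (1/2) ^ Suc i \<le> d"
      using not_less_Least[of i "\<lambda>j. e * (1/2) ^ Suc j \<le> d"] j_def by simp
    then show ?thesis using Suc by simp
  qed
  ultimately show ?thesis by blast
qed

text \<open>On the dyadic shell of radius \<open>s\<close> the integrand is of order
  \<open>s powr (- (n - 3/2))\<close> and the measure at most \<open>K * s ^ (n - 1)\<close>. The
  product \<open>s powr (1/2)\<close> sums geometrically with ratio \<open>sqrt (1/2)\<close>. The
  exponent is twice the one in \<open>smoothed_profile_bounds\<close>, as the profile is evaluated
  at \<open>|x - y|^2\<close>.\<close>

lemma nn_integral_riesz_le:
  fixes M :: "'a::euclidean_space measure"
  assumes sets: "sets M = sets borel"
    and growth: "\<And>x r. 0 < r \<Longrightarrow> emeasure M (ball x r) \<le> ennreal (K * r ^ (n - 1))"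
    and K: "0 \<le> K" and n: "2 \<le> n"
  obtains C where "0 \<le> C" "\<And>x e. 0 < e \<Longrightarrow>
    (\<integral>\<^sup>+y. ennreal (norm (x - y) powr (- (real n - 3/2))) * indicator (ball x e - {x}) y \<partial>M) \<le> ennreal (C * sqrt e)"
proof -
  define a where "a = real n - 3/2"
  have a: "0 < a" using n by (simp add: a_def)
  define q where "q = sqrt (1/2)"
  have q: "0 < q" "q < 1" by (auto simp: q_def)
  define C where "C = K * 2 powr a / (1 - q)"
  have "(\<integral>\<^sup>+y. ennreal (norm (x - y) powr (- a)) * indicator (ball x e - {x}) y \<partial>M) \<le> ennreal (C * sqrt e)"
    if e: "0 < e" for x e
  proof -
    define s where "s j = e * (1/2) ^ j" for j :: nat
    have s: "0 < s j" for j using e by (simp add: s_def)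
    define S where "S j = {y. s (Suc j) \<le> norm (x - y) \<and> norm (x - y) < s j}" for j
    have Sm: "S j \<in> sets M" for j unfolding sets S_def by measurable
    have eS: "emeasure M (S j) \<le> ennreal (K * s j ^ (n - 1))" for j
    proof -
      have "emeasure M (S j) \<le> emeasure M (ball x (s j))"
        by (intro emeasure_mono) (auto simp: S_def dist_norm sets)
      then show ?thesis using growth[OF s] by (rule order_trans)
    qed
    have shell: "ennreal (s (Suc j) powr (- a)) * emeasure M (S j) \<le> ennreal (K * 2 powr a * sqrt e * q ^ j)" for j
    proof -
      have sS: "s (Suc j) = s j / 2" by (simp add: s_def)
      have "ennreal (s (Suc j) powr (- a)) * emeasure M (S j) \<le>
          ennreal (s (Suc j) powr (- a)) * ennreal (K * s j ^ (n - 1))"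
        by (intro mult_left_mono eS) simp
      also have "\<dots> = ennreal (s (Suc j) powr (- a) * (K * s j ^ (n - 1)))"
        using K s[of j] by (intro ennreal_mult[symmetric]) auto
      also have "s (Suc j) powr (- a) * (K * s j ^ (n - 1)) = K * 2 powr a * (s j powr (- a) * s j powr (real n - 1))"
      proof -
        have "s j ^ (n - 1) = s j powr (real n - 1)"
          using s[of j] n by (simp add: powr_realpow[symmetric] of_nat_diff)
        moreover have "s (Suc j) powr (- a) = 2 powr a * s j powr (- a)"
          unfolding sS using s[of j] by (simp add: powr_divide powr_minus field_simps)
        ultimately show ?thesis by simp
      qed
      also have "s j powr (- a) * s j powr (real n - 1) = s j powr (1/2)"
        by (simp add: powr_add[symmetric] a_def)
      also have "\<dots> = sqrt e * q ^ j"
        using s[of j] by (simp add: powr_half_sqrt s_def real_sqrt_mult real_sqrt_power q_def)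
      finally show ?thesis by (simp add: mult.assoc)
    qed
    have "(\<integral>\<^sup>+y. ennreal (norm (x - y) powr (- a)) * indicator (ball x e - {x}) y \<partial>M) \<le>
        (\<integral>\<^sup>+y. (\<Sum>j. ennreal (s (Suc j) powr (- a)) * indicator (S j) y) \<partial>M)"
    proof (rule nn_integral_mono)
      fix y
      show "ennreal (norm (x - y) powr (- a)) * indicator (ball x e - {x}) y \<le>
          (\<Sum>j. ennreal (s (Suc j) powr (- a)) * indicator (S j) y)"
      proof (cases "y \<in> ball x e - {x}")
        case True
        then have "0 < norm (x - y)" "norm (x - y) < e" by (auto simp: dist_norm)
        from ex_dyadic_shell[OF this] obtain j where j: "y \<in> S j" by (auto simp: S_def s_def)
        have "norm (x - y) powr (- a) \<le> s (Suc j) powr (- a)"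
          using j a s[of "Suc j"] by (intro powr_mono2') (auto simp: S_def)
        then have "ennreal (norm (x - y) powr (- a)) * indicator (ball x e - {x}) y \<le>
            (\<Sum>j\<in>{j}. ennreal (s (Suc j) powr (- a)) * indicator (S j) y)"
          using True j by (simp add: ennreal_leI)
        also have "\<dots> \<le> (\<Sum>j. ennreal (s (Suc j) powr (- a)) * indicator (S j) y)"
          by (rule sum_le_suminf) auto
        finally show ?thesis .
      qed simp
    qed
    also have "\<dots> = (\<Sum>j. \<integral>\<^sup>+y. ennreal (s (Suc j) powr (- a)) * indicator (S j) y \<partial>M)"
      by (rule nn_integral_suminf) (use Sm in measurable)
    also have "\<dots> = (\<Sum>j. ennreal (s (Suc j) powr (- a)) * emeasure M (S j))"
      using Sm by (simp add: nn_integral_cmult_indicator)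
    also have "\<dots> \<le> (\<Sum>j. ennreal (K * 2 powr a * sqrt e * q ^ j))"
      by (intro suminf_le shell) auto
    also have "\<dots> = ennreal (K * 2 powr a * sqrt e * (1 / (1 - q)))"
      using K e q by (intro suminf_ennreal_eq sums_mult geometric_sums) auto
    finally show ?thesis by (simp add: C_def mult_ac)
  qed
  moreover have "0 \<le> C" using K q by (simp add: C_def)
  ultimately show ?thesis using that[of C] by (simp add: a_def)
qed

text \<open>By Cauchy-Schwarz the quantity is at least \<open>(1 - |x| |y|)^2\<close>. Hence a
  profile smoothed at scale \<open>\<delta>\<close> is never evaluated in its smoothed
  range.\<close>

lemma reflected_sq_ge:
  assumes "norm x \<le> 1" "norm y \<le> 1 - \<delta>" "0 < \<delta>"
  shows "\<delta>\<^sup>2 \<le> reflected_sq y x"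
proof -
  have "x \<bullet> y \<le> norm x * norm y" by (rule norm_cauchy_schwarz)
  then have "(1 - norm x * norm y)\<^sup>2 \<le> reflected_sq y x"
    by (simp add: reflected_sq_def power2_eq_square algebra_simps)
  moreover have "\<delta> \<le> 1 - norm x * norm y"
    using assms mult_mono[of "norm x" 1 "norm y" "1 - \<delta>"] by simp
  then have "\<delta>\<^sup>2 \<le> (1 - norm x * norm y)\<^sup>2" using assms(3) by (intro power_mono) auto
  ultimately show ?thesis by simp
qed

lemma integrable_mult_laplacian:
  fixes v :: "real^'n::finite \<Rightarrow> real"
  assumes \<phi>: "\<phi> \<in> test_functions (ball 0 1)" and v: "continuous_on (cball 0 1) v"
  shows "integrable lborel (\<lambda>x. v x * laplacian \<phi> x)"
proof -
  note p = test_functionsD[OF \<phi>]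
  have "integrable lborel (\<lambda>x. indicator (cball 0 1) x *\<^sub>R (v x * laplacian \<phi> x))"
    by (intro borel_integrable_compact continuous_on_mult v continuous_on_subset[OF p(7)]) auto
  moreover have "(\<lambda>x. indicator (cball 0 1) x *\<^sub>R (v x * laplacian \<phi> x)) = (\<lambda>x. v x * laplacian \<phi> x)"
    using p(5) by (force simp: indicator_def fun_eq_iff)
  ultimately show ?thesis by (simp only:)
qed

text \<open>The potential theory sees the surface only through the growth of its measure and its
  distance \<open>\<delta>\<close> from the unit sphere.\<close>

locale surface_measure = finite_measure M for M :: "(real^'n::finite) measure" +
  fixes \<Gamma> :: "(real^'n) set" and K \<delta> :: real
  assumes sets_M: "sets M = sets borel"
    and growth: "\<And>x r. 0 < r \<Longrightarrow> emeasure M (ball x r) \<le> ennreal (K * r ^ (CARD('n) - 1))"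
    and K: "0 \<le> K" and n2: "2 \<le> CARD('n)"
    and \<Gamma>: "compact \<Gamma>" "\<And>y. y \<in> \<Gamma> \<Longrightarrow> norm y \<le> 1 - \<delta>"
    and \<delta>: "0 < \<delta>" "\<delta> \<le> 1"
begin


text \<open>Green's function of the unit ball with the pole regularised at scale \<open>e\<close>.
  The image term is smoothed at the fixed scale \<open>\<delta>\<close>, which makes it smooth on
  the whole space and changes nothing for \<open>x\<close> in the closed ball and \<open>y\<close>
  on the surface.\<close>

definition kernel :: "real \<Rightarrow> real^'n \<Rightarrow> real^'n \<Rightarrow> real" where
  "kernel e x y = smoothed_newton e (x - y) - smoothed_profile (real CARD('n)) \<delta> (reflected_sq y x)"

definition pot :: "real \<Rightarrow> real^'n \<Rightarrow> real" where
  "pot e x = (LINT y|M. indicator \<Gamma> y * kernel e x y)"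

lemma space_M: "space M = UNIV"
  using sets_eq_imp_space_eq[OF sets_M] by simp

lemma \<Gamma>_sets: "\<Gamma> \<in> sets M"
  using \<Gamma>(1) by (simp add: sets_M compact_imp_closed)

lemma continuous_kernel:
  assumes "0 < e" "continuous_on S f" "continuous_on S g"
  shows "continuous_on S (\<lambda>p. kernel e (f p) (g p))"
proof -
  have c: "continuous_on UNIV (smoothed_profile (real CARD('n)) e)"
    "continuous_on UNIV (smoothed_profile (real CARD('n)) \<delta>)"
    using Ck_real_smoothed_profile[of _ 0 "real CARD('n)"] assms(1) \<delta> by auto
  have 1: "continuous_on S (\<lambda>p. (norm (f p - g p))\<^sup>2)"
    by (intro continuous_intros assms)
  have 2: "continuous_on S (\<lambda>p. (norm (f p))\<^sup>2 * (norm (g p))\<^sup>2 - 2 * (f p \<bullet> g p) + 1)"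
    by (intro continuous_intros assms)
  show ?thesis unfolding kernel_def smoothed_newton_def reflected_sq_def
    by (rule continuous_on_diff[OF continuous_on_compose2[OF c(1) 1 subset_UNIV]
          continuous_on_compose2[OF c(2) 2 subset_UNIV]])
qed

lemma kernel_bounded:
  assumes "0 < e"
  shows "\<exists>B. \<forall>x y. norm x \<le> 1 \<longrightarrow> \<bar>indicator \<Gamma> y * kernel e x y\<bar> \<le> B"
proof -
  obtain B where B: "0 \<le> B" "\<forall>p\<in>cball 0 1 \<times> \<Gamma>. \<bar>kernel e (fst p) (snd p)\<bar> \<le> B"
    using ex_abs_bound_on_compact[OF compact_Times[OF compact_cball \<Gamma>(1)]
        continuous_kernel[OF assms continuous_on_fst[OF continuous_on_id] continuous_on_snd[OF continuous_on_id]]]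
    by blast
  have "\<bar>indicator \<Gamma> y * kernel e x y\<bar> \<le> B" if "norm x \<le> 1" for x y
    using bspec[OF B(2), of "(x, y)"] B(1) that by (cases "y \<in> \<Gamma>") auto
  then show ?thesis by blast
qed

lemma kernel_measurable: "0 < e \<Longrightarrow> (\<lambda>y. indicator \<Gamma> y * kernel e x y) \<in> borel_measurable M"
proof -
  assume e: "0 < e"
  have "(\<lambda>y. kernel e x y) \<in> borel_measurable borel"
    by (intro borel_measurable_continuous_onI continuous_kernel e continuous_intros)
  then have "(\<lambda>y. kernel e x y) \<in> borel_measurable M" by (simp add: measurable_cong_sets[OF sets_M])
  then show ?thesis using \<Gamma>_sets by measurable
qed

lemma kernel_integrable:
  assumes "0 < e" "norm x \<le> 1" shows "integrable M (\<lambda>y. indicator \<Gamma> y * kernel e x y)"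
proof -
  obtain B where "\<forall>x y. norm x \<le> 1 \<longrightarrow> \<bar>indicator \<Gamma> y * kernel e x y\<bar> \<le> B"
    using kernel_bounded[OF assms(1)] ..
  then show ?thesis
    by (intro integrable_const_bound[where B=B] kernel_measurable assms) (use assms in auto)
qed

lemma continuous_pot:
  assumes e: "0 < e" shows "continuous_on (cball 0 1) (pot e)"
  unfolding continuous_on_sequentially
proof (intro allI ballI impI, elim conjE)
  fix X a assume a: "a \<in> cball (0 :: real^'n) 1" and X: "\<forall>n. X n \<in> cball 0 1" "X \<longlonglongrightarrow> a"
  obtain B where B: "\<forall>x y. norm x \<le> 1 \<longrightarrow> \<bar>indicator \<Gamma> y * kernel e x y\<bar> \<le> B"
    using kernel_bounded[OF e] ..
  have "(\<lambda>n. LINT y|M. indicator \<Gamma> y * kernel e (X n) y) \<longlonglongrightarrow> (LINT y|M. indicator \<Gamma> y * kernel e a y)"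
  proof (rule integral_dominated_convergence[where w="\<lambda>_. B"])
    show "AE y in M. (\<lambda>n. indicator \<Gamma> y * kernel e (X n) y) \<longlonglongrightarrow> indicator \<Gamma> y * kernel e a y"
    proof (rule AE_I2)
      fix y
      have "isCont (\<lambda>x. kernel e x y) a"
        using continuous_kernel[OF e, of UNIV "\<lambda>x. x" "\<lambda>_. y"] by (simp add: continuous_on_eq_continuous_at)
      then have "(\<lambda>n. kernel e (X n) y) \<longlonglongrightarrow> kernel e a y"
        using X(2) by (rule isCont_tendsto_compose)
      then show "(\<lambda>n. indicator \<Gamma> y * kernel e (X n) y) \<longlonglongrightarrow> indicator \<Gamma> y * kernel e a y"
        by (intro tendsto_mult tendsto_const)
    qed
    show "AE y in M. norm (indicator \<Gamma> y * kernel e (X n) y) \<le> B" for n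
      using B X(1) by (intro AE_I2) auto
  qed (use kernel_measurable[OF e] in auto)
  then show "(pot e \<circ> X) \<longlonglongrightarrow> pot e a" by (simp add: pot_def o_def)
qed

text \<open>On the unit sphere \<open>reflected_sq y x = |x - y|^2\<close>, which is at least
  \<open>\<delta>^2\<close> and \<open>e^2\<close>. Both terms of the kernel are then the same
  unsmoothed value, so the boundary condition holds exactly at every scale.\<close>

lemma pot_boundary:
  assumes "0 < e" "e \<le> \<delta>" "norm x = 1"
  shows "pot e x = 0"
proof -
  have z: "indicator \<Gamma> y * kernel e x y = 0" for y
  proof (cases "y \<in> \<Gamma>")
    case True
    have "reflected_sq y x = (norm (x - y))\<^sup>2"
      using assms(3) by (simp add: reflected_sq_def power2_norm_eq_inner inner_diff_left inner_diff_right
          inner_commute[of y x] norm_eq_1)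
    moreover have "\<delta> \<le> norm (x - y)"
      using \<Gamma>(2)[OF True] assms(3) norm_triangle_ineq2[of x y] by simp
    then have "\<delta>\<^sup>2 \<le> (norm (x - y))\<^sup>2" using \<delta> by (intro power_mono) auto
    moreover have "e\<^sup>2 \<le> \<delta>\<^sup>2" using assms by (intro power_mono) auto
    ultimately show ?thesis using assms \<delta> by (simp add: kernel_def smoothed_newton_def smoothed_profile_eq)
  qed simp
  show ?thesis unfolding pot_def z by simp
qed

lemma AE_neq: "AE y in M. y \<noteq> x"
proof -
  have "emeasure M {x} \<le> ennreal t" if t: "0 < t" for t
  proof -
    \<comment> \<open>As \<open>r <= 1\<close> and \<open>n - 1 >= 1\<close>, the growth bound is at
      most \<open>K * r\<close>, hence at most \<open>t\<close>.\<close>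
    define r where "r = min 1 (t / (K + 1))"
    have r: "0 < r" "r \<le> 1" using t K by (auto simp: r_def)
    have "r ^ (CARD('n) - 1) \<le> r ^ 1" using n2 r by (intro power_decreasing) auto
    then have "K * r ^ (CARD('n) - 1) \<le> K * (t / (K + 1))"
      using K by (intro mult_left_mono) (auto simp: r_def)
    also have "\<dots> \<le> t" using K t by (simp add: field_simps)
    finally have "ennreal (K * r ^ (CARD('n) - 1)) \<le> ennreal t" by (rule ennreal_leI)
    moreover have "emeasure M {x} \<le> emeasure M (ball x r)"
      using r by (intro emeasure_mono) (auto simp: sets_M)
    ultimately show ?thesis using growth[OF r(1), of x] by (blast intro: order_trans)
  qed
  then have "emeasure M {x} \<le> 0 + ennreal t" if "0 < t" for t using that by simp
  then have "emeasure M {x} \<le> 0"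
    by (rule ennreal_le_epsilon)
  then have "{x} \<in> null_sets M" by (auto simp: null_sets_def sets_M)
  from AE_not_in[OF this] show ?thesis by simp
qed

text \<open>The image terms cancel, and the two profiles differ only where
  \<open>|x - y| < e\<close>, by at most the singular kernel integrated in
  \<open>nn_integral_riesz_le\<close>.\<close>

lemma pot_Cauchy:
  obtains C where "0 \<le> C" "\<And>e e' x. 0 < e' \<Longrightarrow> e' \<le> e \<Longrightarrow> e \<le> 1 \<Longrightarrow> norm x \<le> 1 \<Longrightarrow>
    \<bar>pot e x - pot e' x\<bar> \<le> C * sqrt e"
proof -
  obtain C where C: "0 \<le> C" "\<And>x e. 0 < e \<Longrightarrow>
    (\<integral>\<^sup>+y. ennreal (norm (x - y) powr (- (real CARD('n) - 3/2))) * indicator (ball x e - {x}) y \<partial>M) \<le> ennreal (C * sqrt e)"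
    using nn_integral_riesz_le[OF sets_M growth K n2] by blast
  have "\<bar>pot e x - pot e' x\<bar> \<le> 4 * C * sqrt e"
    if e: "0 < e'" "e' \<le> e" "e \<le> 1" and x: "norm x \<le> 1" for e e' x
  proof -
    let ?g = "\<lambda>y. indicator \<Gamma> y * kernel e x y - indicator \<Gamma> y * kernel e' x y"
    have e0: "0 < e" "e' \<le> 1" using e by auto
    \<comment> \<open>The point \<open>y = x\<close> is excluded because the right-hand side is 0
      there; it is a null set by \<open>AE_neq\<close>.\<close>
    have le: "\<bar>?g y\<bar> \<le> 4 * (norm (x - y) powr (- (real CARD('n) - 3/2)) * indicator (ball x e - {x}) y)" if "y \<noteq> x" for y
    proof (cases "norm (x - y) < e")
      case True
      define t where "t = (norm (x - y))\<^sup>2"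
      have t: "0 < t" "t < e\<^sup>2" using True that by (auto simp: t_def intro!: power_strict_mono)
      have n: "2 \<le> real CARD('n)" using n2 by simp
      have 1: "newton_profile (real CARD('n)) t \<le> smoothed_profile (real CARD('n)) e' t"
        using smoothed_profile_bounds(1)[OF e(1) e0(2) t(1) _ n] smoothed_profile_eq[OF e(1) e0(2), of t "real CARD('n)"]
        by (cases "t < e'\<^sup>2") auto
      have 2: "smoothed_profile (real CARD('n)) e' t \<le> smoothed_profile (real CARD('n)) e t"
        using e e0 t power_le_one[of e 2] by (intro smoothed_profile_mono) auto
      have 3: "smoothed_profile (real CARD('n)) e t - newton_profile (real CARD('n)) t \<le> 4 * t powr (- (real CARD('n) / 2 - 3 / 4))"
        by (rule smoothed_profile_bounds(2)[OF e0(1) e(3) t n])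
      have 4: "t powr (- (real CARD('n) / 2 - 3 / 4)) = norm (x - y) powr (- (real CARD('n) - 3/2))"
      proof -
        have t2: "t = norm (x - y) powr 2" using that by (simp add: t_def powr_numeral)
        show ?thesis unfolding t2 powr_powr by (simp add: algebra_simps)
      qed
      have "\<bar>?g y\<bar> \<le> \<bar>smoothed_profile (real CARD('n)) e t - smoothed_profile (real CARD('n)) e' t\<bar>"
        by (cases "y \<in> \<Gamma>") (auto simp: kernel_def smoothed_newton_def t_def)
      also have "\<dots> \<le> 4 * t powr (- (real CARD('n) / 2 - 3 / 4))" using 1 2 3 by simp
      finally show ?thesis using True that 4 by (simp add: dist_norm)
    next
      case False
      then have "e\<^sup>2 \<le> (norm (x - y))\<^sup>2" "e'\<^sup>2 \<le> (norm (x - y))\<^sup>2"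
        using e by (auto intro!: power_mono)
      then show ?thesis using e e0 by (simp add: kernel_def smoothed_newton_def smoothed_profile_eq)
    qed
    have int: "integrable M ?g" using kernel_integrable e e0 x by simp
    have "ennreal \<bar>pot e x - pot e' x\<bar> = ennreal (norm (LINT y|M. ?g y))"
      unfolding pot_def using kernel_integrable e e0 x by simp
    also have "\<dots> \<le> (\<integral>\<^sup>+y. ennreal (norm (?g y)) \<partial>M)"
      using int by (rule integral_norm_bound_ennreal)
    also have "\<dots> \<le> (\<integral>\<^sup>+y. 4 * (ennreal (norm (x - y) powr (- (real CARD('n) - 3/2))) * indicator (ball x e - {x}) y) \<partial>M)"
    proof (rule nn_integral_mono_AE)
      show "AE y in M. ennreal (norm (?g y)) \<le>
          4 * (ennreal (norm (x - y) powr (- (real CARD('n) - 3/2))) * indicator (ball x e - {x}) y)"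
        using AE_neq[of x]
      proof (eventually_elim)
        case (elim y)
        have "ennreal (norm (?g y)) \<le> ennreal (4 * (norm (x - y) powr (- (real CARD('n) - 3/2)) * indicator (ball x e - {x}) y))"
          using le[OF elim] by (intro ennreal_leI) simp
        also have "\<dots> = 4 * (ennreal (norm (x - y) powr (- (real CARD('n) - 3/2))) * indicator (ball x e - {x}) y)"
          by (auto simp: ennreal_mult' indicator_def)
        finally show ?case .
      qed
    qed
    also have "\<dots> = 4 * (\<integral>\<^sup>+y. ennreal (norm (x - y) powr (- (real CARD('n) - 3/2))) * indicator (ball x e - {x}) y \<partial>M)"
    proof (rule nn_integral_cmult)
      have [measurable]: "ball x e - {x} \<in> sets borel" by simp
      have "(\<lambda>y. ennreal (norm (x - y) powr (- (real CARD('n) - 3/2))) * indicator (ball x e - {x}) y)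
          \<in> borel_measurable borel" by measurable
      then show "(\<lambda>y. ennreal (norm (x - y) powr (- (real CARD('n) - 3/2))) * indicator (ball x e - {x}) y)
          \<in> borel_measurable M" by (simp only: measurable_cong_sets[OF sets_M refl])
    qed
    also have "\<dots> \<le> 4 * ennreal (C * sqrt e)" by (intro mult_left_mono C e0) simp
    also have "\<dots> = ennreal (4 * C * sqrt e)" using C e0 by (simp add: ennreal_mult' mult.assoc)
    finally show ?thesis using C e0 by (simp add: ennreal_le_iff)
  qed
  then show ?thesis using C(1) that[of "4 * C"] by simp
qed

text \<open>The Laplacian of the image term is a multiple of the mollifier profile at an argument of
  at least \<open>\<delta>^2\<close>, hence zero inside the ball, and \<open>\<phi>\<close> vanishes
  outside.\<close>

lemma kernel_weak:
  assumes e: "0 < e" and \<phi>: "\<phi> \<in> test_functions (ball 0 1)" and y: "y \<in> \<Gamma>"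
  shows "(LINT x|lborel. kernel e x y * laplacian \<phi> x) = (LINT x|lborel. mollifier e (x - y) * \<phi> x)"
proof -
  have C: "Ck_on (Suc (Suc 0)) UNIV (\<lambda>x. smoothed_profile (real CARD('n)) \<delta> (reflected_sq y x))"
    by (rule Ck_on_comp[OF Ck_real_smoothed_profile[OF \<delta>(1)] Ck_on_reflected_sq])
  note C1 = Ck_on_smoothed_newton[OF e, of "Suc (Suc 0)" y]
  have lap: "laplacian (\<lambda>x. kernel e x y) x =
      mollifier e (x - y) - (norm y)\<^sup>2 * radial_mollifier (real CARD('n)) \<delta> (reflected_sq y x)" for x
    unfolding kernel_def
    by (simp only: laplacian_diff[OF C1 C] laplacian_smoothed_newton[OF e] radial_deriv_ode[OF \<delta>(1)]
        laplacian_comp_reflected_sq[OF DERIV_smoothed_profile[OF \<delta>(1)] DERIV_radial_deriv[OF \<delta>(1)]])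
  have eq: "laplacian (\<lambda>x. kernel e x y) x * \<phi> x = mollifier e (x - y) * \<phi> x" for x
  proof (cases "x \<in> ball 0 1")
    case True
    then have "\<delta>\<^sup>2 \<le> reflected_sq y x"
      using \<Gamma>(2)[OF y] \<delta>(1) by (intro reflected_sq_ge) auto
    then show ?thesis unfolding lap using radial_mollifier_eq_0[OF \<delta>(1)] by simp
  next
    case False
    then show ?thesis using test_functionsD(4)[OF \<phi>] by simp
  qed
  have "Ck_on (Suc (Suc 0)) UNIV (\<lambda>x. kernel e x y)"
    unfolding kernel_def by (rule Ck_on_diff[OF C1 C])
  from green_identity[OF this \<phi>] show ?thesis by (simp only: eq)
qed

lemma pot_weak:
  assumes e: "0 < e" and \<phi>: "\<phi> \<in> test_functions (ball 0 1)"
  shows "(LINT x|lborel. pot e x * laplacian \<phi> x) =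
      (LINT y|M. indicator \<Gamma> y * (LINT x|lborel. mollifier e (x - y) * \<phi> x))"
    and "integrable M (\<lambda>y. indicator \<Gamma> y * (LINT x|lborel. mollifier e (x - y) * \<phi> x))"
proof -
  interpret P: pair_sigma_finite lborel M ..
  let ?B = "borel :: ((real^'n) \<times> (real^'n)) measure"
  let ?Q = "cball (0::real^'n) 1 \<times> (UNIV :: (real^'n) set)"
  note p = test_functionsD[OF \<phi>]
  define H where "H x y = indicator \<Gamma> y * kernel e x y * laplacian \<phi> x" for x y
  obtain B where B: "\<forall>x y. norm x \<le> 1 \<longrightarrow> \<bar>indicator \<Gamma> y * kernel e x y\<bar> \<le> B"
    using kernel_bounded[OF e] ..
  obtain L where L: "\<forall>x\<in>cball 0 1. \<bar>laplacian \<phi> x\<bar> \<le> L"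
    using ex_abs_bound_on_compact[OF compact_cball continuous_on_subset[OF p(7) subset_UNIV]] by blast
  have sets_P: "sets (lborel \<Otimes>\<^sub>M M) = sets ?B"
    by (simp add: borel_prod[symmetric] cong: sets_pair_measure_cong) (simp add: sets_M cong: sets_pair_measure_cong)
  have Hm: "case_prod H \<in> borel_measurable (lborel \<Otimes>\<^sub>M M)"
  proof -
    have "(\<lambda>p. indicator \<Gamma> (snd p) * (kernel e (fst p) (snd p) * laplacian \<phi> (fst p))) \<in>
        borel_measurable ?B"
    proof (rule borel_measurable_times)
      show "(\<lambda>p. kernel e (fst p) (snd p) * laplacian \<phi> (fst p)) \<in>
          borel_measurable ?B"
        by (intro borel_measurable_continuous_onI continuous_on_mult continuous_kernel[OF e]
            continuous_on_compose2[OF p(7)] continuous_intros) auto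
      have "(indicator (UNIV \<times> \<Gamma>) :: _ \<Rightarrow> real) \<in> borel_measurable ?B"
        using \<Gamma>(1) by (intro borel_measurable_indicator borel_closed closed_Times) (auto simp: compact_imp_closed)
      moreover have "indicator (UNIV \<times> \<Gamma>) = (\<lambda>p :: (real^'n) \<times> (real^'n). indicator \<Gamma> (snd p) :: real)"
        by (auto simp: indicator_def fun_eq_iff)
      ultimately show "(\<lambda>p. indicator \<Gamma> (snd p) :: real) \<in> borel_measurable ?B"
        by simp
    qed
    moreover have "case_prod H = (\<lambda>p. indicator \<Gamma> (snd p) * (kernel e (fst p) (snd p) * laplacian \<phi> (fst p)))"
      by (auto simp: H_def fun_eq_iff mult.assoc)
    ultimately have "case_prod H \<in> borel_measurable ?B"
      by (simp only:)
    then show ?thesis by (simp only: measurable_cong_sets[OF sets_P refl])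
  qed
  \<comment> \<open>The integrand is bounded and lives on the unit ball times the whole space, a set
    of finite product measure since \<open>M\<close> is finite.\<close>
  have Hint: "integrable (lborel \<Otimes>\<^sub>M M) (case_prod H)"
  proof (rule integrableI_bounded_set[where A="?Q" and B="B * L"])
    show "?Q \<in> sets (lborel \<Otimes>\<^sub>M M)"
      by (intro pair_measureI) (auto simp: sets_M)
    have "emeasure (lborel \<Otimes>\<^sub>M M) (?Q) = emeasure lborel (cball (0::real^'n) 1) * emeasure M UNIV"
      by (rule emeasure_pair_measure_Times) (auto simp: sets_M)
    also have "\<dots> < \<infinity>"
      using emeasure_lborel_cball_finite[of "0::real^'n" 1]
      by (auto simp: ennreal_mult_less_top less_top emeasure_eq_measure)
    finally show "emeasure (lborel \<Otimes>\<^sub>M M) (?Q) < \<infinity>" .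
    show "AE p in lborel \<Otimes>\<^sub>M M. p \<in> ?Q \<longrightarrow> norm (case_prod H p) \<le> B * L"
    proof (intro AE_I2 impI)
      fix p :: "(real^'n) \<times> (real^'n)" assume "p \<in> ?Q"
      then obtain x y where p: "p = (x, y)" "norm x \<le> 1" by auto
      have "\<bar>indicator \<Gamma> y * kernel e x y\<bar> * \<bar>laplacian \<phi> x\<bar> \<le> B * L"
      proof (rule mult_mono)
        show "\<bar>indicator \<Gamma> y * kernel e x y\<bar> \<le> B" using B p(2) by blast
        then show "0 \<le> B" by (rule order_trans[OF abs_ge_zero])
        show "\<bar>laplacian \<phi> x\<bar> \<le> L" using L p(2) by auto
      qed simp
      then show "norm (case_prod H p) \<le> B * L" by (simp only: p(1) H_def case_prod_conv real_norm_def abs_mult)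
    qed
    have "case_prod H p = 0" if "p \<notin> ?Q" for p
    proof -
      obtain x y where xy: "p = (x, y)" by fastforce
      with that have "x \<notin> ball 0 1" by auto
      then show ?thesis using p(5) by (simp add: H_def xy)
    qed
    then show "AE p in lborel \<Otimes>\<^sub>M M. p \<notin> ?Q \<longrightarrow> case_prod H p = 0"
      by (intro AE_I2 impI)
  qed (rule Hm)
  have inner: "(LINT x|lborel. H x y) = indicator \<Gamma> y * (LINT x|lborel. mollifier e (x - y) * \<phi> x)" for y
    using kernel_weak[OF e \<phi>, of y] by (cases "y \<in> \<Gamma>") (auto simp: H_def)
  have "(LINT x|lborel. pot e x * laplacian \<phi> x) = (LINT x|lborel. LINT y|M. H x y)"
    by (simp add: pot_def H_def)
  also have "\<dots> = (LINT y|M. LINT x|lborel. H x y)"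
    using P.Fubini_integral[OF Hint] by simp
  finally show "(LINT x|lborel. pot e x * laplacian \<phi> x) =
      (LINT y|M. indicator \<Gamma> y * (LINT x|lborel. mollifier e (x - y) * \<phi> x))"
    by (simp only: inner)
  show "integrable M (\<lambda>y. indicator \<Gamma> y * (LINT x|lborel. mollifier e (x - y) * \<phi> x))"
    using P.integrable_snd[OF Hint] by (simp only: inner)
qed

lemma mollified_test_function:
  fixes \<phi> :: "real^'n \<Rightarrow> real"
  assumes \<phi>: "\<phi> \<in> test_functions (ball 0 1)" and \<eta>: "0 < \<eta>"
  shows "\<exists>e0>0. \<forall>e y. 0 < e \<longrightarrow> e \<le> e0 \<longrightarrow> e \<le> 1 \<longrightarrow> norm y \<le> 1 \<longrightarrow>
    \<bar>(LINT x|lborel. mollifier e (x - y) * \<phi> x) - mollifier_mass TYPE('n) * \<phi> y\<bar> \<le> \<eta> * mollifier_mass TYPE('n)"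
proof -
  note p = test_functionsD[OF \<phi>]
  \<comment> \<open>Radius 2 contains every point within distance \<open>e <= 1\<close> of the unit
    ball.\<close>
  have "uniformly_continuous_on (cball (0::real^'n) 2) \<phi>"
    using continuous_on_subset[OF p(6)] by (intro compact_uniformly_continuous) auto
  then obtain e0 where e0: "0 < e0" "\<And>x y. x \<in> cball 0 2 \<Longrightarrow> y \<in> cball 0 2 \<Longrightarrow> dist x y < e0 \<Longrightarrow> dist (\<phi> x) (\<phi> y) < \<eta>"
    using \<eta> unfolding uniformly_continuous_on_def by metis
  have "\<bar>(LINT x|lborel. mollifier e (x - y) * \<phi> x) - mollifier_mass TYPE('n) * \<phi> y\<bar> \<le> \<eta> * mollifier_mass TYPE('n)"
    if e: "0 < e" "e \<le> e0" "e \<le> 1" and y: "norm y \<le> 1" for e y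
  proof -
    have i1: "integrable lborel (\<lambda>x. mollifier e (x - y) * \<phi> x)"
      using integrable_mult_mollifier[OF e(1) p(6), of y] by (simp add: mult.commute)
    have i2: "integrable lborel (\<lambda>x. mollifier e (x - y) * \<phi> y)"
      using integrable_mollifier[OF e(1), of y] by simp
    have "mollifier_mass TYPE('n) * \<phi> y = (LINT x|lborel. mollifier e (x - y) * \<phi> y)"
      using integral_mollifier[OF e(1,3), of y] by simp
    then have "(LINT x|lborel. mollifier e (x - y) * \<phi> x) - mollifier_mass TYPE('n) * \<phi> y =
        (LINT x|lborel. mollifier e (x - y) * \<phi> x - mollifier e (x - y) * \<phi> y)"
      using i1 i2 by simp
    also have "\<bar>\<dots>\<bar> \<le> (LINT x|lborel. \<bar>mollifier e (x - y) * \<phi> x - mollifier e (x - y) * \<phi> y\<bar>)"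
      by (rule integral_abs_bound)
    also have "\<dots> \<le> (LINT x|lborel. \<eta> * mollifier e (x - y))"
    proof (rule integral_mono)
      show "integrable lborel (\<lambda>x. \<bar>mollifier e (x - y) * \<phi> x - mollifier e (x - y) * \<phi> y\<bar>)"
        using i1 i2 by simp
      show "integrable lborel (\<lambda>x. \<eta> * mollifier e (x - y))"
        using integrable_mollifier[OF e(1), of y] by simp
      show "\<bar>mollifier e (x - y) * \<phi> x - mollifier e (x - y) * \<phi> y\<bar> \<le> \<eta> * mollifier e (x - y)" for x
      proof (cases "norm (x - y) < e")
        case True
        have "norm x \<le> norm (x - y) + norm y" using norm_triangle_ineq[of "x - y" y] by simp
        then have "dist (\<phi> x) (\<phi> y) < \<eta>"
          using True e y by (intro e0(2)) (auto simp: dist_norm)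
        then have "mollifier e (x - y) * \<bar>\<phi> x - \<phi> y\<bar> \<le> mollifier e (x - y) * \<eta>"
          by (intro mult_left_mono mollifier_nonneg) (simp add: dist_real_def)
        moreover have "\<bar>mollifier e (x - y) * \<phi> x - mollifier e (x - y) * \<phi> y\<bar> = mollifier e (x - y) * \<bar>\<phi> x - \<phi> y\<bar>"
          unfolding right_diff_distrib[symmetric] abs_mult abs_of_nonneg[OF mollifier_nonneg] ..
        ultimately show ?thesis by (simp only: mult.commute[of \<eta>])
      next
        case False
        then show ?thesis using mollifier_eq_0[OF e(1), of "x - y"] by simp
      qed
    qed
    also have "\<dots> = \<eta> * mollifier_mass TYPE('n)" using integral_mollifier[OF e(1,3), of y] by simp
    finally show ?thesis .
  qed
  then show ?thesis using e0(1) by blast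
qed

lemma ex_weak_solution:
  "\<exists>u. continuous_on (cball 0 1) u \<and> (\<forall>x. norm x = 1 \<longrightarrow> u x = 0) \<and>
    (\<forall>\<phi>\<in>test_functions (ball 0 1).
      (LINT x|lborel. u x * laplacian \<phi> x) = (LINT y|M. indicator \<Gamma> y * \<phi> y))"
proof -
  define c where "c = mollifier_mass TYPE('n)"
  have c: "0 < c" unfolding c_def by (rule mollifier_mass_pos)
  \<comment> \<open>The factor \<open>\<delta>\<close> keeps all scales below the one required for
    exact boundary values.\<close>
  define e where "e k = \<delta> * inverse (real (Suc k))" for k
  have e: "0 < e k" "e k \<le> \<delta>" "e k \<le> 1" for k
  proof -
    have "inverse (real (Suc k)) \<le> 1" by (simp add: field_simps)
    then have "\<delta> * inverse (real (Suc k)) \<le> \<delta> * 1" using \<delta> by (intro mult_left_mono) auto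
    then show "e k \<le> \<delta>" by (simp only: e_def mult_1_right)
    then show "e k \<le> 1" using \<delta> by linarith
    show "0 < e k" using \<delta> by (simp add: e_def)
  qed
  have e_mono: "e k \<le> e j" if "j \<le> k" for j k
    using that \<delta> unfolding e_def by (intro mult_left_mono le_imp_inverse_le) auto
  have e_lim: "e \<longlonglongrightarrow> 0"
    unfolding e_def using tendsto_mult_left[OF LIMSEQ_inverse_real_of_nat, of \<delta>] by simp
  obtain C where C: "0 \<le> C" "\<And>e e' x. 0 < e' \<Longrightarrow> e' \<le> e \<Longrightarrow> e \<le> 1 \<Longrightarrow> norm x \<le> 1 \<Longrightarrow>
      \<bar>pot e x - pot e' x\<bar> \<le> C * sqrt e" using pot_Cauchy by metis
  have "uniformly_Cauchy_on (cball 0 1) (\<lambda>k. pot (e k))"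
  proof (rule uniformly_Cauchy_onI')
    fix t :: real assume t: "0 < t"
    have "(\<lambda>k. C * sqrt (e k)) \<longlonglongrightarrow> C * sqrt 0" by (intro tendsto_intros e_lim)
    then have "\<forall>\<^sub>F k in sequentially. C * sqrt (e k) < t" using t by (intro order_tendstoD(2)) auto
    then obtain k0 where k0: "\<And>k. k0 \<le> k \<Longrightarrow> C * sqrt (e k) < t" by (auto simp: eventually_sequentially)
    show "\<exists>K. \<forall>x\<in>cball 0 1. \<forall>m\<ge>K. \<forall>n>m. dist (pot (e m) x) (pot (e n) x) < t"
    proof (intro exI ballI allI impI)
      fix x m n assume "x \<in> cball (0::real^'n) 1" "k0 \<le> m" "m < n"
      then have "\<bar>pot (e m) x - pot (e n) x\<bar> \<le> C * sqrt (e m)" using e by (intro C(2) e_mono) auto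
      also have "\<dots> < t" using k0 \<open>k0 \<le> m\<close> by blast
      finally show "dist (pot (e m) x) (pot (e n) x) < t" by (simp add: dist_real_def)
    qed
  qed
  then obtain w where w: "uniform_limit (cball 0 1) (\<lambda>k. pot (e k)) w sequentially"
    using Cauchy_uniformly_convergent unfolding uniformly_convergent_on_def by blast
  have wcont: "continuous_on (cball 0 1) w"
    by (rule uniform_limit_theorem[OF _ w]) (use continuous_pot e in auto)
  have wpt: "(\<lambda>k. pot (e k) x) \<longlonglongrightarrow> w x" if "norm x \<le> 1" for x
    using tendsto_uniform_limitI[OF w, of x] that by simp
  have wbdry: "w x = 0" if "norm x = 1" for x
    using wpt[of x] pot_boundary[OF e(1,2) that] that by (simp add: LIMSEQ_const_iff)
  have weak: "(LINT x|lborel. w x * laplacian \<phi> x) = c * (LINT y|M. indicator \<Gamma> y * \<phi> y)"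
    if \<phi>: "\<phi> \<in> test_functions (ball 0 1)" for \<phi>
  proof -
    note p = test_functionsD[OF \<phi>]
    note int = integrable_mult_laplacian[OF \<phi>]
    have lim1: "(\<lambda>k. LINT x|lborel. pot (e k) x * laplacian \<phi> x) \<longlonglongrightarrow> (LINT x|lborel. w x * laplacian \<phi> x)"
    proof (rule LIMSEQ_I)
      fix t :: real assume t: "0 < t"
      define A where "A = (LINT x|lborel. \<bar>laplacian \<phi> x\<bar>)"
      have A: "0 \<le> A" unfolding A_def by (intro integral_nonneg_AE) auto
      have Aint: "integrable lborel (\<lambda>x. \<bar>laplacian \<phi> x\<bar>)" using int[of "\<lambda>_. 1"] by (simp add: continuous_on_const)
      \<comment> \<open>Adding 1 avoids division by zero and makes the final estimate strict; the
        same device is used with \<open>m\<close> below.\<close>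
      have s: "0 < t / (A + 1)" using t A by simp
      then obtain k0 where k0: "\<And>k x. k0 \<le> k \<Longrightarrow> x \<in> cball 0 1 \<Longrightarrow> dist (pot (e k) x) (w x) < t / (A + 1)"
        using w unfolding uniform_limit_sequentially_iff by meson
      show "\<exists>k0. \<forall>k\<ge>k0. norm ((LINT x|lborel. pot (e k) x * laplacian \<phi> x) - (LINT x|lborel. w x * laplacian \<phi> x)) < t"
      proof (intro exI allI impI)
        fix k assume k: "k0 \<le> k"
        have "(LINT x|lborel. pot (e k) x * laplacian \<phi> x) - (LINT x|lborel. w x * laplacian \<phi> x) =
            (LINT x|lborel. pot (e k) x * laplacian \<phi> x - w x * laplacian \<phi> x)"
          using int[OF wcont] int[OF continuous_pot[OF e(1)]] by simp
        also have "norm \<dots> \<le> (LINT x|lborel. norm (pot (e k) x * laplacian \<phi> x - w x * laplacian \<phi> x))"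
          by (rule integral_norm_bound)
        also have "\<dots> \<le> (LINT x|lborel. t / (A + 1) * \<bar>laplacian \<phi> x\<bar>)"
        proof (rule integral_mono)
          show "integrable lborel (\<lambda>x. norm (pot (e k) x * laplacian \<phi> x - w x * laplacian \<phi> x))"
            using int[OF wcont] int[OF continuous_pot[OF e(1)]] by simp
          show "integrable lborel (\<lambda>x. t / (A + 1) * \<bar>laplacian \<phi> x\<bar>)" using Aint by simp
          show "norm (pot (e k) x * laplacian \<phi> x - w x * laplacian \<phi> x) \<le> t / (A + 1) * \<bar>laplacian \<phi> x\<bar>" for x
          proof (cases "x \<in> ball 0 1")
            case True
            then have "\<bar>pot (e k) x - w x\<bar> \<le> t / (A + 1)"
              using k0[OF k, of x] by (simp add: dist_real_def)
            then show ?thesis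
              by (simp only: left_diff_distrib[symmetric] real_norm_def abs_mult) (intro mult_right_mono abs_ge_zero)
          next
            case False
            then show ?thesis using p(5) s by simp
          qed
        qed
        also have "\<dots> = t / (A + 1) * A" by (simp add: A_def)
        also have "\<dots> < t" using t A by (simp add: field_simps)
        finally show "norm ((LINT x|lborel. pot (e k) x * laplacian \<phi> x) - (LINT x|lborel. w x * laplacian \<phi> x)) < t" .
      qed
    qed
    let ?F = "\<lambda>k. LINT y|M. indicator \<Gamma> y * (LINT x|lborel. mollifier (e k) (x - y) * \<phi> x)"
    have phim: "integrable M (\<lambda>y. indicator \<Gamma> y * (c * \<phi> y))"
    proof -
      obtain B where B: "0 \<le> B" "\<forall>x\<in>cball 0 1. \<bar>\<phi> x\<bar> \<le> B"
        using ex_abs_bound_on_compact[OF compact_cball continuous_on_subset[OF p(6) subset_UNIV]] by blast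
      have "\<bar>indicator \<Gamma> y * (c * \<phi> y)\<bar> \<le> c * B" for y
      proof (cases "y \<in> \<Gamma>")
        case True
        then show ?thesis using \<Gamma>(2)[OF True] \<delta> B c by (simp add: abs_mult)
      qed (use c B in simp)
      moreover have "(\<lambda>y. indicator \<Gamma> y * (c * \<phi> y)) \<in> borel_measurable M"
      proof -
        have "\<phi> \<in> borel_measurable borel" using p(6) by (rule borel_measurable_continuous_onI)
        then have "\<phi> \<in> borel_measurable M" by (simp only: measurable_cong_sets[OF sets_M refl])
        then show ?thesis using \<Gamma>_sets by measurable
      qed
      ultimately show ?thesis by (intro integrable_const_bound[where B="c * B"]) auto
    qed
    have lim2: "?F \<longlonglongrightarrow> (LINT y|M. indicator \<Gamma> y * (c * \<phi> y))"
    proof (rule LIMSEQ_I)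
      fix t :: real assume t: "0 < t"
      define m where "m = measure M UNIV"
      have m: "0 \<le> m" by (simp add: m_def)
      define \<eta> where "\<eta> = t / (m + 1) / c"
      have \<eta>: "0 < \<eta>" using t c m by (simp add: \<eta>_def)
      obtain e0 where e0: "0 < e0" "\<And>e y. 0 < e \<Longrightarrow> e \<le> e0 \<Longrightarrow> e \<le> 1 \<Longrightarrow> norm y \<le> 1 \<Longrightarrow>
          \<bar>(LINT x|lborel. mollifier e (x - y) * \<phi> x) - mollifier_mass TYPE('n) * \<phi> y\<bar> \<le> \<eta> * mollifier_mass TYPE('n)"
        using mollified_test_function[OF \<phi> \<eta>] by auto
      have "\<forall>\<^sub>F k in sequentially. e k < e0" using e_lim e0(1) by (rule order_tendstoD(2))
      then obtain k0 where k0: "\<And>k. k0 \<le> k \<Longrightarrow> e k < e0" by (auto simp: eventually_sequentially)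
      show "\<exists>k0. \<forall>k\<ge>k0. norm (?F k - (LINT y|M. indicator \<Gamma> y * (c * \<phi> y))) < t"
      proof (intro exI allI impI)
        fix k assume k: "k0 \<le> k"
        let ?G = "\<lambda>y. indicator \<Gamma> y * (LINT x|lborel. mollifier (e k) (x - y) * \<phi> x)"
        note Gi = pot_weak(2)[OF e(1)[of k] \<phi>]
        have "?F k - (LINT y|M. indicator \<Gamma> y * (c * \<phi> y)) = (LINT y|M. ?G y - indicator \<Gamma> y * (c * \<phi> y))"
          using Gi phim by simp
        also have "norm \<dots> \<le> (LINT y|M. norm (?G y - indicator \<Gamma> y * (c * \<phi> y)))"
          by (rule integral_norm_bound)
        also have "\<dots> \<le> (LINT y|M. \<eta> * c)"
        proof (rule integral_mono)
          show "integrable M (\<lambda>y. norm (?G y - indicator \<Gamma> y * (c * \<phi> y)))" using Gi phim by simp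
          show "norm (?G y - indicator \<Gamma> y * (c * \<phi> y)) \<le> \<eta> * c" for y
          proof (cases "y \<in> \<Gamma>")
            case True
            then have "norm y \<le> 1" using \<Gamma>(2)[OF True] \<delta> by simp
            then show ?thesis using e0(2)[OF e(1), of k y] k0[OF k] e(3)[of k] True by (simp add: c_def)
          qed (use \<eta> c in simp)
        qed simp
        also have "\<dots> = \<eta> * c * m" by (simp add: m_def space_M)
        also have "\<eta> * c = t / (m + 1)" using c by (simp add: \<eta>_def)
        also have "t / (m + 1) * m < t" using t m by (simp add: field_simps)
        finally show "norm (?F k - (LINT y|M. indicator \<Gamma> y * (c * \<phi> y))) < t" .
      qed
    qed
    have "(LINT x|lborel. w x * laplacian \<phi> x) = (LINT y|M. indicator \<Gamma> y * (c * \<phi> y))"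
      using LIMSEQ_unique[OF lim1] lim2 pot_weak(1)[OF e(1) \<phi>] by simp
    also have "\<dots> = (LINT y|M. c * (indicator \<Gamma> y * \<phi> y))" by (simp add: mult.left_commute)
    finally show ?thesis by simp
  qed
  show ?thesis
  \<comment> \<open>Only here is the normalisation of the fundamental solution corrected, by the
    common mass \<open>c\<close>.\<close>
  proof (intro exI[of _ "\<lambda>x. w x / c"] conjI allI impI ballI)
    show "continuous_on (cball 0 1) (\<lambda>x. w x / c)" using c by (intro continuous_intros wcont) auto
    show "w x / c = 0" if "norm x = 1" for x using wbdry[OF that] by simp
    show "(LINT x|lborel. w x / c * laplacian \<phi> x) = (LINT y|M. indicator \<Gamma> y * \<phi> y)"
      if "\<phi> \<in> test_functions (ball 0 1)" for \<phi>
      using weak[OF that] c by simp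
  qed
qed

end

section \<open>Testing against dipoles\<close>

text \<open>Half of the \<open>k\<close>-th partial derivative of \<open>smoothed_newton e\<close>.
  Writing \<open>x - 0\<close> matches the lemmas on squared distances to a point.\<close>

definition dipole :: "'n::finite \<Rightarrow> real \<Rightarrow> real^'n \<Rightarrow> real" where
  "dipole k e x = x $ k * radial_deriv (real CARD('n)) e ((norm (x - 0))\<^sup>2)"

lemma Ck_on_dipole: "0 < e \<Longrightarrow> Ck_on j UNIV (dipole k e)"
  unfolding dipole_def
  by (rule Ck_on_mult[OF Ck_on_coord Ck_on_comp[OF Ck_real_radial_deriv Ck_on_norm2]])

lemma laplacian_dipole:
  fixes x :: "real^'n::finite"
  assumes e: "0 < e" and d: "\<And>t. (radial_mollifier (real CARD('n)) e has_real_derivative d t) (at t)"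
  shows "laplacian (dipole k e) x = x $ k * d ((norm x)\<^sup>2)"
proof -
  let ?n = "real CARD('n)" and ?t = "(norm (x - 0))\<^sup>2"
  let ?F = "\<lambda>x::real^'n. radial_deriv ?n e ((norm (x - 0))\<^sup>2)"
  obtain r3 where r3: "\<And>t. (radial_deriv2 ?n e has_real_derivative r3 t) (at t)"
    using Ck_real_radial_deriv2[OF e, of "Suc 0" ?n] by auto
  \<comment> \<open>Differentiating the radial equation once; the extra \<open>4\<close> in
    \<open>2 * ?n + 4\<close> also matches the cross term \<open>2 * (grad x_k . grad F)\<close> of
    the product rule below.\<close>
  have ode: "4 * t * r3 t + (2 * ?n + 4) * radial_deriv2 ?n e t = d t" for t
  proof -
    have "((\<lambda>t. 4 * t * radial_deriv2 ?n e t + 2 * ?n * radial_deriv ?n e t) has_real_derivative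
        (4 * 1 * radial_deriv2 ?n e t + r3 t * (4 * t)) + 2 * ?n * radial_deriv2 ?n e t) (at t)"
      by (rule DERIV_add[OF DERIV_mult[OF DERIV_cmult[OF DERIV_ident] r3] DERIV_cmult[OF DERIV_radial_deriv[OF e]]])
    then have "(radial_mollifier ?n e has_real_derivative
        (4 * 1 * radial_deriv2 ?n e t + r3 t * (4 * t)) + 2 * ?n * radial_deriv2 ?n e t) (at t)"
      by (simp only: radial_deriv_ode[OF e])
    from DERIV_unique[OF this d] show ?thesis by (simp add: algebra_simps)
  qed
  have F: "Ck_on (Suc (Suc 0)) UNIV ?F" by (rule Ck_on_comp[OF Ck_real_radial_deriv[OF e] Ck_on_norm2])
  have pF: "partial i ?F x = radial_deriv2 ?n e ?t * (2 * (x $ i - 0 $ i))" for i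
  proof -
    have "(\<lambda>x::real^'n. (norm (x - 0))\<^sup>2) differentiable at x"
      using Ck_on_norm2[of "Suc 0" "0::real^'n"] by simp
    from partial_comp[of "radial_deriv ?n e", OF DERIV_radial_deriv[OF e] this, of i]
    show ?thesis by (simp only: partial_norm2)
  qed
  have "laplacian (dipole k e) x = x $ k * laplacian ?F x +
      2 * (\<Sum>i\<in>UNIV. partial i (\<lambda>x::real^'n. x $ k) x * partial i ?F x) + laplacian (\<lambda>x::real^'n. x $ k) x * ?F x"
    unfolding dipole_def[abs_def] by (rule laplacian_mult[OF Ck_on_coord F])
  also have "(\<Sum>i\<in>UNIV. partial i (\<lambda>x::real^'n. x $ k) x * partial i ?F x) = radial_deriv2 ?n e ?t * (2 * x $ k)"
    unfolding partial_coord pF by (simp add: if_distrib[where f="\<lambda>a. a * _"] cong: if_cong)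
  also have "laplacian ?F x = 4 * ?t * r3 ?t + 2 * ?n * radial_deriv2 ?n e ?t"
    by (rule laplacian_radial[OF DERIV_radial_deriv[OF e] r3])
  finally have "laplacian (dipole k e) x = x $ k * (4 * ?t * r3 ?t + (2 * ?n + 4) * radial_deriv2 ?n e ?t)"
    by (simp add: laplacian_coord algebra_simps)
  then show ?thesis by (simp only: ode) simp
qed

lemma dipole_diff_test:
  fixes k :: "'n::finite"
  assumes e: "0 < e" "e \<le> R" and sub: "cball 0 R \<subseteq> \<Omega>"
  shows "(\<lambda>x. dipole k e x - dipole k R x) \<in> test_functions \<Omega>"
proof (rule test_functionsI[OF _ _ sub])
  have R: "0 < R" using e by simp
  show "Ck_on j UNIV (\<lambda>x. dipole k e x - dipole k R x)" for j
    by (rule Ck_on_diff[OF Ck_on_dipole[OF e(1)] Ck_on_dipole[OF R]])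
  show "norm (x - 0) \<le> R" if "dipole k e x - dipole k R x \<noteq> 0" for x
  proof (rule ccontr)
    assume "\<not> norm (x - 0) \<le> R"
    then have "R\<^sup>2 \<le> (norm (x - 0))\<^sup>2" "e\<^sup>2 \<le> (norm (x - 0))\<^sup>2" using e by (auto intro!: power_mono)
    with that e R show False by (simp add: dipole_def radial_deriv_eq)
  qed
qed

text \<open>By scaling, the Laplacian of \<open>dipole k e\<close> has size \<open>e\<^sup>-\<^sup>n\<^sup>-\<^sup>1\<close> on the ball of radius \<open>e\<close>, where
  a Lipschitz function deviates by at most \<open>L e\<close> from a constant.\<close>

lemma lipschitz_test_dipole_bounded:
  fixes u :: "real^'n::finite \<Rightarrow> real"
  assumes cont: "continuous_on (cball 0 1) u"
    and R: "0 < R" "R < 1" and lip: "\<And>x. norm x \<le> R \<Longrightarrow> \<bar>u x - u 0\<bar> \<le> L * norm x"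
  shows "\<exists>B. \<forall>e. 0 < e \<longrightarrow> e \<le> R \<longrightarrow>
    \<bar>LINT x|lborel. u x * laplacian (\<lambda>x. dipole k e x - dipole k R x) x\<bar> \<le> B"
proof -
  let ?n = "real CARD('n)"
  obtain C d where d: "\<And>t. (radial_mollifier ?n 1 has_real_derivative d t) (at t)"
    "\<And>t. \<bar>d t\<bar> \<le> C" "\<And>t. 1 < t \<Longrightarrow> d t = 0" using ex_DERIV_radial_mollifier[of ?n] by auto
  have C: "0 \<le> C" using d(2)[of 0] by simp
  have L: "0 \<le> L"
  proof -
    have "norm (R *\<^sub>R axis k 1 :: real^'n) = R" using R by simp
    then have "0 \<le> L * R" using lip[of "R *\<^sub>R axis k 1"] by (metis abs_ge_zero order_refl order_trans)
    then show ?thesis using R by (simp add: zero_le_mult_iff)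
  qed
  have lap: "laplacian (dipole k e) x = x $ k * (e powr (- ?n - 2) * d ((norm x)\<^sup>2 / e\<^sup>2))" if "0 < e" for e x
    by (rule laplacian_dipole[OF that DERIV_radial_mollifier_scale[OF d(1) that]])
  have bound: "\<bar>u x - u 0\<bar> * \<bar>laplacian (dipole k e) x\<bar> \<le> L * C * e powr (- ?n) * indicator (cball 0 e) x"
    if e: "0 < e" "e \<le> R" for e x
  proof (cases "norm x \<le> e")
    case True
    have "\<bar>u x - u 0\<bar> \<le> L * e" using lip[of x] True e L by (meson mult_left_mono order_trans)
    moreover have "\<bar>laplacian (dipole k e) x\<bar> \<le> e * (e powr (- ?n - 2) * C)"
      unfolding lap[OF e(1)] abs_mult
      using component_le_norm_cart[of x k] True e d(2) by (intro mult_mono) auto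
    ultimately have "\<bar>u x - u 0\<bar> * \<bar>laplacian (dipole k e) x\<bar> \<le> (L * e) * (e * (e powr (- ?n - 2) * C))"
      using L e by (intro mult_mono) auto
    also have "e powr (- ?n - 2) = e powr (- ?n) / e\<^sup>2" using e by (simp add: powr_diff powr_numeral)
    also have "(L * e) * (e * (e powr (- ?n) / e\<^sup>2 * C)) = L * C * e powr (- ?n)"
      using e by (simp add: power2_eq_square)
    finally show ?thesis using True by simp
  next
    case False
    then have "e\<^sup>2 < (norm x)\<^sup>2" using e by (intro power_strict_mono) auto
    then have "1 < (norm x)\<^sup>2 / e\<^sup>2" using e by (simp add: less_divide_eq)
    then show ?thesis using d(3) by (simp add: lap[OF e(1)] False)
  qed
  let ?v = "unit_ball_vol ?n"
  \<comment> \<open>The factor \<open>e powr (- n)\<close> cancels the volume of the ball, so the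
    bound is uniform in \<open>e\<close>.\<close>
  have vol: "(LINT x::real^'n|lborel. L * C * e powr (- ?n) * indicator (cball 0 e) x) = L * C * ?v" if "0 < e" for e
  proof -
    have "measure lborel (cball (0::real^'n) e) = ?v * e ^ CARD('n)"
      using content_cball[of e "0::real^'n"] that by simp
    moreover have "e powr (- ?n) * e ^ CARD('n) = 1"
      using that by (simp add: powr_minus powr_realpow)
    ultimately show ?thesis by (simp add: mult_ac)
  qed
  have ind: "integrable lborel (\<lambda>x::real^'n. L * C * e powr (- ?n) * indicator (cball 0 e) x)" for e
    using emeasure_lborel_cball_finite[of "0::real^'n" e]
    by (intro integrable_mult_right integrable_real_indicator) auto
  have "\<bar>LINT x|lborel. u x * laplacian (\<lambda>x. dipole k e x - dipole k R x) x\<bar> \<le> 2 * (L * C * ?v)"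
    if e: "0 < e" "e \<le> R" for e
  proof -
    let ?\<phi> = "\<lambda>x. dipole k e x - dipole k R x"
    have \<phi>: "?\<phi> \<in> test_functions (ball 0 1)"
      using R by (intro dipole_diff_test e) auto
    have i1: "integrable lborel (\<lambda>x. u x * laplacian ?\<phi> x)"
      by (rule integrable_mult_laplacian[OF \<phi> cont])
    have i2: "integrable lborel (\<lambda>x. u 0 * laplacian ?\<phi> x)"
      by (rule integrable_mult_laplacian[OF \<phi>]) simp
    have lapd: "laplacian ?\<phi> x = laplacian (dipole k e) x - laplacian (dipole k R) x" for x
      by (rule laplacian_diff[OF Ck_on_dipole[OF e(1)] Ck_on_dipole[OF R(1)]])
    \<comment> \<open>The Laplacian of a test function has integral zero, so the constant
      \<open>u 0\<close> may be subtracted and only the increment of \<open>u\<close>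
      counts.\<close>
    have "(LINT x|lborel. u x * laplacian ?\<phi> x) =
        (LINT x|lborel. u x * laplacian ?\<phi> x) - (LINT x|lborel. u 0 * laplacian ?\<phi> x)"
      using integral_laplacian_eq_0[OF \<phi>] by simp
    also have "\<dots> = (LINT x|lborel. u x * laplacian ?\<phi> x - u 0 * laplacian ?\<phi> x)"
      using i1 i2 by simp
    also have "\<bar>\<dots>\<bar> \<le> (LINT x|lborel. \<bar>u x * laplacian ?\<phi> x - u 0 * laplacian ?\<phi> x\<bar>)"
      by (rule integral_abs_bound)
    also have "\<dots> \<le> (LINT x::real^'n|lborel. L * C * e powr (- ?n) * indicator (cball 0 e) x +
        L * C * R powr (- ?n) * indicator (cball 0 R) x)"
    proof (rule integral_mono)
      show "integrable lborel (\<lambda>x. \<bar>u x * laplacian ?\<phi> x - u 0 * laplacian ?\<phi> x\<bar>)" using i1 i2 by simp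
      show "integrable lborel (\<lambda>x::real^'n. L * C * e powr (- ?n) * indicator (cball 0 e) x +
          L * C * R powr (- ?n) * indicator (cball 0 R) x)"
        by (intro Bochner_Integration.integrable_add ind)
      fix x
      have "\<bar>u x * laplacian ?\<phi> x - u 0 * laplacian ?\<phi> x\<bar> = \<bar>u x - u 0\<bar> * \<bar>laplacian (dipole k e) x - laplacian (dipole k R) x\<bar>"
        by (simp only: left_diff_distrib[symmetric] abs_mult lapd)
      also have "\<dots> \<le> \<bar>u x - u 0\<bar> * (\<bar>laplacian (dipole k e) x\<bar> + \<bar>laplacian (dipole k R) x\<bar>)"
        by (intro mult_left_mono abs_triangle_ineq4) simp
      also have "\<dots> \<le> L * C * e powr (- ?n) * indicator (cball 0 e) x + L * C * R powr (- ?n) * indicator (cball 0 R) x"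
        unfolding distrib_left by (intro add_mono bound e R order_refl)
      finally show "\<bar>u x * laplacian ?\<phi> x - u 0 * laplacian ?\<phi> x\<bar> \<le>
          L * C * e powr (- ?n) * indicator (cball 0 e) x + L * C * R powr (- ?n) * indicator (cball 0 R) x" .
    qed
    also have "\<dots> = 2 * (L * C * ?v)"
      unfolding Bochner_Integration.integral_add[OF ind ind] vol[OF e(1)] vol[OF R(1)] by simp
    finally show ?thesis .
  qed
  then show ?thesis by blast
qed

section \<open>The cusp\<close>

text \<open>At \<open>t = 0\<close> the quotient is 0, so the convention at the tip needs no
  separate case.\<close>

definition cusp_profile :: "real \<Rightarrow> real" where
  "cusp_profile t = t / \<bar>ln t\<bar>"

text \<open>For \<open>t <= 1/16\<close> one has \<open>|ln t| >= 1\<close>; the threshold is 2^-4,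
  matching the shells of index at least 4.\<close>

lemma cusp_profile_bounds:
  assumes "0 < t" "t \<le> 1/16"
  shows "0 \<le> cusp_profile t" "cusp_profile t \<le> t"
proof -
  show "0 \<le> cusp_profile t" unfolding cusp_profile_def using assms by (intro divide_nonneg_nonneg) auto
  have "ln t \<le> - 1"
  proof -
    have "exp 1 \<le> (3::real)" using exp_le by simp
    then have "t * exp 1 \<le> 1/16 * 3" using assms by (intro mult_mono) auto
    then have "t \<le> exp (- 1)" by (simp add: exp_minus field_simps)
    then show ?thesis using assms by (simp add: ln_le_cancel_iff[symmetric, of t] del: ln_le_cancel_iff)
  qed
  then have "1 \<le> \<bar>ln t\<bar>" by linarith
  then have "t / \<bar>ln t\<bar> \<le> t / 1" using assms by (intro divide_left_mono) auto
  then show "cusp_profile t \<le> t" by (simp add: cusp_profile_def)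
qed

text \<open>Here \<open>|ln t| <= (j + 1) * ln 2 <= j + 1\<close>; this is where the harmonic term
  originates.\<close>

lemma cusp_profile_dyadic_ge:
  assumes "(1/2) ^ j / 2 \<le> t" "t < 1"
  shows "(1/2) ^ j / 2 / (real j + 1) \<le> cusp_profile t"
proof -
  have "0 < (1/2 :: real) ^ j / 2" by simp
  then have t: "0 < t" using assms(1) by linarith
  have l1: "ln ((1/2) ^ j / 2) \<le> ln t" using assms(1) t by (simp add: ln_le_cancel_iff)
  have l2: "ln ((1/2) ^ j / 2 :: real) = - ((real j + 1) * ln 2)"
    by (simp add: ln_div ln_mult ln_realpow algebra_simps power_divide)
  have l3: "(real j + 1) * ln 2 \<le> (real j + 1) * 1"
    using ln_2_less_1 by (intro mult_left_mono) auto
  have l4: "ln t < 0" using t assms(2) by simp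
  have "- ln t \<le> (real j + 1) * ln 2" using l1 unfolding l2 by (simp only: minus_le_iff)
  also note l3
  finally have "\<bar>ln t\<bar> \<le> real j + 1" using l4 by simp
  with l4 have "0 < \<bar>ln t\<bar>" "\<bar>ln t\<bar> \<le> real j + 1" by linarith+
  then show ?thesis unfolding cusp_profile_def using assms(1) t by (intro frac_le) auto
qed

lemma norm_horizontal_le: "norm (horizontal k x) \<le> norm x"
  by (rule norm_le_componentwise_cart) auto

lemma norm_le_horizontal: "norm x \<le> norm (horizontal k x) + \<bar>x $ k\<bar>"
proof -
  have "x = horizontal k x + x $ k *\<^sub>R axis k 1" by (simp add: vec_eq_iff axis_def)
  then have "norm x \<le> norm (horizontal k x) + norm (x $ k *\<^sub>R axis k (1::real))"
    by (metis norm_triangle_ineq)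
  then show ?thesis by simp
qed

text \<open>With \<open>s = 2\<^sup>-\<^sup>j\<close>, the shell has area at least a multiple of \<open>s\<^sup>n\<^sup>-\<^sup>1\<close> and height at least
  \<open>s / (2 (j + 1))\<close>, so that the dipole moments sum up like the harmonic series.\<close>

definition cusp_shell :: "(real^'n::finite) set \<Rightarrow> 'n \<Rightarrow> nat \<Rightarrow> (real^'n) set" where
  "cusp_shell \<Gamma> k j = {x \<in> \<Gamma> \<inter> ball 0 (1/4).
     (1/2) ^ j / 2 \<le> norm (horizontal k x) \<and> norm (horizontal k x) < (1/2) ^ j}"

locale cusp_surface =
  fixes \<Gamma> :: "(real^'n::finite) set" and k :: 'n
  assumes n2: "CARD('n) \<ge> 2"
    and hyper: "closed_C1_hypersurface \<Gamma>"
    and cusp: "\<Gamma> \<inter> ball 0 (1/4) =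
      {x \<in> ball 0 (1/4). x $ k =
         (if horizontal k x = 0 then 0
          else norm (horizontal k x) / \<bar>ln (norm (horizontal k x))\<bar>)}"
    and inball: "\<Gamma> \<subseteq> ball 0 1"
begin

abbreviation "hmeas \<equiv> hausdorff_measure (CARD('n) - 1) :: (real^'n) measure"

lemma cusp_iff: "x \<in> \<Gamma> \<and> norm x < 1/4 \<longleftrightarrow> norm x < 1/4 \<and> x $ k = cusp_profile (norm (horizontal k x))"
proof -
  have "x \<in> \<Gamma> \<and> norm x < 1/4 \<longleftrightarrow> x \<in> \<Gamma> \<inter> ball 0 (1/4)" by simp
  then show ?thesis unfolding cusp by (auto simp: cusp_profile_def)
qed

lemma sets_\<Gamma>: "\<Gamma> \<in> sets borel"
  using hyper by (simp add: closed_C1_hypersurface_def compact_imp_closed)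

lemma emeasure_\<Gamma>_finite: "emeasure hmeas \<Gamma> < top"
proof -
  obtain K where "\<forall>x r. 0 < r \<longrightarrow>
    hausdorff_outer (CARD('n) - 1) (\<Gamma> \<inter> ball x r) \<le> ennreal (K * r ^ (CARD('n) - 1))"
    using hypersurface_growth[OF hyper] by blast
  from this[rule_format, of 1 0]
  have "hausdorff_outer (CARD('n) - 1) (\<Gamma> \<inter> ball 0 1) \<le> ennreal (K * 1 ^ (CARD('n) - 1))" by simp
  moreover have "\<Gamma> \<inter> ball 0 1 = \<Gamma>" using inball by blast
  ultimately show ?thesis by (simp add: emeasure_hausdorff_measure[OF sets_\<Gamma>] le_less_trans)
qed

lemma sets_cusp_shell: "cusp_shell \<Gamma> k j \<in> sets borel"
proof -
  have h: "continuous_on UNIV (\<lambda>x. norm (horizontal k x))"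
    unfolding horizontal_def
  proof (intro continuous_on_norm continuous_on_vec_lambda)
    show "continuous_on UNIV (\<lambda>x::real^'n. if i = k then 0 else x $ i)" for i
      by (cases "i = k") (auto intro: continuous_intros)
  qed
  have "cusp_shell \<Gamma> k j = \<Gamma> \<inter> ball 0 (1/4) \<inter> {x. (1/2) ^ j / 2 \<le> norm (horizontal k x)} \<inter>
      {x. norm (horizontal k x) < (1/2) ^ j}"
    by (auto simp: cusp_shell_def)
  moreover have "closed {x. (1/2) ^ j / 2 \<le> norm (horizontal k x)}"
    by (intro closed_Collect_le continuous_on_const h)
  moreover have "open {x. norm (horizontal k x) < (1/2) ^ j}"
    by (intro open_Collect_less continuous_on_const h)
  ultimately show ?thesis using sets_\<Gamma> by auto
qed

lemma measure_cusp_shell_ge: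
  assumes j: "4 \<le> j"
  shows "unit_ball_vol (real (CARD('n) - 1)) / 4 ^ (CARD('n) - 1) * ((1/2) ^ j / (4 * real CARD('n))) ^ (CARD('n) - 1)
    \<le> measure hmeas (cusp_shell \<Gamma> k j)"
proof -
  let ?n = "real CARD('n)" and ?m = "CARD('n) - 1"
  define s where "s = (1/2 :: real) ^ j"
  have s0: "0 < s" by (simp add: s_def)
  have s: "s \<le> 1/16"
    using power_decreasing[OF j, of "1/2 :: real"] by (simp add: s_def power4_eq_xxxx)
  \<comment> \<open>Dimension at least two supplies a horizontal direction along which the box can
    be moved away from the axis.\<close>
  have "\<exists>i::'n. i \<noteq> k"
  proof (rule ccontr)
    assume "\<not> ?thesis"
    then have "(UNIV :: 'n set) = {k}" by auto
    then have "CARD('n) = card {k}" by (rule arg_cong)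
    then show False using n2 by simp
  qed
  then obtain i0 where i0: "i0 \<noteq> k" by blast
  \<comment> \<open>All \<open>n\<close> coordinates together move a point by at most
    \<open>n * w = s / 4\<close>, so a box with corner at distance \<open>s / 2\<close> stays inside
    radius \<open>3/4 * s < s\<close>.\<close>
  define w where "w = s / (4 * ?n)"
  have w: "0 < w" using s0 by (simp add: w_def)
  \<comment> \<open>Starting the coordinate \<open>i0\<close> at \<open>s / 2\<close> gives the
    inner bound of the shell. The \<open>k\<close>-extent from 0 to 1 is only the unit height
    required by \<open>hausdorff_outer_ge_box\<close>.\<close>
  define a :: "real^'n" where "a = (\<chi> i. if i = i0 then s / 2 else 0)"
  define b :: "real^'n" where "b = (\<chi> i. if i = i0 then s / 2 + w else if i = k then 1 else w)"
  have prod: "(\<Prod>i\<in>UNIV. b $ i - a $ i) = w ^ ?m"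
  proof -
    have "(\<Prod>i\<in>UNIV. b $ i - a $ i) = (b $ k - a $ k) * (\<Prod>i\<in>UNIV - {k}. b $ i - a $ i)"
      by (rule prod.remove) auto
    also have "(\<Prod>i\<in>UNIV - {k}. b $ i - a $ i) = (\<Prod>i\<in>UNIV - {k}. w)"
      by (rule prod.cong) (auto simp: a_def b_def)
    finally show ?thesis using i0 by (simp add: a_def b_def card_Diff_singleton)
  qed
  have "ennreal (unit_ball_vol (real ?m) / 4 ^ ?m * (\<Prod>i\<in>UNIV. b $ i - a $ i)) \<le>
      hausdorff_outer ?m (cusp_shell \<Gamma> k j)"
  proof (rule hausdorff_outer_ge_box)
    show "a $ i \<le> b $ i" for i using w by (simp add: a_def b_def)
    show "b $ k - a $ k = 1" using i0 by (simp add: a_def b_def)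
    fix y assume y: "y \<in> cbox a b"
    define h where "h = horizontal k y"
    have yb: "a $ i \<le> y $ i" "y $ i \<le> b $ i" for i using y by (auto simp: mem_box_cart)
    have low: "s / 2 \<le> norm h"
    proof -
      have "s / 2 \<le> \<bar>h $ i0\<bar>" using yb(1)[of i0] i0 by (simp add: h_def a_def)
      then show ?thesis using component_le_norm_cart[of h i0] by linarith
    qed
    have up: "norm h < s"
    proof -
      have "\<bar>(h - (s / 2) *\<^sub>R axis i0 1) $ i\<bar> \<le> w" for i
        using yb[of i] i0 w by (auto simp: h_def axis_def a_def b_def split: if_splits)
      then have "norm (h - (s / 2) *\<^sub>R axis i0 1) \<le> (\<Sum>i\<in>(UNIV :: 'n set). w)"
        by (intro order_trans[OF norm_le_l1_cart] sum_mono)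
      also have "\<dots> = s / 4" by (simp add: w_def)
      finally have "norm (h - (s / 2) *\<^sub>R axis i0 1) \<le> s / 4" .
      moreover have "norm h \<le> norm (h - (s / 2) *\<^sub>R axis i0 1) + norm ((s / 2) *\<^sub>R axis i0 (1::real))"
        by (metis diff_add_cancel norm_triangle_ineq)
      ultimately show ?thesis using s0 by simp
    qed
    \<comment> \<open>The point of the cusp above \<open>h\<close>; its norm is at most
      \<open>2 * |h| < 2 * s <= 1/8\<close>, so it lies where the surface is prescribed.\<close>
    define z where "z = h + cusp_profile (norm h) *\<^sub>R axis k 1"
    have cb: "0 \<le> cusp_profile (norm h)" "cusp_profile (norm h) \<le> norm h"
      using low up s s0 by (auto intro!: cusp_profile_bounds)
    have hz: "horizontal k z = h" by (simp add: vec_eq_iff z_def h_def axis_def)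
    have zk: "z $ k = cusp_profile (norm h)" by (simp add: z_def h_def)
    have "norm z < 1/4" using norm_le_horizontal[of z k] hz zk cb up s by simp
    then have "z \<in> \<Gamma>" using cusp_iff[of z] hz zk by simp
    then have "z \<in> cusp_shell \<Gamma> k j"
      using \<open>norm z < 1/4\<close> low up by (simp add: cusp_shell_def hz s_def)
    then show "\<exists>z\<in>cusp_shell \<Gamma> k j. horizontal k z = horizontal k y" using hz h_def by blast
  qed
  also have "hausdorff_outer ?m (cusp_shell \<Gamma> k j) = emeasure hmeas (cusp_shell \<Gamma> k j)"
    by (rule emeasure_hausdorff_measure[OF sets_cusp_shell, symmetric])
  also have "\<dots> = ennreal (measure hmeas (cusp_shell \<Gamma> k j))"
  proof (rule emeasure_eq_ennreal_measure)
    have "emeasure hmeas (cusp_shell \<Gamma> k j) \<le> emeasure hmeas \<Gamma>"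
      using sets_\<Gamma> by (intro emeasure_mono) (auto simp: cusp_shell_def)
    then show "emeasure hmeas (cusp_shell \<Gamma> k j) \<noteq> top" using emeasure_\<Gamma>_finite by (auto simp: top_unique)
  qed
  finally show ?thesis unfolding prod by (simp add: w_def s_def)
qed

lemma set_integrable_continuous:
  assumes "continuous_on UNIV f"
  shows "integrable hmeas (\<lambda>x. indicator \<Gamma> x *\<^sub>R (f x :: real))"
proof -
  obtain B where B: "\<forall>x\<in>\<Gamma>. \<bar>f x\<bar> \<le> B"
    using ex_abs_bound_on_compact[of \<Gamma> f] hyper continuous_on_subset[OF assms subset_UNIV]
    by (auto simp: closed_C1_hypersurface_def)
  show ?thesis
  proof (rule integrableI_bounded_set[where A=\<Gamma> and B=B])
    have "f \<in> borel_measurable borel" using assms by (rule borel_measurable_continuous_onI)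
    then have "(\<lambda>x. indicator \<Gamma> x *\<^sub>R f x) \<in> borel_measurable borel"
      using sets_\<Gamma> by (intro borel_measurable_scaleR borel_measurable_indicator)
    then show "(\<lambda>x. indicator \<Gamma> x *\<^sub>R f x) \<in> borel_measurable hmeas"
      by (simp only: measurable_cong_sets[OF sets_hausdorff_measure refl])
  qed (use B sets_\<Gamma> emeasure_\<Gamma>_finite in auto)
qed

text \<open>The inner cutoff \<open>e\<close> is adapted to \<open>J\<close>, while \<open>R\<close>
  and the constant stay fixed; the moments thus dominate every partial sum of a harmonic
  series.\<close>

lemma dipole_moment_ge:
  assumes R: "0 < R" "R \<le> 1/8" and j0: "4 \<le> j0" "(1/2) ^ j0 \<le> R / 4"
  shows "\<exists>\<kappa>>0. \<forall>J. \<exists>e>0. e \<le> R \<and>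
    (\<Sum>j\<in>{j0..<J}. \<kappa> / (real j + 1)) \<le> (LINT x:\<Gamma>|hmeas. dipole k e x - dipole k R x)"
proof -
  let ?n = "real CARD('n)" and ?m = "CARD('n) - 1"
  define \<mu> where "\<mu> = unit_ball_vol (real ?m) / 4 ^ ?m * (1 / (4 * ?n)) ^ ?m"
  \<comment> \<open>\<open>\<mu>\<close> is the area constant of a shell; the factor 1/2 comes from
    the height \<open>s / 2\<close> in the numerator and \<open>2 powr (- n)\<close> from
    \<open>|x| <= 2 * s\<close>.\<close>
  define \<kappa> where "\<kappa> = \<mu> / 2 * 2 powr (- ?n)"
  have \<mu>: "0 < \<mu>" by (simp add: \<mu>_def)
  then have \<kappa>: "0 < \<kappa>" by (simp add: \<kappa>_def)
  have "\<exists>e>0. e \<le> R \<and> (\<Sum>j\<in>{j0..<J}. \<kappa> / (real j + 1)) \<le> (LINT x:\<Gamma>|hmeas. dipole k e x - dipole k R x)" for J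
  proof -
    \<comment> \<open>The cutoff lies below all shells of index less than \<open>J\<close>, so on
      them the singular dipole is not yet smoothed.\<close>
    define e where "e = min R ((1/2) ^ J / 2)"
    have e: "0 < e" "e \<le> R" "e \<le> (1/2) ^ J / 2" using R by (auto simp: e_def)
    define c where "c j = (1/2) ^ j / 2 / (real j + 1) * (2 * (1/2) ^ j) powr (- ?n)" for j :: nat
    have c0: "0 \<le> c j" for j by (simp add: c_def)
    let ?A = "cusp_shell \<Gamma> k"
    let ?f = "\<lambda>x. dipole k e x - dipole k R x"
    have A_fin: "emeasure hmeas (?A j) < \<infinity>" for j
    proof -
      have "emeasure hmeas (?A j) \<le> emeasure hmeas \<Gamma>"
        using sets_\<Gamma> by (intro emeasure_mono) (auto simp: cusp_shell_def)
      then show ?thesis using emeasure_\<Gamma>_finite by (simp add: le_less_trans)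
    qed
    \<comment> \<open>Inside radius 1/4 the cusp lies in \<open>x $ k >= 0\<close>. Farther out the
      two dipoles cancel because \<open>R <= 1/8\<close>, so the unknown remainder of the surface
      contributes nothing.\<close>
    have nonneg: "0 \<le> ?f x" if x: "x \<in> \<Gamma>" for x
    proof (cases "norm x < 1/4")
      case True
      then have "0 \<le> x $ k" using cusp_iff[of x] x by (simp add: cusp_profile_def)
      moreover have "radial_deriv ?n R ((norm x)\<^sup>2) \<le> radial_deriv ?n e ((norm x)\<^sup>2)"
        using e by (intro radial_deriv_antimono) auto
      ultimately show ?thesis by (simp add: dipole_def mult_left_mono)
    next
      case False
      then have "R\<^sup>2 \<le> (norm x)\<^sup>2" "e\<^sup>2 \<le> (norm x)\<^sup>2" using R e by (auto intro!: power_mono)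
      then show ?thesis using R e by (simp add: dipole_def radial_deriv_eq)
    qed
    \<comment> \<open>On these shells \<open>e <= |x| <= R / 2\<close>: the dipole of scale
      \<open>e\<close> is the exact one and that of scale \<open>R\<close> vanishes.\<close>
    have lower: "c j \<le> ?f x" if j: "j0 \<le> j" "j < J" and x: "x \<in> ?A j" for j x
    proof -
      define s where "s = (1/2 :: real) ^ j"
      have s0: "0 < s" by (simp add: s_def)
      have "s \<le> (1/2) ^ j0" unfolding s_def using j by (intro power_decreasing) auto
      then have s1: "s \<le> R / 4" "s \<le> 1/16" using j0(2) R by linarith+
      have es: "e \<le> s / 2"
      proof -
        have "(1/2) ^ J \<le> s" unfolding s_def using j by (intro power_decreasing) auto
        with e(3) show ?thesis by linarith
      qed
      have h: "s / 2 \<le> norm (horizontal k x)" "norm (horizontal k x) < s"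
        using x by (auto simp: cusp_shell_def s_def)
      have xk: "x $ k = cusp_profile (norm (horizontal k x))" using x cusp_iff[of x] by (simp add: cusp_shell_def)
      have xk_le: "0 \<le> x $ k" "x $ k \<le> s"
      proof -
        have "0 < norm (horizontal k x)" "norm (horizontal k x) \<le> 1/16" using h s0 s1 by linarith+
        from cusp_profile_bounds[OF this] show "0 \<le> x $ k" "x $ k \<le> s"
          unfolding xk using h by linarith+
      qed
      have xk_ge: "s / 2 / (real j + 1) \<le> x $ k"
        unfolding xk s_def using h s1 by (intro cusp_profile_dyadic_ge) (auto simp: s_def)
      define t where "t = (norm x)\<^sup>2"
      have nx: "s / 2 \<le> norm x" "norm x \<le> 2 * s"
        using norm_horizontal_le[of k x] norm_le_horizontal[of x k] h xk_le by auto
      have "e\<^sup>2 \<le> t" unfolding t_def using e es nx by (intro power_mono) auto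
      then have He: "radial_deriv ?n e t = t powr (- ?n / 2)" using e by (intro radial_deriv_eq)
      have "t \<le> (R / 2)\<^sup>2" unfolding t_def using nx s1 by (intro power_mono) auto
      then have HR: "radial_deriv ?n R t = 0" using R by (intro radial_deriv_eq_0) (auto simp: power_divide)
      have "norm x > 0" using nx s0 by linarith
      then have "t powr (- ?n / 2) = norm x powr (- ?n)"
        unfolding t_def by (simp add: powr_powr powr_numeral[symmetric] del: powr_numeral)
      also have "(2 * s) powr (- ?n) \<le> norm x powr (- ?n)"
        using nx \<open>norm x > 0\<close> by (intro powr_mono2') auto
      finally have "(2 * s) powr (- ?n) \<le> t powr (- ?n / 2)" by simp
      then have "s / 2 / (real j + 1) * (2 * s) powr (- ?n) \<le> x $ k * t powr (- ?n / 2)"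
        using xk_ge xk_le by (intro mult_mono) auto
      then show ?thesis using He HR by (simp add: dipole_def c_def s_def t_def)
    qed
    have disj: "x \<notin> ?A j'" if "x \<in> ?A j" "j < j'" for x j j'
    proof
      assume "x \<in> ?A j'"
      then have "(1/2) ^ j / 2 < (1/2 :: real) ^ j'" using that by (auto simp: cusp_shell_def)
      moreover have "(1/2) ^ j' \<le> (1/2 :: real) ^ Suc j" using that by (intro power_decreasing) auto
      ultimately show False by simp
    qed
    have pointwise: "(\<Sum>j\<in>{j0..<J}. c j * indicator (?A j) x) \<le> indicator \<Gamma> x *\<^sub>R ?f x" for x
    proof (cases "\<exists>j\<in>{j0..<J}. x \<in> ?A j")
      case True
      then obtain j where j: "j \<in> {j0..<J}" "x \<in> ?A j" by blast
      have other: "x \<notin> ?A j'" if "j' \<noteq> j" for j'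
        using disj[of x j j'] disj[of x j' j] j(2) that by (cases "j < j'") auto
      have "(\<Sum>j\<in>{j0..<J}. c j * indicator (?A j) x) = (\<Sum>i\<in>{j0..<J}. if i = j then c j else 0)"
        using other j(2) by (intro sum.cong) auto
      also have "\<dots> = c j" using j(1) by simp
      finally show ?thesis using lower[of j x] j by (auto simp: cusp_shell_def)
    next
      case False
      then have "(\<Sum>j\<in>{j0..<J}. c j * indicator (?A j) x) = 0" by (intro sum.neutral) auto
      then show ?thesis using nonneg[of x] by (simp add: indicator_def)
    qed
    have cont: "continuous_on UNIV ?f"
      using test_functionsD(6)[OF dipole_diff_test[OF e(1,2), of UNIV k]] by simp
    note fint = set_integrable_continuous[OF cont]
    have Aint: "integrable hmeas (\<lambda>x. c j * indicator (?A j) x)" for j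
      using A_fin sets_cusp_shell by (intro integrable_mult_right integrable_real_indicator) auto
    have "\<kappa> / (real j + 1) \<le> c j * measure hmeas (?A j)" if j: "j \<in> {j0..<J}" for j
    proof -
      define s where "s = (1/2 :: real) ^ j"
      have s0: "0 < s" by (simp add: s_def)
      \<comment> \<open>Kernel size, shell area and height scale as \<open>s^-n\<close>,
        \<open>s^(n-1)\<close> and \<open>s\<close>; all powers cancel and only
        \<open>1 / (j + 1)\<close> survives.\<close>
      have "s powr (- ?n) * s ^ ?m * s = s powr (- ?n) * s ^ CARD('n)"
        using n2 by (simp add: mult.assoc power_Suc2[symmetric] del: power_Suc)
      also have "\<dots> = 1" using s0 by (simp add: powr_minus powr_realpow)
      finally have one: "s powr (- ?n) * s ^ ?m * s = 1" .
      have "c j * (\<mu> * s ^ ?m) = \<kappa> / (real j + 1) * (s powr (- ?n) * s ^ ?m * s)"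
        using s0 by (simp add: c_def \<kappa>_def s_def[symmetric] powr_mult)
      then have "\<kappa> / (real j + 1) = c j * (\<mu> * s ^ ?m)" using one by simp
      also have "\<mu> * s ^ ?m = unit_ball_vol (real ?m) / 4 ^ ?m * ((1/2) ^ j / (4 * ?n)) ^ ?m"
        unfolding \<mu>_def s_def power_divide by simp
      also have "c j * \<dots> \<le> c j * measure hmeas (?A j)"
        using j j0 by (intro mult_left_mono measure_cusp_shell_ge c0) auto
      finally show ?thesis .
    qed
    then have "(\<Sum>j\<in>{j0..<J}. \<kappa> / (real j + 1)) \<le> (\<Sum>j\<in>{j0..<J}. c j * measure hmeas (?A j))"
      by (rule sum_mono)
    also have "\<dots> = (LINT x|hmeas. (\<Sum>j\<in>{j0..<J}. c j * indicator (?A j) x))"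
      using Aint by (subst Bochner_Integration.integral_sum) auto
    also have "\<dots> \<le> (LINT x|hmeas. indicator \<Gamma> x *\<^sub>R ?f x)"
      by (intro integral_mono pointwise fint Bochner_Integration.integrable_sum Aint)
    finally show ?thesis using e unfolding set_lebesgue_integral_def by (intro exI[of _ e] conjI)
  qed
  then show ?thesis using \<kappa> by blast
qed

lemma weak_solution_not_lipschitz:
  assumes u: "weak_solution (ball 0 1) \<Gamma> (\<lambda>_. 1) u"
  shows "\<not> locally_lipschitz_on (ball 0 1) u"
proof
  assume "locally_lipschitz_on (ball 0 1) u"
  then have "\<exists>r>0. \<exists>L. L-lipschitz_on (ball 0 r \<inter> ball 0 1) u"
    unfolding locally_lipschitz_on_def by (rule bspec) simp
  then obtain r L where r: "0 < r" and L: "L-lipschitz_on (ball 0 r \<inter> ball 0 1) u" by blast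
  have cont: "continuous_on (cball 0 1) u" using u by (simp add: weak_solution_def)
  \<comment> \<open>\<open>r / 2\<close> keeps the test function where \<open>u\<close> is
    Lipschitz, and \<open>1/8\<close> keeps it where the surface is the cusp.\<close>
  define R where "R = min (r / 2) (1/8)"
  have R: "0 < R" "R \<le> 1/8" "R < r" using r by (auto simp: R_def)
  have lip: "\<bar>u x - u 0\<bar> \<le> L * norm x" if "norm x \<le> R" for x
    using lipschitz_onD[OF L, of x 0] that R by (simp add: dist_norm)
  obtain B where B: "\<And>e. 0 < e \<Longrightarrow> e \<le> R \<Longrightarrow>
    \<bar>LINT x|lborel. u x * laplacian (\<lambda>x. dipole k e x - dipole k R x) x\<bar> \<le> B"
    using lipschitz_test_dipole_bounded[OF cont R(1) _ lip, of k] R by auto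
  obtain j1 where j1: "(1/2 :: real) ^ j1 < R / 4" using real_arch_pow_inv[of "R / 4" "1/2"] R by auto
  define j0 where "j0 = max 4 j1"
  have j0: "4 \<le> j0" "(1/2) ^ j0 \<le> R / 4"
  proof -
    have "(1/2) ^ j0 \<le> (1/2 :: real) ^ j1" by (intro power_decreasing) (auto simp: j0_def)
    with j1 show "(1/2) ^ j0 \<le> R / 4" by linarith
  qed (simp add: j0_def)
  obtain \<kappa> where \<kappa>: "0 < \<kappa>" "\<forall>J. \<exists>e>0. e \<le> R \<and>
    (\<Sum>j\<in>{j0..<J}. \<kappa> / (real j + 1)) \<le> (LINT x:\<Gamma>|hmeas. dipole k e x - dipole k R x)"
    using dipole_moment_ge[OF R(1,2) j0] by blast
  have bounded: "(\<Sum>j\<in>{j0..<J}. \<kappa> / (real j + 1)) \<le> B" for J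
  proof -
    obtain e where e: "0 < e" "e \<le> R"
      "(\<Sum>j\<in>{j0..<J}. \<kappa> / (real j + 1)) \<le> (LINT x:\<Gamma>|hmeas. dipole k e x - dipole k R x)"
      using \<kappa>(2) by blast
    let ?\<phi> = "\<lambda>x. dipole k e x - dipole k R x"
    have \<phi>: "?\<phi> \<in> test_functions (ball 0 1)" using R by (intro dipole_diff_test e) auto
    have "(LINT x:\<Gamma>|hmeas. ?\<phi> x) = (LINT x:ball 0 1|lborel. u x * laplacian ?\<phi> x)"
      using u \<phi> by (simp add: weak_solution_def)
    also have "\<dots> = (LINT x|lborel. u x * laplacian ?\<phi> x)"
      by (rule set_integral_eq_lborel_integral) (use test_functionsD(5)[OF \<phi>] in simp)
    also have "\<dots> \<le> B" using B[OF e(1,2)] by simp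
    finally show ?thesis using e(3) by simp
  qed
  have "summable (\<lambda>i. \<kappa> / (real (i + j0) + 1))"
  proof (rule summableI_nonneg_bounded)
    show "0 \<le> \<kappa> / (real (i + j0) + 1)" for i using \<kappa> by simp
    show "(\<Sum>i<n. \<kappa> / (real (i + j0) + 1)) \<le> B" for n
    proof -
      have "(\<Sum>i<n. \<kappa> / (real (i + j0) + 1)) = (\<Sum>j\<in>{j0..<n + j0}. \<kappa> / (real j + 1))"
        using sum.shift_bounds_nat_ivl[of "\<lambda>j. \<kappa> / (real j + 1)" 0 j0 n] by (simp add: atLeast0LessThan)
      then show ?thesis using bounded[of "n + j0"] by simp
    qed
  qed
  then have "summable (\<lambda>i. \<kappa> / (real i + 1))"
    using summable_iff_shift[of "\<lambda>i. \<kappa> / (real i + 1)" j0] by simp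
  then have "summable (\<lambda>i. (1 / \<kappa>) * (\<kappa> / (real i + 1)))" by (rule summable_mult)
  then have "summable (\<lambda>i. 1 / real (i + 1))" using \<kappa>(1) by (simp add: add.commute)
  then have "summable (\<lambda>i. inverse (real i))"
    using summable_iff_shift[of "\<lambda>i. inverse (real i)" 1] by (simp add: inverse_eq_divide)
  then show False using not_summable_harmonic[where 'a=real] by blast
qed

lemma ex_weak_solution_cusp: "\<exists>u. weak_solution (ball 0 1) \<Gamma> (\<lambda>_. 1) u"
proof -
  \<comment> \<open>The density restricts the Hausdorff measure to the surface, which makes it
    finite and gives it the growth bound.\<close>
  let ?M = "density hmeas (indicator \<Gamma>)"
  obtain K where K: "0 \<le> K" "\<And>x r. 0 < r \<Longrightarrow>
    hausdorff_outer (CARD('n) - 1) (\<Gamma> \<inter> ball x r) \<le> ennreal (K * r ^ (CARD('n) - 1))"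
    using hypersurface_growth[OF hyper] by blast
  have cpt: "compact \<Gamma>" using hyper by (simp add: closed_C1_hypersurface_def)
  have "\<exists>\<delta>. 0 < \<delta> \<and> \<delta> \<le> 1 \<and> (\<forall>y\<in>\<Gamma>. norm y \<le> 1 - \<delta>)"
  proof (cases "\<Gamma> = {}")
    case False
    obtain q where q: "q \<in> \<Gamma>" "\<And>y. y \<in> \<Gamma> \<Longrightarrow> norm y \<le> norm q"
      using continuous_attains_sup[OF cpt False, of norm] continuous_on_norm_id[of \<Gamma>] by blast
    then show ?thesis using inball by (intro exI[of _ "1 - norm q"]) auto
  qed (auto intro: exI[of _ 1])
  then obtain \<delta> where \<delta>: "0 < \<delta>" "\<delta> \<le> 1" "\<And>y. y \<in> \<Gamma> \<Longrightarrow> norm y \<le> 1 - \<delta>" by blast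
  have ind: "(indicator \<Gamma> :: _ \<Rightarrow> ennreal) \<in> borel_measurable hmeas"
    by (intro borel_measurable_indicator) (simp add: sets_\<Gamma>)
  have em: "emeasure ?M A = emeasure hmeas (\<Gamma> \<inter> A)" if "A \<in> sets borel" for A
  proof -
    have "emeasure ?M A = (\<integral>\<^sup>+x. indicator \<Gamma> x * indicator A x \<partial>hmeas)"
      by (rule emeasure_density[OF ind]) (simp add: that)
    also have "\<dots> = (\<integral>\<^sup>+x. indicator (\<Gamma> \<inter> A) x \<partial>hmeas)" by (simp only: indicator_inter_arith)
    also have "\<dots> = emeasure hmeas (\<Gamma> \<inter> A)" by (rule nn_integral_indicator) (use that sets_\<Gamma> in simp)
    finally show ?thesis .
  qed
  interpret M: finite_measure ?M
    by (rule finite_measureI) (use em[of UNIV] emeasure_\<Gamma>_finite in auto)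
  interpret surface_measure ?M \<Gamma> K \<delta>
  proof
    show "emeasure ?M (ball x r) \<le> ennreal (K * r ^ (CARD('n) - 1))" if "0 < r" for x r
    proof -
      have "\<Gamma> \<inter> ball x r \<in> sets borel" using sets_\<Gamma> by simp
      from emeasure_hausdorff_measure[OF this] K(2)[OF that, of x] show ?thesis
        unfolding em[OF borel_open[OF open_ball]] by (simp only:)
    qed
  qed (use K n2 cpt \<delta> in auto)
  obtain u where u: "continuous_on (cball 0 1) u" "\<And>x. norm x = 1 \<Longrightarrow> u x = 0"
    "\<And>\<phi>. \<phi> \<in> test_functions (ball 0 1) \<Longrightarrow>
      (LINT x|lborel. u x * laplacian \<phi> x) = (LINT y|?M. indicator \<Gamma> y * \<phi> y)"
    using ex_weak_solution by blast
  have "(LINT x:ball 0 1|lborel. u x * laplacian \<phi> x) = (LINT x:\<Gamma>|hmeas. 1 * \<phi> x)"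
    if \<phi>: "\<phi> \<in> test_functions (ball 0 1)" for \<phi>
  proof -
    have \<phi>m: "\<phi> \<in> borel_measurable borel"
      using test_functionsD(6)[OF \<phi>] by (rule borel_measurable_continuous_onI)
    have "(LINT x:ball 0 1|lborel. u x * laplacian \<phi> x) = (LINT x|lborel. u x * laplacian \<phi> x)"
      by (rule set_integral_eq_lborel_integral) (use test_functionsD(5)[OF \<phi>] in simp)
    \<comment> \<open>The density is written as a coerced real function to fit
      \<open>integral_density\<close>; the indicator then occurs twice and is idempotent.\<close>
    also have "\<dots> = (LINT y|density hmeas (\<lambda>y. ennreal (indicator \<Gamma> y)). indicator \<Gamma> y * \<phi> y)"
      using u(3)[OF \<phi>] by (simp add: ennreal_indicator)
    also have "\<dots> = (LINT y|hmeas. indicator \<Gamma> y *\<^sub>R (indicator \<Gamma> y * \<phi> y))"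
      using \<phi>m sets_\<Gamma> by (intro integral_density) (auto simp: measurable_cong_sets[OF sets_hausdorff_measure refl])
    also have "\<dots> = (LINT x:\<Gamma>|hmeas. 1 * \<phi> x)"
      unfolding set_lebesgue_integral_def
      by (rule Bochner_Integration.integral_cong) (auto simp: indicator_def)
    finally show ?thesis .
  qed
  then show ?thesis using u(1,2) by (intro exI[of _ u]) (auto simp: weak_solution_def)
qed

end

section \<open>Comparison of weak solutions and conclusion\<close>

lemma weak_solution_le:
  fixes u v :: "real^'n::finite \<Rightarrow> real"
  assumes u: "weak_solution (ball 0 1) \<Gamma> g u" and v: "weak_solution (ball 0 1) \<Gamma> g v"
    and x: "norm x \<le> 1"
  shows "v x \<le> u x"
proof -
  have cont: "continuous_on (cball 0 1) u" "continuous_on (cball 0 1) v"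
    using u v by (auto simp: weak_solution_def)
  \<comment> \<open>Solutions are only continuous on the closed ball. Composing with the
    nearest-point projection extends the difference continuously to the whole space, as the maximum
    principle requires.\<close>
  define P :: "real^'n \<Rightarrow> real^'n" where "P = closest_point (cball 0 1)"
  have P: "P y = y" if "norm y \<le> 1" for y unfolding P_def using that by (intro closest_point_self) simp
  have Pc: "continuous_on UNIV P" unfolding P_def by (intro continuous_on_closest_point) auto
  have Pin: "P ` UNIV \<subseteq> cball 0 1" unfolding P_def using closest_point_in_set[of "cball 0 1"] by auto
  define d where "d y = v (P y) - u (P y)" for y
  have "d x \<le> 0"
  proof (rule weakly_harmonic_nonpos[OF _ _ _ x])
    show "continuous_on UNIV d" unfolding d_def
      by (intro continuous_on_diff continuous_on_compose2[OF cont(1) Pc Pin] continuous_on_compose2[OF cont(2) Pc Pin])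
    show "d y \<le> 0" if "norm y = 1" for y
      using that u v by (simp add: d_def P weak_solution_def)
    fix \<phi> :: "real^'n \<Rightarrow> real" assume \<phi>: "\<phi> \<in> test_functions (ball 0 1)"
    have eq: "(LINT y|lborel. w y * laplacian \<phi> y) = (LINT y:ball 0 1|lborel. w y * laplacian \<phi> y)" for w :: "real^'n \<Rightarrow> real"
      by (rule set_integral_eq_lborel_integral[symmetric]) (use test_functionsD(5)[OF \<phi>] in simp)
    have "(LINT y|lborel. v y * laplacian \<phi> y) = (LINT y|lborel. u y * laplacian \<phi> y)"
      unfolding eq using u v \<phi> by (simp add: weak_solution_def)
    then have "(LINT y|lborel. v y * laplacian \<phi> y - u y * laplacian \<phi> y) = 0"
      using integrable_mult_laplacian[OF \<phi> cont(1)] integrable_mult_laplacian[OF \<phi> cont(2)] by simp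
    also have "(\<lambda>y. v y * laplacian \<phi> y - u y * laplacian \<phi> y) = (\<lambda>y. d y * laplacian \<phi> y)"
    proof
      fix y
      show "v y * laplacian \<phi> y - u y * laplacian \<phi> y = d y * laplacian \<phi> y"
      proof (cases "norm y < 1")
        case True
        then show ?thesis by (simp add: d_def P left_diff_distrib)
      next
        case False
        then show ?thesis using test_functionsD(5)[OF \<phi>, of y] by simp
      qed
    qed
    finally show "(LINT y|lborel. d y * laplacian \<phi> y) = 0" .
  qed
  then show ?thesis using P[OF x] by (simp add: d_def)
qed

theorem theorem3p1:
  fixes \<Gamma> :: "(real^'n::finite) set" and k :: 'n and g :: "real^'n \<Rightarrow> real"
  assumes "CARD('n) \<ge> 2"
    and "closed_C1_hypersurface \<Gamma>"
    and "\<Gamma> \<subseteq> ball 0 1"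
    and "\<Gamma> \<inter> ball 0 (1/4) =
      {x \<in> ball 0 (1/4). x $ k =
         (if horizontal k x = 0 then 0
          else norm (horizontal k x) / \<bar>ln (norm (horizontal k x))\<bar>)}"
    and "g = (\<lambda>_. 1)"
  shows "\<exists>u. weak_solution (ball 0 1) \<Gamma> g u \<and>
      (\<forall>v. weak_solution (ball 0 1) \<Gamma> g v \<longrightarrow> (\<forall>x\<in>closure (ball 0 1). v x = u x)) \<and>
      \<not> locally_lipschitz_on (ball 0 1) u"
proof -
  interpret cusp_surface \<Gamma> k by standard (use assms in blast)+
  obtain u where u: "weak_solution (ball 0 1) \<Gamma> g u"
    using ex_weak_solution_cusp assms(5) by blast
  \<comment> \<open>Comparison in both directions gives uniqueness on the closed ball.\<close>
  have "v x = u x" if "weak_solution (ball 0 1) \<Gamma> g v" "x \<in> closure (ball 0 1)" for v x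
    using weak_solution_le[OF u that(1), of x] weak_solution_le[OF that(1) u, of x] that(2) by simp
  then show ?thesis using u weak_solution_not_lipschitz[of u] assms(5) by blast
qed

end
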